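(* Let $0\ne I\subsetneq k[\mathbf{P}^N]$ be a homogeneous ideal. (a) Then $\alpha(I)/\gamma(I)\le\rho(I)$. (b) If in addition $I$ defines a $0$-dimensional subscheme of $\mathbf{P}^N$, then $\rho(I)\le \mathrm{reg}(I)/\gamma(I)$.
   Context: $k$ is an arbitrary algebraically closed field, $N\ge 1$, and $k[\mathbf{P}^N]=k[x_0,\dots,x_N]$ is the polynomial ring with its standard grading. Symbolic powers: for a homogeneous ideal $0\ne I\subsetneq R=k[\mathbf{P}^N]$ and $m\ge 1$, $I^{(m)}$ is the contraction to $R$ of $I^mR_A$, where $R_A$ is the localization of $R$ at the multiplicative system $A$ equal to the complement of the union of the associated primes of $I$. Resurgence: $\rho(I)=\sup\{m/r : m,r\ge 1 \text{ integers},\ I^{(m)}\not\subseteq I^r\}$. $\alpha(J)$, for a nonzero homogeneous ideal $J$, is the least degree $t$ with $J_t\ne 0$ (where $J_t$ is the homogeneous component of degree $t$). $\gamma(I)=\lim_{m\to\infty}\alpha(I^{(m)})/m$; this limit exists by subadditivity of $m\mapsto\alpha(I^{(m)})$, and is positive. $\mathrm{reg}(I)$ is the Castelnuovo–Mumford regularity: if $0\to F_N\to\cdots\to F_0\to I\to 0$ is a minimal graded free resolution over $R$ with $F_i=\bigoplus_j R[-b_{ij}]$, then $\mathrm{reg}(I)=\max_{i,j}(b_{ij}-i)$. "Defines a $0$-dimensional subscheme" means the closed subscheme of $\mathbf{P}^N$ determined by $I$ is nonempty of dimension $0$; $I$ is not required to be saturated. *)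

theory Defs
  imports
    "HOL-Library.Poly_Mapping"
    "HOL-Library.Cardinality"
    "HOL-Library.Extended_Nat"
    "HOL-Library.Extended_Real"
    "HOL-Computational_Algebra.Fraction_Field"
    "HOL-Computational_Algebra.Polynomial"
    "HOL-Analysis.Abstract_Topology"
    "Jordan_Normal_Form.Matrix_Kernel"
begin

section \<open>The graded polynomial ring\<close>

text \<open>
  The variables are indexed by a finite type \<open>'n\<close> with \<open>CARD('n) = N + 1\<close>, so that the
  coordinate ring of projective \<open>N\<close>-space over \<open>'k\<close> is the type \<open>('n, 'k) mpol\<close>. The order on
  \<open>'n\<close> only serves to obtain the library's \<open>idom\<close> instance.
\<close>

type_synonym ('n, 'k) mpol = "('n \<Rightarrow>\<^sub>0 nat) \<Rightarrow>\<^sub>0 'k"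

definition mon_degree :: "('n::finite \<Rightarrow>\<^sub>0 nat) \<Rightarrow> nat" where
  "mon_degree t = (\<Sum>i\<in>UNIV. Poly_Mapping.lookup t i)"

text \<open>
  The degree is an integer, so that entries of graded matrices may have negative degree (and then
  vanish). The zero polynomial is homogeneous of every degree.
\<close>

definition homogeneous :: "int \<Rightarrow> ('n::finite, 'k::zero) mpol \<Rightarrow> bool" where
  "homogeneous d f \<longleftrightarrow> (\<forall>t\<in>Poly_Mapping.keys f. int (mon_degree t) = d)"

definition homogeneous_elements :: "('n::finite, 'k::zero) mpol set" where
  "homogeneous_elements = {f. \<exists>d. homogeneous d f}"

definition variable :: "'n \<Rightarrow> ('n, 'k::zero_neq_one) mpol" where
  "variable i = Poly_Mapping.single (Poly_Mapping.single i 1) 1"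


section \<open>Ideals\<close>

text \<open>An ideal is a submodule of the ring over itself.\<close>

interpretation ring_module: Modules.module "(*) :: 'a::comm_ring_1 \<Rightarrow> 'a \<Rightarrow> 'a"
  by standard (auto simp: algebra_simps)

abbreviation is_ideal :: "'a::comm_ring_1 set \<Rightarrow> bool" where
  "is_ideal \<equiv> Modules.module.subspace (*)"

abbreviation ideal_span :: "'a::comm_ring_1 set \<Rightarrow> 'a set" where
  "ideal_span \<equiv> Modules.module.span (*)"

primrec ideal_power :: "'a::comm_ring_1 set \<Rightarrow> nat \<Rightarrow> 'a set" where
  "ideal_power I 0 = UNIV"
| "ideal_power I (Suc n) = ideal_span {a * b | a b. a \<in> I \<and> b \<in> ideal_power I n}"

definition is_prime_ideal :: "'a::comm_ring_1 set \<Rightarrow> bool" where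
  "is_prime_ideal P \<longleftrightarrow> is_ideal P \<and> P \<noteq> UNIV \<and> (\<forall>a b. a * b \<in> P \<longrightarrow> a \<in> P \<or> b \<in> P)"

text \<open>The associated primes of \<open>R/I\<close>, i.e. the primes of the form \<open>(I : f)\<close>.\<close>

definition associated_primes :: "'a::comm_ring_1 set \<Rightarrow> 'a set set" where
  "associated_primes I = {P. is_prime_ideal P \<and> (\<exists>f. P = {g. g * f \<in> I})}"

definition homogeneous_ideal :: "('n::finite, 'k::comm_ring_1) mpol set \<Rightarrow> bool" where
  "homogeneous_ideal I \<longleftrightarrow> (\<exists>S \<subseteq> homogeneous_elements. I = ideal_span S)"

definition irrelevant_ideal :: "('n::finite, 'k::comm_ring_1) mpol set" where
  "irrelevant_ideal = ideal_span (range variable)"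


section \<open>Symbolic powers and resurgence\<close>

text \<open>
  The localization of an integral domain at a multiplicative system without zero, realized inside
  the fraction field, and the extension of an ideal to it.
\<close>

definition localization :: "'a::idom set \<Rightarrow> 'a fract set" where
  "localization A = {Fract a s | a s. s \<in> A}"

definition extended_ideal :: "'a::idom set \<Rightarrow> 'a set \<Rightarrow> 'a fract set" where
  "extended_ideal A J = {\<Sum>i<n. c i * Fract (g i) 1 | (n::nat) c g.
     \<forall>i<n. c i \<in> localization A \<and> g i \<in> J}"

definition symbolic_power :: "'a::idom set \<Rightarrow> nat \<Rightarrow> 'a set" where
  "symbolic_power I m =
     {f. Fract f 1 \<in> extended_ideal (- \<Union>(associated_primes I)) (ideal_power I m)}"

text \<open>The supremum is taken in the extended reals, so it makes sense without a finiteness proof.\<close>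

definition resurgence :: "'a::idom set \<Rightarrow> ereal" where
  "resurgence I = Sup {ereal (real m / real r) | m r.
     m \<ge> 1 \<and> r \<ge> 1 \<and> \<not> symbolic_power I m \<subseteq> ideal_power I r}"

definition hom_component :: "('n::finite, 'k::zero) mpol set \<Rightarrow> nat \<Rightarrow> ('n, 'k) mpol set" where
  "hom_component J t = {f \<in> J. homogeneous (int t) f}"

definition alpha :: "('n::finite, 'k::zero) mpol set \<Rightarrow> nat" where
  "alpha J = (LEAST t. hom_component J t \<noteq> {0})"

definition gamma :: "('n::{finite,linorder}, 'k::idom) mpol set \<Rightarrow> real" where
  "gamma I = lim (\<lambda>m. real (alpha (symbolic_power I m)) / real m)"


section \<open>Castelnuovo-Mumford regularity\<close>

text \<open>
  The list \<open>b i\<close> holds the shifts of \<open>F\<^sub>i = \<Oplus>\<^sub>j R[- b i ! j]\<close> and \<open>\<phi> i\<close> is the matrix of the map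
  \<open>F\<^sub>i \<rightarrow> F\<^sub>i\<^sub>-\<^sub>1\<close>, where \<open>\<phi> 0\<close> is the augmentation \<open>F\<^sub>0 \<rightarrow> I \<subseteq> R = R[0]\<close>. As the generator of
  \<open>R[-b]\<close> has degree \<open>b\<close>, such a map preserves degrees iff its entries are homogeneous of degree
  source shift minus target shift. The modules \<open>F\<^sub>i\<close> with \<open>i > N\<close> are zero, so the exactness
  condition at \<open>i = N\<close> is injectivity of \<open>\<phi> N\<close>. Minimality means that the image of
  \<open>F\<^sub>i\<^sub>+\<^sub>1 \<rightarrow> F\<^sub>i\<close> lies in the irrelevant ideal times \<open>F\<^sub>i\<close>.
\<close>

definition target_shifts :: "(nat \<Rightarrow> int list) \<Rightarrow> nat \<Rightarrow> int list" where
  "target_shifts b i = (case i of 0 \<Rightarrow> [0] | Suc j \<Rightarrow> b j)"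

definition minimal_graded_free_resolution ::
    "('n::finite, 'k::comm_ring_1) mpol set \<Rightarrow> (nat \<Rightarrow> int list) \<Rightarrow>
     (nat \<Rightarrow> ('n, 'k) mpol mat) \<Rightarrow> bool" where
  "minimal_graded_free_resolution I b \<phi> \<longleftrightarrow>
     (\<forall>i. i > CARD('n) - 1 \<longrightarrow> b i = []) \<and>
     (\<forall>i. \<phi> i \<in> carrier_mat (length (target_shifts b i)) (length (b i))) \<and>
     (\<forall>i. \<forall>p < length (target_shifts b i). \<forall>q < length (b i).
        homogeneous (b i ! q - target_shifts b i ! p) (\<phi> i $$ (p, q))) \<and>
     {(\<phi> 0 *\<^sub>v v) $ 0 | v. v \<in> carrier_vec (length (b 0))} = I \<and>
     (\<forall>i. {\<phi> (Suc i) *\<^sub>v v | v. v \<in> carrier_vec (length (b (Suc i)))} = mat_kernel (\<phi> i)) \<and>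
     (\<forall>i. \<forall>p < length (b i). \<forall>q < length (b (Suc i)).
        \<phi> (Suc i) $$ (p, q) \<in> irrelevant_ideal)"

text \<open>
  A minimal resolution exists by Hilbert's syzygy theorem, and its shifts are unique up to order;
  hence the choice below is immaterial.
\<close>

definition regularity :: "('n::finite, 'k::comm_ring_1) mpol set \<Rightarrow> int" where
  "regularity I = (SOME d. \<exists>b \<phi>. minimal_graded_free_resolution I b \<phi> \<and>
     d = Max {b i ! j - int i | i j. i \<le> CARD('n) - 1 \<and> j < length (b i)})"


section \<open>Closed subschemes of projective space\<close>

definition Proj :: "('n::finite, 'k::comm_ring_1) mpol set set" where
  "Proj = {P. is_prime_ideal P \<and> homogeneous_ideal P \<and> \<not> irrelevant_ideal \<subseteq> P}"

definition proj_zeros :: "('n::finite, 'k::comm_ring_1) mpol set \<Rightarrow> ('n, 'k) mpol set set" where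
  "proj_zeros S = {P \<in> Proj. S \<subseteq> P}"

definition proj_topology :: "('n::finite, 'k::comm_ring_1) mpol set topology" where
  "proj_topology = topology (\<lambda>U. \<exists>S \<subseteq> homogeneous_elements. U = Proj - proj_zeros S)"

lemma homogeneous_mult:
  fixes f g :: "('n::finite, 'k::comm_ring_1) mpol"
  assumes "homogeneous d f" "homogeneous e g"
  shows "homogeneous (d + e) (f * g)"
  unfolding homogeneous_def
proof
  fix t assume "t \<in> Poly_Mapping.keys (f * g)"
  then obtain u v where "u \<in> Poly_Mapping.keys f" "v \<in> Poly_Mapping.keys g" "t = u + v"
    using keys_mult[of f g] by blast
  then show "int (mon_degree t) = d + e"
    using assms by (auto simp: homogeneous_def mon_degree_def lookup_add sum.distrib)
qed

lemma istopology_proj: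
  "istopology (\<lambda>U. \<exists>S \<subseteq> (homogeneous_elements :: ('n::finite, 'k::comm_ring_1) mpol set).
     U = Proj - proj_zeros S)"
  (is "istopology ?open")
  unfolding istopology_def
proof (intro conjI allI impI)
  fix U V assume "?open U" "?open V"
  then obtain S T where ST: "S \<subseteq> homogeneous_elements" "T \<subseteq> homogeneous_elements"
    "U = Proj - proj_zeros S" "V = Proj - proj_zeros T" by blast
  let ?W = "{s * t | s t. s \<in> S \<and> t \<in> T}"
  have "?W \<subseteq> homogeneous_elements"
    using ST(1,2) homogeneous_mult unfolding homogeneous_elements_def by blast
  moreover have "U \<inter> V = Proj - proj_zeros ?W"
  proof -
    have "?W \<subseteq> P \<longleftrightarrow> S \<subseteq> P \<or> T \<subseteq> P" if "P \<in> Proj" for P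
    proof
      assume W: "?W \<subseteq> P"
      show "S \<subseteq> P \<or> T \<subseteq> P"
      proof (rule ccontr)
        assume "\<not> (S \<subseteq> P \<or> T \<subseteq> P)"
        then obtain s t where "s \<in> S" "t \<in> T" "s \<notin> P" "t \<notin> P" by blast
        moreover from this have "s * t \<in> P" using W by blast
        ultimately show False using that by (auto simp: Proj_def is_prime_ideal_def)
      qed
    next
      have "is_ideal P" using that by (simp add: Proj_def is_prime_ideal_def)
      then have "s * t \<in> P" if "s \<in> P \<or> t \<in> P" for s t
        using that ring_module.subspace_scale[of P t s] ring_module.subspace_scale[of P s t]
        by (auto simp: mult.commute)
      then show "S \<subseteq> P \<or> T \<subseteq> P \<Longrightarrow> ?W \<subseteq> P" by blast
    qed
    then show ?thesis unfolding ST proj_zeros_def by blast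
  qed
  ultimately show "?open (U \<inter> V)" by blast
next
  fix K assume "\<forall>U\<in>K. ?open U"
  then obtain S where S: "\<And>U. U \<in> K \<Longrightarrow> S U \<subseteq> homogeneous_elements"
    "\<And>U. U \<in> K \<Longrightarrow> U = Proj - proj_zeros (S U)" by metis
  have "\<Union>K = Proj - proj_zeros (\<Union>U\<in>K. S U)"
  proof -
    have "\<Union>K = (\<Union>U\<in>K. Proj - proj_zeros (S U))" using S(2) by auto
    then show ?thesis by (auto simp: proj_zeros_def)
  qed
  then show "?open (\<Union>K)" using S(1) by (intro exI[of _ "\<Union>U\<in>K. S U"]) auto
qed

lemma openin_proj_topology:
  "openin proj_topology U \<longleftrightarrow> (\<exists>S \<subseteq> homogeneous_elements. U = Proj - proj_zeros S)"
  unfolding proj_topology_def by (simp add: topology_inverse'[OF istopology_proj])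

definition irreducible_in :: "'a topology \<Rightarrow> 'a set \<Rightarrow> bool" where
  "irreducible_in X Z \<longleftrightarrow> Z \<subseteq> topspace X \<and> Z \<noteq> {} \<and>
     (\<forall>C D. closedin X C \<and> closedin X D \<and> Z \<subseteq> C \<union> D \<longrightarrow> Z \<subseteq> C \<or> Z \<subseteq> D)"

text \<open>The supremum of the empty set is \<open>0\<close> here, so the empty space has to be excluded separately.\<close>

definition krull_dimension :: "'a topology \<Rightarrow> enat" where
  "krull_dimension X = Sup {enat n | n. \<exists>Z :: nat \<Rightarrow> 'a set.
     (\<forall>i\<le>n. closedin X (Z i) \<and> irreducible_in X (Z i)) \<and> (\<forall>i<n. Z i \<subset> Z (Suc i))}"

definition defines_zero_dim_subscheme :: "('n::finite, 'k::comm_ring_1) mpol set \<Rightarrow> bool" where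
  "defines_zero_dim_subscheme I \<longleftrightarrow> proj_zeros I \<noteq> {} \<and>
     krull_dimension (subtopology proj_topology (proj_zeros I)) = 0"

end

theory Submission
  imports Defs
begin

text \<open>
  Lower bound. An element of \<open>I\<^sup>(\<^sup>m\<^sup>)\<close> vanishes to order \<open>m\<close> along an associated prime of \<open>I\<close>, so its
  Taylor coefficients of order below \<open>m\<close> lie in that prime; hence its degree is at least \<open>m\<close> and
  \<open>\<gamma> \<ge> 1\<close>. If \<open>m/r < \<alpha>/\<gamma>\<close>, then \<open>\<alpha>(I\<^sup>(\<^sup>k\<^sup>m\<^sup>)) < k r \<alpha>(I)\<close> for large \<open>k\<close>, which is below every degree
  occurring in the \<open>kr\<close>-th power of \<open>I\<close>.

  Upper bound. Let \<open>d = reg(I)\<close>. If the irrelevant ideal is associated to \<open>I\<close>, then symbolic and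
  ordinary powers agree. Otherwise some linear form \<open>l\<close> is a nonzerodivisor modulo \<open>I\<close>. Reducing a
  minimal resolution modulo \<open>l\<close> and further variables and following a socle element of \<open>R/(I, l)\<close>
  along it shows \<open>R\<^sub>t \<subseteq> I + (l)\<close> for \<open>t \<ge> d\<close>. As the syzygies of \<open>I\<close> have degree at most \<open>d + 1\<close>, it
  follows by induction on \<open>r\<close> that \<open>l\<close> is a nonzerodivisor modulo \<open>I\<^sup>r\<close> in degrees at least \<open>rd\<close>. In
  dimension \<open>0\<close>, \<open>I\<^sup>(\<^sup>m\<^sup>)\<close> is the saturation of \<open>I\<^sup>m\<close> with respect to \<open>l\<close>, so it is contained in \<open>I\<^sup>r\<close>
  as soon as \<open>m \<ge> r\<close> and \<open>m\<gamma> \<ge> rd\<close>.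
\<close>

(* This rule would loop with associativity of multiplication. *)
declare ring_module.scale_scale [simp del]

text \<open>\<open>regularity\<close> is a choice, so a minimal resolution must be constructed
  before anything can be read off it; the argument then uses the shifts of whichever resolution was
  chosen. The ideal I may be unsaturated. If the irrelevant ideal is associated to I, every element
  of the system A has a nonzero constant term, and modulo a graded ideal such a factor cancels
  degree by degree. The characteristic is arbitrary, so vanishing order is measured by Taylor
  coefficients (Hasse derivatives) rather than partial derivatives.

  The degree count in the induction on r is exact. Let l f lie in I^(r+1) with deg f = e >= (r+1)d.
  Coefficients of f over generators of degree at most d have degree at least e - d >= rd, and
  coefficients over syzygies of degree at most d + 1 in a relation of degree e + 1 again have degree
  at least e - d. The higher shifts enter through the socle.

  Dimension 0 says that graded primes over I other than the irrelevant ideal are incomparable.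
  Combined with a product of graded primes contained in I, this takes the place of primary
  decomposition: it yields l and shows that powers of l suffice as multipliers.\<close>

section \<open>Homogeneous components and homogeneous ideals\<close>

lemma poly_mapping_sum_single:
  "(\<Sum>t\<in>Poly_Mapping.keys f. Poly_Mapping.single t (Poly_Mapping.lookup f t)) = f"
  by (intro poly_mapping_eqI)
     (auto simp: lookup_sum lookup_single when_def sum.delta in_keys_iff)

lemma times_eq_sum_single:
  fixes f g :: "'a::comm_monoid_add \<Rightarrow>\<^sub>0 'b::comm_semiring_0"
  shows "f * g = (\<Sum>u\<in>Poly_Mapping.keys f. \<Sum>v\<in>Poly_Mapping.keys g.
    Poly_Mapping.single (u + v) (Poly_Mapping.lookup f u * Poly_Mapping.lookup g v))"
proof -
  have "f * g = (\<Sum>u\<in>Poly_Mapping.keys f. Poly_Mapping.single u (Poly_Mapping.lookup f u)) *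
      (\<Sum>v\<in>Poly_Mapping.keys g. Poly_Mapping.single v (Poly_Mapping.lookup g v))"
    by (simp add: poly_mapping_sum_single)
  then show ?thesis by (simp add: sum_product mult_single)
qed

lemma lookup_times_sum:
  fixes f g :: "'a::comm_monoid_add \<Rightarrow>\<^sub>0 'b::comm_semiring_0"
  shows "Poly_Mapping.lookup (f * g) t = (\<Sum>u\<in>Poly_Mapping.keys f. \<Sum>v\<in>Poly_Mapping.keys g.
    (Poly_Mapping.lookup f u * Poly_Mapping.lookup g v when u + v = t))"
  by (subst times_eq_sum_single) (simp add: lookup_sum lookup_single)

lemma mon_degree_add [simp]: "mon_degree (s + t) = mon_degree s + mon_degree t"
  by (simp add: mon_degree_def lookup_add sum.distrib)

lemma mon_degree_0 [simp]: "mon_degree 0 = 0"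
  by (simp add: mon_degree_def)

lemma mon_degree_eq_0_iff [simp]: "mon_degree t = 0 \<longleftrightarrow> t = 0"
  by (auto simp: mon_degree_def intro: poly_mapping_eqI)

lemma single_eq_0_iff [simp]: "Poly_Mapping.single i m = 0 \<longleftrightarrow> m = 0"
  by (metis lookup_single_eq lookup_zero single_zero)

lemma lookup_variable_0 [simp]: "Poly_Mapping.lookup (variable i) 0 = 0"
  by (simp add: variable_def lookup_single when_def)

lemma mon_degree_single [simp]: "mon_degree (Poly_Mapping.single i m) = m"
  by (simp add: mon_degree_def lookup_single when_def)

lemma homogeneous_0 [simp]: "homogeneous d 0"
  by (simp add: homogeneous_def)

lemma homogeneous_single: "homogeneous (int (mon_degree t)) (Poly_Mapping.single t c)"
  by (simp add: homogeneous_def)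

lemma homogeneous_const [simp]: "homogeneous 0 (Poly_Mapping.single 0 c)"
  using homogeneous_single[of 0 c] by simp

lemma homogeneous_1 [simp]: "homogeneous 0 (1 :: ('n::finite, 'k::zero_neq_one) mpol)"
  by (simp add: homogeneous_def)

lemma homogeneous_variable [simp]: "homogeneous 1 (variable i)"
  using homogeneous_single[of "Poly_Mapping.single i 1" 1] by (simp add: variable_def)

lemma homogeneous_add:
  "homogeneous d f \<Longrightarrow> homogeneous d g \<Longrightarrow> homogeneous d (f + g)"
  for f g :: "('n::finite, 'k::monoid_add) mpol"
  using Poly_Mapping.keys_add[of f g] by (auto simp: homogeneous_def)

lemma homogeneous_sum:
  "(\<And>i. i \<in> A \<Longrightarrow> homogeneous d (f i)) \<Longrightarrow> homogeneous d (sum f A)"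
  for f :: "_ \<Rightarrow> ('n::finite, 'k::comm_monoid_add) mpol"
  by (induction A rule: infinite_finite_induct) (auto intro: homogeneous_add)

lemma homogeneous_power:
  "homogeneous d f \<Longrightarrow> homogeneous (int n * d) (f ^ n)"
  for f :: "('n::finite, 'k::comm_ring_1) mpol"
  by (induction n) (auto simp: algebra_simps dest: homogeneous_mult)

lemma homogeneous_negative: "homogeneous d f \<Longrightarrow> d < 0 \<Longrightarrow> f = 0"
  for f :: "('n::finite, 'k::zero) mpol"
  by (metis all_not_in_conv homogeneous_def keys_eq_empty of_nat_0_le_iff not_le)

lemma homogeneous_degree_0: "homogeneous 0 f \<Longrightarrow> f = Poly_Mapping.single 0 (Poly_Mapping.lookup f 0)"
  for f :: "('n::finite, 'k::zero) mpol"
  by (intro poly_mapping_eqI) (auto simp: homogeneous_def lookup_single when_def in_keys_iff)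

definition hcomp :: "int \<Rightarrow> ('n::finite, 'k::zero) mpol \<Rightarrow> ('n, 'k) mpol" where
  "hcomp d f = Poly_Mapping.mapp (\<lambda>t c. c when int (mon_degree t) = d) f"

lemma lookup_hcomp:
  "Poly_Mapping.lookup (hcomp d f) t = (Poly_Mapping.lookup f t when int (mon_degree t) = d)"
  by (auto simp: hcomp_def lookup_mapp when_def in_keys_iff)

lemma homogeneous_hcomp [simp]: "homogeneous d (hcomp d f)"
  by (auto simp: homogeneous_def in_keys_iff lookup_hcomp when_def split: if_splits)

lemma hcomp_homogeneous: "homogeneous e f \<Longrightarrow> hcomp d f = (if d = e then f else 0)"
  by (rule poly_mapping_eqI) (auto simp: lookup_hcomp when_def homogeneous_def in_keys_iff)

lemma hcomp_0 [simp]: "hcomp d 0 = 0"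
  by (rule poly_mapping_eqI) (simp add: lookup_hcomp)

lemma hcomp_add: "hcomp d (f + g) = hcomp d f + hcomp d g"
  for f g :: "('n::finite, 'k::monoid_add) mpol"
  by (rule poly_mapping_eqI) (simp add: lookup_hcomp lookup_add when_def)

lemma hcomp_diff: "hcomp d (f - g) = hcomp d f - hcomp d g"
  for f g :: "('n::finite, 'k::ab_group_add) mpol"
  by (rule poly_mapping_eqI) (simp add: lookup_hcomp lookup_minus when_def)

lemma hcomp_sum: "hcomp d (sum f A) = (\<Sum>i\<in>A. hcomp d (f i))"
  for f :: "_ \<Rightarrow> ('n::finite, 'k::comm_monoid_add) mpol"
  by (induction A rule: infinite_finite_induct) (auto simp: hcomp_add)

lemma keys_hcomp: "Poly_Mapping.keys (hcomp d f) = {t \<in> Poly_Mapping.keys f. int (mon_degree t) = d}"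
  by (auto simp: in_keys_iff lookup_hcomp)

definition hdegrees :: "('n::finite, 'k::zero) mpol \<Rightarrow> int set" where
  "hdegrees f = (\<lambda>t. int (mon_degree t)) ` Poly_Mapping.keys f"

lemma finite_hdegrees [simp]: "finite (hdegrees f)"
  by (simp add: hdegrees_def)

lemma hdegrees_nonneg: "d \<in> hdegrees f \<Longrightarrow> d \<ge> 0"
  by (auto simp: hdegrees_def)

lemma hcomp_eq_0_iff: "hcomp d f = 0 \<longleftrightarrow> d \<notin> hdegrees f"
  unfolding keys_eq_empty[symmetric] keys_hcomp hdegrees_def by auto

lemma hdegrees_eq_empty [simp]: "hdegrees f = {} \<longleftrightarrow> f = 0"
  by (simp add: hdegrees_def)

lemma sum_hcomp: "(\<Sum>d\<in>hdegrees f. hcomp d f) = f"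
  for f :: "('n::finite, 'k::comm_monoid_add) mpol"
  by (rule poly_mapping_eqI)
     (auto simp: lookup_sum lookup_hcomp when_def sum.delta' hdegrees_def in_keys_iff)

lemma hcomp_mult_homogeneous:
  fixes f g :: "('n::finite, 'k::comm_ring_1) mpol"
  assumes "homogeneous e f"
  shows "hcomp d (f * g) = f * hcomp (d - e) g"
proof -
  have "hcomp d (f * g) = hcomp d (f * (\<Sum>c\<in>hdegrees g. hcomp c g))"
    by (simp add: sum_hcomp)
  also have "\<dots> = (\<Sum>c\<in>hdegrees g. hcomp d (f * hcomp c g))"
    by (simp add: sum_distrib_left hcomp_sum)
  also have "\<dots> = (\<Sum>c\<in>hdegrees g. if c = d - e then f * hcomp c g else 0)"
    by (intro sum.cong refl, subst hcomp_homogeneous[OF homogeneous_mult[OF assms homogeneous_hcomp]]) auto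
  also have "\<dots> = f * hcomp (d - e) g"
    using hcomp_eq_0_iff[of "d - e" g] by (auto simp: sum.delta)
  finally show ?thesis .
qed

lemma hcomp_mult:
  fixes f g :: "('n::finite, 'k::comm_ring_1) mpol"
  shows "hcomp d (f * g) = (\<Sum>e\<in>hdegrees f. hcomp e f * hcomp (d - e) g)"
proof -
  have "hcomp d (f * g) = hcomp d ((\<Sum>e\<in>hdegrees f. hcomp e f) * g)"
    by (simp add: sum_hcomp)
  then show ?thesis
    by (simp add: sum_distrib_right hcomp_sum hcomp_mult_homogeneous[OF homogeneous_hcomp])
qed

section \<open>Ideals, graded ideals and their powers\<close>

lemma is_idealD:
  assumes "is_ideal I"
  shows ideal_0: "0 \<in> I" and ideal_add: "\<And>a b. a \<in> I \<Longrightarrow> b \<in> I \<Longrightarrow> a + b \<in> I"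
    and ideal_diff: "\<And>a b. a \<in> I \<Longrightarrow> b \<in> I \<Longrightarrow> a - b \<in> I"
    and ideal_mult_left: "\<And>a b. a \<in> I \<Longrightarrow> b * a \<in> I"
    and ideal_mult_right: "\<And>a b. a \<in> I \<Longrightarrow> a * b \<in> I"
  using ring_module.subspace_0[OF assms] ring_module.subspace_add[OF assms]
    ring_module.subspace_diff[OF assms] ring_module.subspace_scale[OF assms]
  by (auto simp: mult.commute)

lemma ideal_sum: "is_ideal I \<Longrightarrow> (\<And>i. i \<in> A \<Longrightarrow> f i \<in> I) \<Longrightarrow> sum f A \<in> I"
  by (rule ring_module.subspace_sum)

lemma is_idealI:
  assumes "0 \<in> I" "\<And>a b. a \<in> I \<Longrightarrow> b \<in> I \<Longrightarrow> a + b \<in> I" "\<And>a b. a \<in> I \<Longrightarrow> b * a \<in> I"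
  shows "is_ideal I"
  using assms by (auto simp: ring_module.subspace_def)

lemma ideal_eq_UNIV_iff: "is_ideal I \<Longrightarrow> I = UNIV \<longleftrightarrow> 1 \<in> I"
  using ideal_mult_left[of I 1] by auto

text \<open>The working form of \<open>homogeneous_ideal\<close>: closure under components can be
  checked element by element, without choosing homogeneous generators.\<close>

definition graded :: "('n::finite, 'k::comm_ring_1) mpol set \<Rightarrow> bool" where
  "graded I \<longleftrightarrow> is_ideal I \<and> (\<forall>f\<in>I. \<forall>d. hcomp d f \<in> I)"

lemma graded_ideal: "graded I \<Longrightarrow> is_ideal I"
  and graded_hcomp: "graded I \<Longrightarrow> f \<in> I \<Longrightarrow> hcomp d f \<in> I"
  by (auto simp: graded_def)

lemma graded_memI: "graded I \<Longrightarrow> (\<And>d. d \<in> hdegrees f \<Longrightarrow> hcomp d f \<in> I) \<Longrightarrow> f \<in> I"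
  by (metis sum_hcomp ideal_sum graded_ideal)

text \<open>Testing generators suffices because the elements all of whose components lie in the span
  form an ideal.\<close>

lemma graded_span:
  assumes "\<And>f d. f \<in> S \<Longrightarrow> hcomp d f \<in> ideal_span S"
  shows "graded (ideal_span S)"
  unfolding graded_def
proof (intro conjI ballI)
  fix f assume "f \<in> ideal_span S"
  moreover have "is_ideal {f. \<forall>d. hcomp d f \<in> ideal_span S}"
  proof (intro is_idealI CollectI allI)
    fix a b d assume *: "a \<in> {f. \<forall>d. hcomp d f \<in> ideal_span S}"
    show "hcomp d (b * a) \<in> ideal_span S"
      unfolding hcomp_mult using *
      by (intro ring_module.span_sum ring_module.span_scale) simp
    show "hcomp d (a + b) \<in> ideal_span S" if "b \<in> {f. \<forall>d. hcomp d f \<in> ideal_span S}"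
      unfolding hcomp_add using * that by (intro ring_module.span_add) simp_all
  qed (simp add: ring_module.span_zero)
  ultimately have "f \<in> {f. \<forall>d. hcomp d f \<in> ideal_span S}"
    using ring_module.span_minimal[of S "{f. \<forall>d. hcomp d f \<in> ideal_span S}"] assms by blast
  then show "\<forall>d. hcomp d f \<in> ideal_span S" by simp
qed simp

lemma homogeneous_ideal_iff_graded: "homogeneous_ideal I \<longleftrightarrow> graded I"
proof
  assume "homogeneous_ideal I"
  then obtain S where S: "S \<subseteq> homogeneous_elements" "I = ideal_span S"
    by (auto simp: homogeneous_ideal_def)
  have "hcomp d f \<in> ideal_span S" if f: "f \<in> S" for f d
  proof -
    obtain e where "homogeneous e f" using f S(1) by (auto simp: homogeneous_elements_def)
    then have "hcomp d f = f \<or> hcomp d f = 0" by (simp add: hcomp_homogeneous)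
    then show ?thesis using ring_module.span_zero ring_module.span_base[OF f] by metis
  qed
  then show "graded I" unfolding S(2) by (rule graded_span)
next
  assume I: "graded I"
  let ?S = "I \<inter> homogeneous_elements"
  have "I = ideal_span ?S"
  proof
    show "I \<subseteq> ideal_span ?S"
    proof
      fix f assume "f \<in> I"
      have "(\<Sum>d\<in>hdegrees f. hcomp d f) \<in> ideal_span ?S"
        using graded_hcomp[OF I \<open>f \<in> I\<close>] homogeneous_hcomp
        unfolding homogeneous_elements_def
        by (intro ring_module.span_sum ring_module.span_base) blast
      then show "f \<in> ideal_span ?S" by (simp add: sum_hcomp)
    qed
    show "ideal_span ?S \<subseteq> I"
      using ring_module.span_minimal[of ?S I] graded_ideal[OF I] by simp
  qed
  then show "homogeneous_ideal I" unfolding homogeneous_ideal_def by blast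
qed

lemma is_ideal_power: "is_ideal (ideal_power I n)"
  by (cases n) (auto intro: is_idealI)

lemma ideal_power_mult:
  "a \<in> I \<Longrightarrow> b \<in> ideal_power I n \<Longrightarrow> a * b \<in> ideal_power I (Suc n)"
  by (auto intro!: ring_module.span_base)

text \<open>Scalars of the span are absorbed into the factor from \<open>ideal_power I n\<close>, so
  that inductions over products need no case for scaling.\<close>

lemma ideal_power_Suc_induct [consumes 1, case_names mult 0 add]:
  assumes "f \<in> ideal_power I (Suc n)"
    and "\<And>a b. a \<in> I \<Longrightarrow> b \<in> ideal_power I n \<Longrightarrow> P (a * b)"
    and "P 0" and "\<And>f g. P f \<Longrightarrow> P g \<Longrightarrow> P (f + g)"
  shows "P f"
proof -
  let ?S = "{a * b | a b. a \<in> I \<and> b \<in> ideal_power I n}"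
  have "f \<in> ideal_span ?S" using assms(1) by simp
  then show ?thesis
  proof (induction rule: ring_module.span_induct_alt)
    case (step c x y)
    then obtain a b where "x = a * b" "a \<in> I" "b \<in> ideal_power I n" by blast
    then have "P (a * (c * b))"
      using assms(2) ideal_mult_left[OF is_ideal_power] by blast
    then show ?case using step \<open>x = a * b\<close> assms(4)[of "c * x" y] by (simp add: mult_ac)
  qed (fact assms(3))
qed

lemma ideal_power_add_mult:
  "a \<in> ideal_power I m \<Longrightarrow> b \<in> ideal_power I n \<Longrightarrow> a * b \<in> ideal_power I (m + n)"
proof (induction m arbitrary: a)
  case 0
  then show ?case by (simp add: ideal_mult_left[OF is_ideal_power])
next
  case (Suc m)
  from Suc.prems(1) show ?case
  proof (induction rule: ideal_power_Suc_induct)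
    case (mult c d)
    then have "c * (d * b) \<in> ideal_power I (Suc (m + n))"
      using Suc by (intro ideal_power_mult) auto
    then show ?case by (simp add: mult.assoc)
  next
    case 0 then show ?case using ideal_0[OF is_ideal_power] by (simp del: ideal_power.simps)
  next
    case (add f g)
    then show ?case using ideal_add[OF is_ideal_power] by (simp add: distrib_right del: ideal_power.simps)
  qed
qed

lemma power_in_ideal_power: "a \<in> I \<Longrightarrow> a ^ n \<in> ideal_power I n"
  by (induction n) (simp, simp only: power_Suc ideal_power_mult)

lemma ideal_power_Suc_subset: "ideal_power I (Suc n) \<subseteq> ideal_power I n"
proof
  fix f assume "f \<in> ideal_power I (Suc n)"
  then show "f \<in> ideal_power I n"
    by (induction rule: ideal_power_Suc_induct)
       (auto intro: ideal_mult_left[OF is_ideal_power] ideal_0[OF is_ideal_power]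
         ideal_add[OF is_ideal_power])
qed

lemma ideal_power_antimono: "m \<le> n \<Longrightarrow> ideal_power I n \<subseteq> ideal_power I m"
  by (rule lift_Suc_antimono_le[of "ideal_power I"]) (rule ideal_power_Suc_subset)

lemma ideal_power_1: "is_ideal I \<Longrightarrow> ideal_power I (Suc 0) = I"
proof (intro equalityI subsetI)
  fix f assume I: "is_ideal I" and "f \<in> ideal_power I (Suc 0)"
  from this(2) show "f \<in> I"
    by (induction rule: ideal_power_Suc_induct)
       (auto intro: ideal_mult_right[OF I] ideal_0[OF I] ideal_add[OF I])
next
  fix f assume "f \<in> I"
  then show "f \<in> ideal_power I (Suc 0)" using ideal_power_mult[of f I 1 0] by simp
qed

lemma ideal_power_subset: "is_ideal I \<Longrightarrow> n \<ge> 1 \<Longrightarrow> ideal_power I n \<subseteq> I"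
  using ideal_power_antimono[of 1 n I] ideal_power_1[of I] by simp

lemma graded_ideal_power: "graded I \<Longrightarrow> graded (ideal_power I n)"
proof (induction n)
  case 0
  then show ?case by (auto simp: graded_def intro: is_idealI)
next
  case (Suc n)
  then have "graded (ideal_power I n)" by simp
  then have *: "hcomp c a * hcomp d b \<in> ideal_power I (Suc n)"
    if "a \<in> I" "b \<in> ideal_power I n" for a b c d
    using that graded_hcomp Suc.prems by (blast intro: ideal_power_mult)
  show ?case unfolding ideal_power.simps
  proof (rule graded_span)
    fix f d assume "f \<in> {a * b | a b. a \<in> I \<and> b \<in> ideal_power I n}"
    then obtain a b where "f = a * b" "a \<in> I" "b \<in> ideal_power I n" by blast
    then have "hcomp d f \<in> ideal_power I (Suc n)"
      unfolding \<open>f = a * b\<close> hcomp_mult by (intro ideal_sum[OF is_ideal_power] *)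
    then show "hcomp d f \<in> ideal_span {a * b | a b. a \<in> I \<and> b \<in> ideal_power I n}" by simp
  qed
qed

section \<open>Evaluation homomorphisms\<close>

text \<open>Coefficients are moved by \<open>h\<close> so that one definition serves both the Taylor
  expansion, whose target has polynomial coefficients, and the elimination of variables.\<close>

definition meval :: "('k \<Rightarrow> 'r) \<Rightarrow> ('n \<Rightarrow> 'r) \<Rightarrow> ('n::finite, 'k::comm_ring_1) mpol \<Rightarrow> 'r::comm_ring_1" where
  "meval h x f = (\<Sum>t\<in>Poly_Mapping.keys f.
     h (Poly_Mapping.lookup f t) * (\<Prod>i\<in>UNIV. x i ^ Poly_Mapping.lookup t i))"

locale coefficient_hom =
  fixes h :: "'k::comm_ring_1 \<Rightarrow> 'r::comm_ring_1"
  assumes h_add: "h (a + b) = h a + h b" and h_mult: "h (a * b) = h a * h b" and h_1: "h 1 = 1"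
begin

lemma h_0: "h 0 = 0"
  using h_add[of 0 0] by simp

lemma meval_superset:
  "finite K \<Longrightarrow> Poly_Mapping.keys f \<subseteq> K \<Longrightarrow> meval h x f = (\<Sum>t\<in>K.
     h (Poly_Mapping.lookup f t) * (\<Prod>i\<in>UNIV. x i ^ Poly_Mapping.lookup t i))"
  unfolding meval_def by (rule sum.mono_neutral_left) (auto simp: in_keys_iff h_0)

lemma meval_add: "meval h x (f + g) = meval h x f + meval h x g"
  using Poly_Mapping.keys_add[of f g]
  by (simp add: meval_superset[of "Poly_Mapping.keys f \<union> Poly_Mapping.keys g"]
      lookup_add h_add distrib_right sum.distrib)

lemma meval_0 [simp]: "meval h x 0 = 0"
  by (simp add: meval_def)

lemma meval_sum: "meval h x (sum f A) = (\<Sum>i\<in>A. meval h x (f i))"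
  by (induction A rule: infinite_finite_induct) (auto simp: meval_add)

lemma meval_single:
  "meval h x (Poly_Mapping.single t c) = h c * (\<Prod>i\<in>UNIV. x i ^ Poly_Mapping.lookup t i)"
  by (simp add: meval_superset[of "{t}"])

lemma meval_mult: "meval h x (f * g) = meval h x f * meval h x g"
proof -
  have "meval h x (f * g) = (\<Sum>u\<in>Poly_Mapping.keys f. \<Sum>v\<in>Poly_Mapping.keys g.
      h (Poly_Mapping.lookup f u * Poly_Mapping.lookup g v) *
      (\<Prod>i\<in>UNIV. x i ^ Poly_Mapping.lookup (u + v) i))"
    by (subst times_eq_sum_single) (simp add: meval_sum meval_single)
  then show ?thesis
    by (simp add: meval_def sum_product h_mult lookup_add power_add prod.distrib mult_ac)
qed

lemma meval_1 [simp]: "meval h x 1 = 1"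
  by (simp add: meval_single h_1 flip: single_one)

lemma meval_variable [simp]: "meval h x (variable i) = x i"
proof -
  have "(\<Prod>j\<in>UNIV. x j ^ (Suc 0 when i = j)) = x i"
    by (simp add: when_def if_distrib prod.delta' cong: if_cong)
  then show ?thesis by (simp add: variable_def meval_single h_1 lookup_single)
qed

end

lemma sum_single_lookup:
  "(\<Sum>i\<in>UNIV. Poly_Mapping.single i (Poly_Mapping.lookup t i)) = t"
  for t :: "'n::finite \<Rightarrow>\<^sub>0 'b::comm_monoid_add"
  by (intro poly_mapping_eqI) (auto simp: lookup_sum lookup_single when_def)

lemma prod_variable_powers:
  "(\<Prod>i\<in>UNIV. variable i ^ Poly_Mapping.lookup t i) =
     (Poly_Mapping.single t 1 :: ('n::finite, 'k::comm_ring_1) mpol)"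
proof -
  have pow: "variable i ^ m = (Poly_Mapping.single (Poly_Mapping.single i m) 1 :: ('n, 'k) mpol)" for i m
    by (induction m) (auto simp: variable_def mult_single single_add[symmetric])
  have pr: "(\<Prod>i\<in>A. Poly_Mapping.single (g i) 1) = (Poly_Mapping.single (sum g A) 1 :: ('n, 'k) mpol)"
    for g and A :: "'n set"
    by (induction A rule: infinite_finite_induct) (auto simp: mult_single)
  show ?thesis by (simp add: pow pr sum_single_lookup)
qed

text \<open>Monomials are products of variables, so a ring homomorphism is determined by constants
  and variables. This identifies homomorphisms without computing with sums.\<close>

lemma ring_hom_eq_meval:
  fixes F :: "('n::finite, 'k::comm_ring_1) mpol \<Rightarrow> 'r::comm_ring_1"
  assumes add: "\<And>f g. F (f + g) = F f + F g" and mult: "\<And>f g. F (f * g) = F f * F g" and one: "F 1 = 1"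
  shows "F f = meval (\<lambda>c. F (Poly_Mapping.single 0 c)) (\<lambda>i. F (variable i)) f"
proof -
  have F0: "F 0 = 0" using add[of 0 0] by simp
  have Fsum: "F (sum g A) = (\<Sum>i\<in>A. F (g i))" for g and A :: "'b set"
    by (induction A rule: infinite_finite_induct) (auto simp: add F0)
  have Fpow: "F (g ^ m) = F g ^ m" for g m by (induction m) (auto simp: mult one)
  have Fprod: "F (prod g A) = (\<Prod>i\<in>A. F (g i))" for g and A :: "'n set"
    by (induction A rule: infinite_finite_induct) (auto simp: mult one)
  have mono: "F (Poly_Mapping.single t c) = F (Poly_Mapping.single 0 c) *
      (\<Prod>i\<in>UNIV. F (variable i) ^ Poly_Mapping.lookup t i)" for t c
  proof -
    have "F (Poly_Mapping.single t c) = F (Poly_Mapping.single 0 c * Poly_Mapping.single t 1)"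
      by (simp add: mult_single)
    then show ?thesis by (simp add: mult Fpow Fprod flip: prod_variable_powers)
  qed
  have F0': "F (\<Sum>t\<in>K. g t) = (\<Sum>t\<in>K. F (g t))" for g and K :: "('n \<Rightarrow>\<^sub>0 nat) set"
    by (induction K rule: infinite_finite_induct) (auto simp: add F0)
  have "F f = F (\<Sum>t\<in>Poly_Mapping.keys f. Poly_Mapping.single t (Poly_Mapping.lookup f t))"
    by (simp add: poly_mapping_sum_single)
  also have "\<dots> = (\<Sum>t\<in>Poly_Mapping.keys f. F (Poly_Mapping.single t (Poly_Mapping.lookup f t)))"
    by (rule F0')
  also have "\<dots> = meval (\<lambda>c. F (Poly_Mapping.single 0 c)) (\<lambda>i. F (variable i)) f"
    unfolding meval_def by (intro sum.cong refl) (rule mono)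
  finally show ?thesis .
qed

section \<open>Noetherianity\<close>

text \<open>Every sequence has a monotone subsequence, and a decreasing sequence of naturals is
  constant from its minimum on, hence also nondecreasing there.\<close>

lemma nat_seq_mono_subseq: "\<exists>\<phi> :: nat \<Rightarrow> nat. strict_mono \<phi> \<and> mono (\<lambda>n. f (\<phi> n))" for f :: "nat \<Rightarrow> nat"
proof -
  obtain \<phi> :: "nat \<Rightarrow> nat" where \<phi>: "strict_mono \<phi>" "monoseq (\<lambda>n. f (\<phi> n))" using seq_monosub by blast
  show ?thesis
  proof (cases "incseq (\<lambda>n. f (\<phi> n))")
    case False
    with \<phi>(2) have dec: "decseq (\<lambda>n. f (\<phi> n))" by (simp add: monoseq_iff)
    obtain N where N: "\<And>n. f (\<phi> N) \<le> f (\<phi> n)"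
      using ex_has_least_nat[of "\<lambda>_. True" 0 "\<lambda>n. f (\<phi> n)"] by auto
    have "f (\<phi> (n + N)) = f (\<phi> N)" for n
      using N[of "n + N"] dec by (auto simp: decseq_def intro: antisym)
    then have "mono (\<lambda>n. f (\<phi> (n + N)))" by (simp add: mono_def)
    moreover have "strict_mono (\<lambda>n. \<phi> (n + N))" using \<phi>(1) by (simp add: strict_mono_def)
    ultimately show ?thesis by blast
  qed (use \<phi> in blast)
qed

lemma monomial_seq_mono_subseq:
  fixes s :: "nat \<Rightarrow> 'n::finite \<Rightarrow>\<^sub>0 nat"
  shows "\<exists>\<phi> :: nat \<Rightarrow> nat. strict_mono \<phi> \<and> (\<forall>i\<in>A. mono (\<lambda>n. Poly_Mapping.lookup (s (\<phi> n)) i))"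
proof -
  have "finite A" by simp
  then show ?thesis
  proof (induction A rule: finite_induct)
    case empty
    show ?case by (rule exI[of _ id]) (simp add: strict_mono_def)
  next
    case (insert i A)
    then obtain \<phi> :: "nat \<Rightarrow> nat" where \<phi>: "strict_mono \<phi>" "\<And>i. i \<in> A \<Longrightarrow> mono (\<lambda>n. Poly_Mapping.lookup (s (\<phi> n)) i)"
      by blast
    obtain \<psi> :: "nat \<Rightarrow> nat" where \<psi>: "strict_mono \<psi>" "mono (\<lambda>n. Poly_Mapping.lookup (s (\<phi> (\<psi> n))) i)"
      using nat_seq_mono_subseq[of "\<lambda>n. Poly_Mapping.lookup (s (\<phi> n)) i"] by blast
    have "mono (\<lambda>n. Poly_Mapping.lookup (s (\<phi> (\<psi> n))) j)" if "j \<in> A" for j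
      using \<phi>(2)[OF that] strict_mono_mono[OF \<psi>(1)] by (simp add: mono_def)
    then show ?case using \<phi>(1) \<psi> by (intro exI[of _ "\<phi> \<circ> \<psi>"]) (auto simp: strict_mono_def)
  qed
qed

text \<open>Dickson's lemma: along a subsequence on which every exponent is nondecreasing, each
  monomial divides the later ones.\<close>

lemma dickson:
  fixes s :: "nat \<Rightarrow> 'n::finite \<Rightarrow>\<^sub>0 nat"
  obtains i j u where "i < j" "s j = u + s i"
proof -
  obtain \<phi> :: "nat \<Rightarrow> nat" where \<phi>: "strict_mono \<phi>" "\<And>i. mono (\<lambda>n. Poly_Mapping.lookup (s (\<phi> n)) i)"
    using monomial_seq_mono_subseq[of UNIV s] by blast
  have "s (\<phi> 1) = (s (\<phi> 1) - s (\<phi> 0)) + s (\<phi> 0)"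
  proof (rule poly_mapping_eqI)
    fix i
    have "Poly_Mapping.lookup (s (\<phi> 0)) i \<le> Poly_Mapping.lookup (s (\<phi> 1)) i"
      using \<phi>(2)[of i] by (simp add: mono_def)
    then show "Poly_Mapping.lookup (s (\<phi> 1)) i = Poly_Mapping.lookup ((s (\<phi> 1) - s (\<phi> 0)) + s (\<phi> 0)) i"
      by (simp add: lookup_add minus_poly_mapping.rep_eq)
  qed
  moreover have "\<phi> 0 < \<phi> 1" using \<phi>(1) by (simp add: strict_mono_def)
  ultimately show ?thesis using that by blast
qed

text \<open>The order on monomials is lexicographic: it compares exponents at the first index where
  they differ. Together with compatibility with addition, minimality of 0 makes it a monomial
  order.\<close>

lemma zero_le_monomial: "0 \<le> (u :: 'n::{finite,linorder} \<Rightarrow>\<^sub>0 nat)"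
proof (cases "u = 0")
  case False
  then have ne: "Poly_Mapping.keys u \<noteq> {}" by simp
  let ?k = "Min (Poly_Mapping.keys u)"
  have "Poly_Mapping.lookup u ?k \<noteq> 0" using Min_in[OF finite_keys ne] by (simp add: in_keys_iff)
  moreover have "Poly_Mapping.lookup u k' = 0" if "k' < ?k" for k'
    using that Min_le[OF finite_keys, of k' u] by (metis in_keys_iff leD)
  ultimately have "less_fun (Poly_Mapping.lookup 0) (Poly_Mapping.lookup u)"
    by (auto simp: less_fun_def intro!: exI[of _ ?k])
  then show ?thesis by (simp add: less_eq_poly_mapping.rep_eq)
qed simp

text \<open>By Dickson's lemma an infinite descent would contain a monomial followed later by one of
  its multiples, and a multiple is never smaller.\<close>

lemma wf_monomial_less: "wf {(s, t :: 'n::{finite,linorder} \<Rightarrow>\<^sub>0 nat). s < t}"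
  unfolding wf_iff_no_infinite_down_chain
proof
  assume "\<exists>f. \<forall>i. (f (Suc i), f i) \<in> {(s, t :: 'n \<Rightarrow>\<^sub>0 nat). s < t}"
  then obtain f where f: "\<And>i. f (Suc i) < (f i :: 'n \<Rightarrow>\<^sub>0 nat)" by auto
  obtain i j u where "i < j" "f j = u + f i" using dickson by blast
  moreover have "f j < f i" using \<open>i < j\<close> by (induction rule: less_Suc_induct) (auto intro: f less_trans)
  ultimately show False using add_right_mono[OF zero_le_monomial[of u], of "f i"] by simp
qed

section \<open>Leading terms and chains of submodules of free modules\<close>

type_synonym ('n, 'k) mvec = "nat \<Rightarrow>\<^sub>0 ('n, 'k) mpol"

definition vscale :: "'r::comm_ring_1 \<Rightarrow> (nat \<Rightarrow>\<^sub>0 'r) \<Rightarrow> (nat \<Rightarrow>\<^sub>0 'r)" where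
  "vscale c v = Poly_Mapping.map ((*) c) v"

lemma lookup_vscale [simp]: "Poly_Mapping.lookup (vscale c v) i = c * Poly_Mapping.lookup v i"
  by (simp add: vscale_def Poly_Mapping.map.rep_eq when_def)

interpretation vec_module: Modules.module "vscale :: 'r::comm_ring_1 \<Rightarrow> _"
  by standard (auto intro!: poly_mapping_eqI simp: lookup_add algebra_simps)

text \<open>Finitely supported sequences put the free modules of all ranks into one type, so ranks
  appear as set membership and may vary along a complex.\<close>

definition free_mod :: "nat \<Rightarrow> (nat \<Rightarrow>\<^sub>0 'r::comm_ring_1) set" where
  "free_mod m = {v. Poly_Mapping.keys v \<subseteq> {..<m}}"

lemma free_mod_iff: "v \<in> free_mod m \<longleftrightarrow> (\<forall>i\<ge>m. Poly_Mapping.lookup v i = 0)"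
  by (auto simp: free_mod_def in_keys_iff not_less subset_iff) (metis not_less)

lemma subspace_free_mod [simp]: "vec_module.subspace (free_mod m)"
  by (auto simp: vec_module.subspace_def free_mod_iff lookup_add)

text \<open>Position over term: vectors are compared first by their last nonzero position and then
  by the largest monomial of the entry there.\<close>

definition lead_pos :: "('n, 'k::zero) mvec \<Rightarrow> nat" where
  "lead_pos v = Max (Poly_Mapping.keys v)"

definition lead_mon :: "('n::linorder, 'k::zero) mvec \<Rightarrow> ('n \<Rightarrow>\<^sub>0 nat)" where
  "lead_mon v = Max (Poly_Mapping.keys (Poly_Mapping.lookup v (lead_pos v)))"

lemma lookup_single_times:
  "Poly_Mapping.lookup (Poly_Mapping.single u c * f) (u + t) = c * Poly_Mapping.lookup f t"
  for f :: "('n, 'k::comm_ring_1) mpol"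
proof (cases "c = 0")
  case False
  then show ?thesis
    by (simp add: lookup_times_sum when_def in_keys_iff sum.delta)
qed simp

lemma keys_single_times:
  "Poly_Mapping.keys (Poly_Mapping.single u c * f) \<subseteq> (+) u ` Poly_Mapping.keys f"
  for f :: "('n, 'k::comm_ring_1) mpol"
  using keys_mult[of "Poly_Mapping.single u c" f] by (auto split: if_splits)

text \<open>One step of the division algorithm: \<open>c\<close> is the monomial \<open>u\<close>
  times the quotient of the leading coefficients, which cancels the leading term of \<open>w\<close>
  and introduces only smaller ones.\<close>

lemma lead_reduction:
  fixes v w :: "('n::{finite,linorder}, 'k::field) mvec"
  assumes "v \<noteq> 0" "w \<noteq> 0" and pos: "lead_pos v = lead_pos w" and mon: "lead_mon w = u + lead_mon v"
  obtains c where "w - vscale c v = 0 \<or>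
    lead_pos (w - vscale c v) < lead_pos w \<or>
    lead_pos (w - vscale c v) = lead_pos w \<and> lead_mon (w - vscale c v) < lead_mon w"
proof -
  let ?p = "lead_pos w"
  define a where "a = Poly_Mapping.lookup v ?p"
  define b where "b = Poly_Mapping.lookup w ?p"
  have in_keys: "lead_pos x \<in> Poly_Mapping.keys x" if "x \<noteq> 0" for x :: "('n, 'k) mvec"
    unfolding lead_pos_def using that by (intro Max_in) auto
  have "a \<noteq> 0" "b \<noteq> 0"
    using in_keys[of v] in_keys[of w] assms by (auto simp: a_def b_def in_keys_iff)
  have lm: "lead_mon v = Max (Poly_Mapping.keys a)" "lead_mon w = Max (Poly_Mapping.keys b)"
    by (simp_all add: lead_mon_def a_def b_def pos)
  define \<alpha> where "\<alpha> = Poly_Mapping.lookup a (lead_mon v)"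
  define \<beta> where "\<beta> = Poly_Mapping.lookup b (lead_mon w)"
  have "\<alpha> \<noteq> 0"
    using Max_in[OF finite_keys, of a] \<open>a \<noteq> 0\<close> by (simp add: \<alpha>_def lm in_keys_iff)
  define c where "c = Poly_Mapping.single u (\<beta> / \<alpha>)"
  define x where "x = w - vscale c v"
  have xp: "Poly_Mapping.lookup x ?p = b - c * a"
    by (simp add: x_def a_def b_def lookup_minus)
  have lt: "t < lead_mon w" if t: "t \<in> Poly_Mapping.keys (b - c * a)" for t
  proof -
    have "t \<noteq> lead_mon w"
    proof
      assume "t = lead_mon w"
      then have "Poly_Mapping.lookup (c * a) t = \<beta>"
        using \<open>\<alpha> \<noteq> 0\<close> by (simp add: mon c_def lookup_single_times \<alpha>_def)
      then show False using t \<open>t = lead_mon w\<close> by (simp add: in_keys_iff lookup_minus \<beta>_def)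
    qed
    moreover have "t \<le> lead_mon w"
    proof -
      have "t \<in> Poly_Mapping.keys b \<or> t \<in> (+) u ` Poly_Mapping.keys a"
        using t keys_single_times[of u "\<beta> / \<alpha>" a] by (auto simp: c_def in_keys_iff lookup_minus)
      then show ?thesis
      proof
        assume "t \<in> (+) u ` Poly_Mapping.keys a"
        then obtain s where "s \<in> Poly_Mapping.keys a" "t = u + s" by blast
        then show ?thesis unfolding mon lm by (auto intro: add_left_mono)
      qed (simp add: lm)
    qed
    ultimately show ?thesis by simp
  qed
  have pos_le: "lead_pos x \<le> ?p" if "x \<noteq> 0"
  proof -
    have "q \<le> ?p" if q: "q \<in> Poly_Mapping.keys x" for q
    proof -
      have "q \<in> Poly_Mapping.keys w \<or> q \<in> Poly_Mapping.keys v"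
        using q by (auto simp: x_def in_keys_iff lookup_minus)
      then show ?thesis
        using pos Max_ge[OF finite_keys, of q w] Max_ge[OF finite_keys, of q v]
        unfolding lead_pos_def by argo
    qed
    then show ?thesis using in_keys[OF that] by blast
  qed
  have "lead_mon x < lead_mon w" if "x \<noteq> 0" "lead_pos x = ?p"
  proof -
    have "b - c * a \<noteq> 0" using in_keys[OF that(1)] that(2) xp by (simp add: in_keys_iff)
    then have "lead_mon x \<in> Poly_Mapping.keys (b - c * a)"
      unfolding lead_mon_def that(2) xp by (intro Max_in) auto
    then show ?thesis by (rule lt)
  qed
  then show ?thesis using that[of c] pos_le unfolding x_def by linarith
qed

text \<open>Choose in each difference \<open>N (Suc i) - N i\<close> an element with least leading
  term. Infinitely many of these share a leading position, and by Dickson's lemma one leading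
  monomial divides a later one. Reducing the later element stays in its difference and lowers the
  leading term, a contradiction.\<close>

lemma no_infinite_submodule_chain:
  fixes N :: "nat \<Rightarrow> ('n::{finite,linorder}, 'k::field) mvec set"
  assumes sub: "\<And>i. vec_module.subspace (N i)" and bound: "\<And>i. N i \<subseteq> free_mod m"
    and inc: "\<And>i. N i \<subset> N (Suc i)"
  shows False
proof -
  let ?r = "less_than <*lex*> {(s, t :: 'n \<Rightarrow>\<^sub>0 nat). s < t}"
  let ?lead = "\<lambda>v :: ('n, 'k) mvec. (lead_pos v, lead_mon v)"
  define R where "R = inv_image ?r ?lead"
  have wf: "wf R" unfolding R_def using wf_monomial_less by (intro wf_inv_image wf_lex_prod) auto
  define least where "least i v \<longleftrightarrow> v \<in> N (Suc i) - N i \<and>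
    (\<forall>x. (x, v) \<in> R \<longrightarrow> x \<notin> N (Suc i) - N i)" for i v
  have "\<exists>v. least i v" for i
  proof -
    obtain x where "x \<in> N (Suc i) - N i" using inc[of i] by blast
    from wf[unfolded wf_eq_minimal, rule_format, OF this]
    obtain z where "z \<in> N (Suc i) - N i"
      and "\<forall>y. (y, z) \<in> R \<longrightarrow> y \<notin> N (Suc i) - N i" ..
    then have "least i z" unfolding least_def by (rule conjI)
    then show ?thesis ..
  qed
  then obtain v where least: "\<And>i. least i (v i)" by metis
  have v: "v i \<in> N (Suc i) - N i" for i
    using least[of i] unfolding least_def by (rule conjunct1)
  have v_least: "x \<notin> N (Suc i) - N i" if "(x, v i) \<in> R" for i x
    by (rule least[of i, unfolded least_def, THEN conjunct2, THEN spec, THEN mp, OF that])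
  have mono: "N i \<subseteq> N j" if "i \<le> j" for i j
    using lift_Suc_mono_le[of N, OF psubset_imp_subset[OF inc] that] .
  have nz: "v i \<noteq> 0" for i using v[of i] vec_module.subspace_0[OF sub] by auto
  have "lead_pos (v i) < m" for i
    using v[of i] bound[of "Suc i"] Max_in[OF finite_keys, of "v i"] nz[of i]
    by (auto simp: lead_pos_def free_mod_def)
  then have "finite (range (\<lambda>i. lead_pos (v i)))"
    by (meson finite_lessThan finite_subset image_subsetI lessThan_iff)
  then obtain p where "infinite {i. lead_pos (v i) = p}"
    using pigeonhole_infinite[of UNIV "\<lambda>i. lead_pos (v i)"] by auto
  then obtain \<phi> :: "nat \<Rightarrow> nat" where \<phi>: "strict_mono \<phi>" "\<And>a. lead_pos (v (\<phi> a)) = p"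
    using infinite_enumerate[of "{i. lead_pos (v i) = p}"] by auto
  obtain a b u where ab: "a < b" "lead_mon (v (\<phi> b)) = u + lead_mon (v (\<phi> a))"
    using dickson[of "\<lambda>a. lead_mon (v (\<phi> a))"] by blast
  have lt: "\<phi> a < \<phi> b" using \<phi>(1) ab(1) by (simp add: strict_mono_def)
  obtain c where "v (\<phi> b) - vscale c (v (\<phi> a)) = 0 \<or>
      lead_pos (v (\<phi> b) - vscale c (v (\<phi> a))) < lead_pos (v (\<phi> b)) \<or>
      lead_pos (v (\<phi> b) - vscale c (v (\<phi> a))) = lead_pos (v (\<phi> b)) \<and>
      lead_mon (v (\<phi> b) - vscale c (v (\<phi> a))) < lead_mon (v (\<phi> b))"
    by (rule lead_reduction[OF nz nz _ ab(2)]) (simp_all add: \<phi>(2))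
  then have c: "v (\<phi> b) - vscale c (v (\<phi> a)) = 0 \<or> (v (\<phi> b) - vscale c (v (\<phi> a)), v (\<phi> b)) \<in> R"
    by (simp add: R_def)
  have va: "vscale c (v (\<phi> a)) \<in> N (\<phi> b)"
    using v[of "\<phi> a"] mono[of "Suc (\<phi> a)" "\<phi> b"] lt by (auto intro!: vec_module.subspace_scale sub)
  have "v (\<phi> b) - vscale c (v (\<phi> a)) \<in> N (Suc (\<phi> b))"
    using v[of "\<phi> b"] va mono[of "\<phi> b" "Suc (\<phi> b)"] by (intro vec_module.subspace_diff sub) auto
  moreover have "v (\<phi> b) - vscale c (v (\<phi> a)) \<notin> N (\<phi> b)"
    using vec_module.subspace_add[OF sub _ va] v[of "\<phi> b"] by force
  moreover from this have "v (\<phi> b) - vscale c (v (\<phi> a)) \<noteq> 0"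
    using vec_module.subspace_0[OF sub] by metis
  ultimately show False using c v_least by blast
qed

lemma submodule_finitely_generated:
  fixes N :: "('n::{finite,linorder}, 'k::field) mvec set"
  assumes N: "vec_module.subspace N" "N \<subseteq> free_mod m"
  obtains S where "finite S" "S \<subseteq> N" "N = vec_module.span S"
proof (rule ccontr)
  assume "\<not> thesis"
  with that have no: "\<And>S. finite S \<Longrightarrow> S \<subseteq> N \<Longrightarrow> N \<noteq> vec_module.span S" by blast
  have "\<exists>v. v \<in> N - vec_module.span S" if "finite S" "S \<subseteq> N" for S
    using no[of S] that vec_module.span_minimal[OF that(2) N(1)] by blast
  then obtain f where f: "\<And>S. finite S \<Longrightarrow> S \<subseteq> N \<Longrightarrow> f S \<in> N - vec_module.span S" by metis
  define S where "S = rec_nat {} (\<lambda>_ T. insert (f T) T)"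
  have S_simps: "S 0 = {}" "\<And>i. S (Suc i) = insert (f (S i)) (S i)" by (simp_all add: S_def)
  have S: "finite (S i) \<and> S i \<subseteq> N" for i by (induction i) (use f S_simps in auto)
  show False
  proof (rule no_infinite_submodule_chain[of "\<lambda>i. vec_module.span (S i)" m])
    show "vec_module.span (S i) \<subset> vec_module.span (S (Suc i))" for i
    proof
      show "vec_module.span (S i) \<subseteq> vec_module.span (S (Suc i))"
        by (rule vec_module.span_mono) (auto simp: S_simps)
      have "f (S i) \<in> vec_module.span (S (Suc i))" by (rule vec_module.span_base) (simp add: S_simps)
      then show "vec_module.span (S i) \<noteq> vec_module.span (S (Suc i))" using f[of "S i"] S by auto
    qed
    show "vec_module.span (S i) \<subseteq> free_mod m" for i
      using vec_module.span_minimal[of "S i" N] S N by blast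
  qed simp
qed

text \<open>Ideals are submodules of rank one. Well-foundedness of reverse inclusion is the form
  that yields both maximal elements and Noetherian induction.\<close>

lemma wf_ideal_chain:
  "wf {(J, I :: ('n::{finite,linorder}, 'k::field) mpol set). is_ideal I \<and> is_ideal J \<and> I \<subset> J}"
  unfolding wf_iff_no_infinite_down_chain
proof
  assume "\<exists>f. \<forall>i. (f (Suc i), f i) \<in>
    {(J, I :: ('n, 'k) mpol set). is_ideal I \<and> is_ideal J \<and> I \<subset> J}"
  then obtain I where "\<forall>i. (I (Suc i), I i) \<in>
    {(J, I :: ('n, 'k) mpol set). is_ideal I \<and> is_ideal J \<and> I \<subset> J}" ..
  then have I: "is_ideal (I i)" "I i \<subset> I (Suc i)" for i by simp_all
  let ?N = "\<lambda>i. Poly_Mapping.single (0::nat) ` I i"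
  show False
  proof (rule no_infinite_submodule_chain[of ?N 1])
    show "vec_module.subspace (?N i)" for i
    proof (rule vec_module.subspaceI)
      show "0 \<in> ?N i" using ideal_0[OF I(1)[of i]] by (metis image_eqI single_zero)
      show "x + y \<in> ?N i" if "x \<in> ?N i" "y \<in> ?N i" for x y
        using that ideal_add[OF I(1)[of i]] by (auto simp flip: single_add)
      show "vscale c x \<in> ?N i" if x: "x \<in> ?N i" for c x
      proof -
        obtain g where g: "g \<in> I i" "x = Poly_Mapping.single 0 g" using x by blast
        then have "vscale c x = Poly_Mapping.single 0 (c * g)"
          by (intro poly_mapping_eqI) (simp add: lookup_single when_def)
        then show ?thesis using ideal_mult_left[OF I(1) g(1)] by blast
      qed
    qed
    show "?N i \<subseteq> free_mod 1" for i by (auto simp: free_mod_def split: if_splits)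
    show "?N i \<subset> ?N (Suc i)" for i
      by (rule image_strict_mono[OF inj_on_subset[OF inj_single subset_UNIV] I(2)])
  qed
qed

section \<open>Zero divisors and symbolic powers\<close>

definition zero_divisors_mod :: "'a::comm_ring_1 set \<Rightarrow> 'a set" where
  "zero_divisors_mod I = {g. \<exists>f. f \<notin> I \<and> g * f \<in> I}"

definition colon :: "'a::comm_ring_1 set \<Rightarrow> 'a \<Rightarrow> 'a set" where
  "colon I f = {g. g * f \<in> I}"

lemma is_ideal_colon: "is_ideal I \<Longrightarrow> is_ideal (colon I f)"
  by (rule is_idealI)
     (auto simp: colon_def distrib_right mult.assoc ideal_0 ideal_add ideal_mult_left)

lemma subset_colon: "is_ideal I \<Longrightarrow> I \<subseteq> colon I f"
  by (auto simp: colon_def ideal_mult_right)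

lemma not_zero_divisor_cancel: "s \<notin> zero_divisors_mod I \<Longrightarrow> s * f \<in> I \<Longrightarrow> f \<in> I"
  by (auto simp: zero_divisors_mod_def)

lemma not_zero_divisor_mult:
  "s \<notin> zero_divisors_mod I \<Longrightarrow> t \<notin> zero_divisors_mod I \<Longrightarrow> s * t \<notin> zero_divisors_mod I"
  by (auto simp: zero_divisors_mod_def mult.assoc)

lemma is_prime_idealD:
  assumes "is_prime_ideal P"
  shows prime_is_ideal: "is_ideal P" and prime_1: "1 \<notin> P"
    and prime_mult: "\<And>a b. a * b \<in> P \<Longrightarrow> a \<in> P \<or> b \<in> P"
  using assms ideal_eq_UNIV_iff[of P] by (auto simp: is_prime_ideal_def)

text \<open>A maximal one among the proper ideals (I : f') containing g is prime: if ab lies in (I :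
  f') and b does not, then (I : b f') is again of this kind and contains (I : f'), so both are equal
  and contain a.\<close>

lemma ex_associated_prime:
  fixes I :: "('n::{finite,linorder}, 'k::field) mpol set"
  assumes I: "is_ideal I" and f: "f \<notin> I" and gf: "g * f \<in> I"
  obtains P where "P \<in> associated_primes I" "g \<in> P"
proof -
  let ?Q = "{colon I f' | f'. f' \<notin> I \<and> g * f' \<in> I}"
  have "colon I f \<in> ?Q" using f gf by blast
  from wf_ideal_chain[unfolded wf_eq_minimal, rule_format, OF this]
  obtain P where P: "P \<in> ?Q"
    and max: "\<forall>J. (J, P) \<in> {(J, I). is_ideal I \<and> is_ideal J \<and> I \<subset> J} \<longrightarrow> J \<notin> ?Q" ..
  obtain f' where f': "P = colon I f'" "f' \<notin> I" "g * f' \<in> I" using P by blast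
  have idP: "is_ideal P" unfolding f'(1) by (rule is_ideal_colon[OF I])
  have "is_prime_ideal P"
    unfolding is_prime_ideal_def
  proof (intro conjI allI impI)
    show "is_ideal P" by (rule idP)
    show "P \<noteq> UNIV" using f'(2) ideal_eq_UNIV_iff[OF idP] by (simp add: f'(1) colon_def)
    fix a b assume ab: "a * b \<in> P"
    show "a \<in> P \<or> b \<in> P"
    proof (cases "b \<in> P")
      case False
      have sub: "P \<subseteq> colon I (b * f')"
        using ideal_mult_left[OF I, of _ b] by (auto simp: f'(1) colon_def) (metis mult.left_commute)
      have "colon I (b * f') \<in> ?Q"
        using False f'(1) ideal_mult_left[OF I f'(3), of b]
        by (auto simp: colon_def mult.left_commute)
      then have "\<not> P \<subset> colon I (b * f')" using max idP is_ideal_colon[OF I] by blast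
      with sub have "colon I (b * f') = P" by blast
      moreover have "a \<in> colon I (b * f')" using ab by (simp add: f'(1) colon_def mult.assoc)
      ultimately show ?thesis by simp
    qed simp
  qed
  then have "P \<in> associated_primes I" by (auto simp: associated_primes_def f'(1) colon_def)
  moreover have "g \<in> P" using f'(3) by (simp add: f'(1) colon_def)
  ultimately show thesis by (rule that)
qed

lemma Union_associated_primes:
  fixes I :: "('n::{finite,linorder}, 'k::field) mpol set"
  assumes "is_ideal I"
  shows "\<Union>(associated_primes I) = zero_divisors_mod I"
proof (intro equalityI subsetI)
  fix g assume "g \<in> \<Union>(associated_primes I)"
  then obtain f where f: "is_prime_ideal {g. g * f \<in> I}" "g * f \<in> I"
    by (auto simp: associated_primes_def)
  then have "f \<notin> I" using prime_1[OF f(1)] by simp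
  then show "g \<in> zero_divisors_mod I" using f(2) by (auto simp: zero_divisors_mod_def)
next
  fix g assume "g \<in> zero_divisors_mod I"
  then obtain f where "f \<notin> I" "g * f \<in> I" by (auto simp: zero_divisors_mod_def)
  then show "g \<in> \<Union>(associated_primes I)" by (metis ex_associated_prime[OF assms] UnionI)
qed

text \<open>Clearing denominators: a finite sum over the localization has a common denominator
  outside the zero divisors. Properness of I keeps 0 out of the denominators, so equality of
  fractions becomes equality of polynomials.\<close>

lemma symbolic_power_iff:
  fixes I :: "('n::{finite,linorder}, 'k::field) mpol set"
  assumes I: "is_ideal I" "I \<noteq> UNIV"
  shows "f \<in> symbolic_power I m \<longleftrightarrow> (\<exists>s. s \<notin> zero_divisors_mod I \<and> s * f \<in> ideal_power I m)"
proof -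
  let ?A = "- zero_divisors_mod I"
  let ?J = "ideal_power I m"
  have "1 \<notin> I" using I ideal_eq_UNIV_iff by blast
  then have nz: "s \<noteq> 0" if "s \<in> ?A" for s
    using that ideal_0[OF I(1)] by (auto simp: zero_divisors_mod_def)
  have 1: "1 \<in> ?A" by (auto simp: zero_divisors_mod_def)
  have frac: "\<exists>h s. h \<in> ?J \<and> s \<in> ?A \<and> (\<Sum>i<n. c i * Fract (g i) 1) = Fract h s"
    if "\<forall>i<n. c i \<in> localization ?A \<and> g i \<in> ?J" for n :: nat and c g
    using that
  proof (induction n)
    case 0
    show ?case using 1 ideal_0[OF is_ideal_power]
      by (intro exI[of _ 0] exI[of _ 1]) (simp add: Zero_fract_def)
  next
    case (Suc n)
    then obtain h s where h: "h \<in> ?J" "s \<in> ?A" "(\<Sum>i<n. c i * Fract (g i) 1) = Fract h s" by auto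
    obtain a t where a: "c n = Fract a t" "t \<in> ?A" "g n \<in> ?J"
      using Suc.prems by (auto simp: localization_def)
    have "(\<Sum>i<Suc n. c i * Fract (g i) 1) = Fract (h * t + a * g n * s) (s * t)"
      using h(3) nz[OF h(2)] nz[OF a(2)] by (simp add: a(1))
    moreover have "h * t + a * g n * s \<in> ?J"
      using h(1) a(3) by (intro ideal_add[OF is_ideal_power] ideal_mult_right[OF is_ideal_power]
          ideal_mult_left[OF is_ideal_power])
    moreover have "s * t \<in> ?A" using h(2) a(2) not_zero_divisor_mult by auto
    ultimately show ?case by blast
  qed
  show ?thesis
  proof
    assume "f \<in> symbolic_power I m"
    then obtain n :: nat and c g where *: "Fract f 1 = (\<Sum>i<n. c i * Fract (g i) 1)"
      "\<forall>i<n. c i \<in> localization ?A \<and> g i \<in> ?J"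
      by (auto simp: symbolic_power_def extended_ideal_def Union_associated_primes[OF I(1)])
    obtain h s where h: "h \<in> ?J" "s \<in> ?A" "Fract f 1 = Fract h s"
      using frac[OF *(2)] *(1) by auto
    then have "s * f = h" using nz[OF h(2)] by (simp add: eq_fract mult.commute)
    then show "\<exists>s. s \<notin> zero_divisors_mod I \<and> s * f \<in> ?J" using h by auto
  next
    assume "\<exists>s. s \<notin> zero_divisors_mod I \<and> s * f \<in> ?J"
    then obtain s where s: "s \<in> ?A" "s * f \<in> ?J" by auto
    have "Fract f 1 = (\<Sum>i<(1::nat). Fract 1 s * Fract (s * f) 1)"
      using nz[OF s(1)] by (simp add: eq_fract)
    moreover have "Fract 1 s \<in> localization ?A" using s(1) by (auto simp: localization_def)
    ultimately show "f \<in> symbolic_power I m"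
      using s(2) unfolding symbolic_power_def extended_ideal_def Union_associated_primes[OF I(1)]
      by (intro CollectI exI[of _ 1] exI[of _ "\<lambda>_. Fract 1 s"] exI[of _ "\<lambda>_. s * f"]) auto
  qed
qed

lemma ideal_power_subset_symbolic:
  fixes I :: "('n::{finite,linorder}, 'k::field) mpol set"
  assumes "is_ideal I" "I \<noteq> UNIV"
  shows "ideal_power I m \<subseteq> symbolic_power I m"
  using symbolic_power_iff[OF assms] by (force simp: zero_divisors_mod_def intro: exI[of _ 1])

lemma symbolic_power_mult:
  fixes I :: "('n::{finite,linorder}, 'k::field) mpol set"
  assumes I: "is_ideal I" "I \<noteq> UNIV" and "f \<in> symbolic_power I m" "g \<in> symbolic_power I n"
  shows "f * g \<in> symbolic_power I (m + n)"
proof -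
  obtain s t where st: "s \<notin> zero_divisors_mod I" "s * f \<in> ideal_power I m"
    "t \<notin> zero_divisors_mod I" "t * g \<in> ideal_power I n"
    using assms symbolic_power_iff[OF I] by blast
  then have "(s * t) * (f * g) \<in> ideal_power I (m + n)"
    using ideal_power_add_mult[OF st(2,4)] by (simp add: mult_ac)
  then show ?thesis using symbolic_power_iff[OF I] not_zero_divisor_mult st by blast
qed

lemma is_ideal_symbolic_power:
  fixes I :: "('n::{finite,linorder}, 'k::field) mpol set"
  assumes I: "is_ideal I" "I \<noteq> UNIV"
  shows "is_ideal (symbolic_power I m)"
proof (rule is_idealI)
  show "0 \<in> symbolic_power I m"
    using ideal_power_subset_symbolic[OF I, of m] ideal_0[OF is_ideal_power] by blast
  fix f g assume f: "f \<in> symbolic_power I m"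
  then obtain s where s: "s \<notin> zero_divisors_mod I" "s * f \<in> ideal_power I m"
    using symbolic_power_iff[OF I] by blast
  have "s * (g * f) \<in> ideal_power I m"
    using ideal_mult_left[OF is_ideal_power s(2), of g] by (simp add: mult_ac)
  then show "g * f \<in> symbolic_power I m" using s(1) symbolic_power_iff[OF I] by blast
  assume "g \<in> symbolic_power I m"
  then obtain t where t: "t \<notin> zero_divisors_mod I" "t * g \<in> ideal_power I m"
    using symbolic_power_iff[OF I] by blast
  have "(s * t) * (f + g) = t * (s * f) + s * (t * g)" by (simp add: algebra_simps)
  then have "(s * t) * (f + g) \<in> ideal_power I m"
    using ideal_mult_left[OF is_ideal_power s(2), of t] ideal_mult_left[OF is_ideal_power t(2), of s]
      ideal_add[OF is_ideal_power] by metis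
  then show "f + g \<in> symbolic_power I m"
    using symbolic_power_iff[OF I] not_zero_divisor_mult[OF s(1) t(1)] by blast
qed

section \<open>The order of vanishing of symbolic powers\<close>

text \<open>The expansion of f(x + z) in new variables z with coefficients in k[x]. The coefficients
  are the Hasse derivatives of f, which retain the vanishing order in every characteristic.\<close>

definition taylor :: "('n::finite, 'k::comm_ring_1) mpol \<Rightarrow> ('n, ('n, 'k) mpol) mpol" where
  "taylor = meval (\<lambda>c. Poly_Mapping.single 0 (Poly_Mapping.single 0 c))
     (\<lambda>i. Poly_Mapping.single 0 (variable i) + variable i)"

interpretation taylor: coefficient_hom
  "\<lambda>c :: 'k::comm_ring_1. Poly_Mapping.single 0 (Poly_Mapping.single 0 c) :: ('n::finite, ('n, 'k) mpol) mpol"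
  by standard (simp_all add: single_add mult_single)

lemma monomial_add_eq_0_iff [simp]: "u + v = 0 \<longleftrightarrow> u = 0 \<and> v = (0 :: 'n::finite \<Rightarrow>\<^sub>0 nat)"
proof -
  have "u + v = 0 \<longleftrightarrow> mon_degree (u + v) = 0" by (simp only: mon_degree_eq_0_iff)
  also have "\<dots> \<longleftrightarrow> u = 0 \<and> v = 0" by simp
  finally show ?thesis .
qed

lemma lookup_times_0:
  fixes F G :: "('n::finite, 'r::comm_ring_1) mpol"
  shows "Poly_Mapping.lookup (F * G) 0 = Poly_Mapping.lookup F 0 * Poly_Mapping.lookup G 0"
proof -
  let ?f = "Poly_Mapping.lookup F" and ?g = "Poly_Mapping.lookup G"
  have "Poly_Mapping.lookup (F * G) 0 = (\<Sum>u\<in>Poly_Mapping.keys F. \<Sum>v\<in>Poly_Mapping.keys G.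
      if v = 0 then (if u = 0 then ?f u * ?g v else 0) else 0)"
    unfolding lookup_times_sum by (intro sum.cong refl) (simp add: when_def)
  also have "\<dots> = (\<Sum>u\<in>Poly_Mapping.keys F. if u = 0 then ?f u * ?g 0 else 0)"
    by (intro sum.cong refl) (auto simp: sum.delta in_keys_iff)
  also have "\<dots> = ?f 0 * ?g 0" by (auto simp: sum.delta in_keys_iff)
  finally show ?thesis .
qed

text \<open>Setting z = 0 is a ring homomorphism that fixes constants and variables.\<close>

lemma lookup_taylor_0: "Poly_Mapping.lookup (taylor f) 0 = f"
proof -
  let ?F = "\<lambda>f :: ('a, 'b) mpol. Poly_Mapping.lookup (taylor f) 0"
  have var: "?F (variable i) = variable i" for i
    by (simp add: taylor_def lookup_add)
  have const: "?F (Poly_Mapping.single 0 c) = Poly_Mapping.single 0 c" for c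
    by (simp add: taylor_def taylor.meval_single)
  have "?F f = meval (\<lambda>c. ?F (Poly_Mapping.single 0 c)) (\<lambda>i. ?F (variable i)) f"
    by (rule ring_hom_eq_meval[of ?F])
       (simp_all add: taylor_def taylor.meval_add taylor.meval_mult lookup_add lookup_times_0)
  also have "\<dots> = meval (\<lambda>c. Poly_Mapping.single 0 c) variable f" by (simp add: var const)
  also have "\<dots> = f" using ring_hom_eq_meval[of "\<lambda>f. f" f] by simp
  finally show ?thesis .
qed

lemma taylor_mult: "taylor (f * g) = taylor f * taylor g"
  by (simp add: taylor_def taylor.meval_mult)

lemma taylor_add: "taylor (f + g) = taylor f + taylor g"
  by (simp add: taylor_def taylor.meval_add)

lemma taylor_0 [simp]: "taylor 0 = 0"
  by (simp add: taylor_def)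

text \<open>In the coefficient of a product ab with a in P, the terms using the constant Taylor
  coefficient of a contain the factor a; all others use a coefficient of b of order at least one
  lower, to which the induction hypothesis applies.\<close>

lemma lookup_taylor_ideal_power:
  assumes P: "is_ideal P" and "g \<in> ideal_power P m" "mon_degree t < m"
  shows "Poly_Mapping.lookup (taylor g) t \<in> P"
  using assms(2,3)
proof (induction m arbitrary: g t)
  case (Suc m)
  have "\<forall>t. mon_degree t < Suc m \<longrightarrow> Poly_Mapping.lookup (taylor g) t \<in> P"
    using Suc.prems(1)
  proof (induction rule: ideal_power_Suc_induct)
    case (mult a b)
    show ?case
    proof (intro allI impI)
      fix t :: "'a \<Rightarrow>\<^sub>0 nat" assume t: "mon_degree t < Suc m"
      show "Poly_Mapping.lookup (taylor (a * b)) t \<in> P"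
        unfolding taylor_mult lookup_times_sum
      proof (intro ideal_sum[OF P])
        fix u v
        show "(Poly_Mapping.lookup (taylor a) u * Poly_Mapping.lookup (taylor b) v when u + v = t) \<in> P"
        proof (cases "u + v = t")
          case True
          show ?thesis
          proof (cases "u = 0")
            case u: True
            then show ?thesis using mult True
              by (simp add: lookup_taylor_0 ideal_mult_right[OF P])
          next
            case False
            then have "mon_degree u > 0" by (metis mon_degree_eq_0_iff neq0_conv)
            then have "mon_degree v < m" using t True[symmetric] by simp
            then have "Poly_Mapping.lookup (taylor b) v \<in> P" using Suc.IH mult by blast
            then show ?thesis using True by (simp add: ideal_mult_left[OF P])
          qed
        qed (simp add: ideal_0[OF P])
      qed
    qed
  qed (auto simp: ideal_0[OF P] taylor_add lookup_add ideal_add[OF P])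
  then show ?case using Suc.prems(2) by blast
qed simp

lemma lookup_taylor_symbolic:
  assumes P: "is_prime_ideal P" and s: "s \<notin> P" and "s * f \<in> ideal_power P m" "mon_degree t < m"
  shows "Poly_Mapping.lookup (taylor f) t \<in> P"
  using assms(4)
proof (induction "mon_degree t" arbitrary: t rule: less_induct)
  case less
  note I = prime_is_ideal[OF P]
  let ?K = "Poly_Mapping.keys (taylor s)" and ?L = "Poly_Mapping.keys (taylor f)"
  let ?T = "\<lambda>u. \<Sum>v\<in>?L.
    (Poly_Mapping.lookup (taylor s) u * Poly_Mapping.lookup (taylor f) v when u + v = t)"
  have "s \<noteq> 0" using s ideal_0[OF I] by auto
  then have 0: "0 \<in> ?K" by (simp add: in_keys_iff lookup_taylor_0)
  have T0: "?T 0 = Poly_Mapping.lookup (taylor (s * f)) t - (\<Sum>u\<in>?K - {0}. ?T u)"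
    unfolding taylor_mult lookup_times_sum using 0 by (simp add: sum.remove)
  have "Poly_Mapping.lookup (taylor (s * f)) t \<in> P"
    using lookup_taylor_ideal_power[OF I assms(3) less.prems] .
  moreover have "(\<Sum>u\<in>?K - {0}. ?T u) \<in> P"
  proof (intro ideal_sum[OF I])
    fix u v assume u: "u \<in> ?K - {0}"
    show "(Poly_Mapping.lookup (taylor s) u * Poly_Mapping.lookup (taylor f) v when u + v = t) \<in> P"
    proof (cases "u + v = t")
      case True
      have "mon_degree u > 0" using u by (metis DiffE mon_degree_eq_0_iff neq0_conv singletonI)
      then have "mon_degree v < mon_degree t" using True[symmetric] by simp
      then have "Poly_Mapping.lookup (taylor f) v \<in> P" using less by simp
      then show ?thesis using True by (simp add: ideal_mult_left[OF I])
    qed (simp add: ideal_0[OF I])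
  qed
  ultimately have "?T 0 \<in> P" unfolding T0 by (rule ideal_diff[OF I])
  moreover have "?T 0 = s * Poly_Mapping.lookup (taylor f) t"
    by (auto simp: lookup_taylor_0 when_def sum.delta in_keys_iff)
  ultimately show ?case using prime_mult[OF P] s by metis
qed

definition lower_terms :: "nat \<Rightarrow> ('n::finite, 'r::zero) mpol \<Rightarrow> bool" where
  "lower_terms d F \<longleftrightarrow> (\<forall>t\<in>Poly_Mapping.keys F. mon_degree t < d)"

text \<open>\<open>F\<close> equals the monomial t plus terms of smaller total degree. Unlike a
  statement about one coefficient, this is preserved by products and so can be built up factor by
  factor.\<close>

definition monic_at :: "('n::finite \<Rightarrow>\<^sub>0 nat) \<Rightarrow> ('n, 'r::comm_ring_1) mpol \<Rightarrow> bool" where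
  "monic_at t F \<longleftrightarrow> lower_terms (mon_degree t) (F - Poly_Mapping.single t 1)"

lemma monic_at_mult:
  assumes "monic_at s F" "monic_at t G"
  shows "monic_at (s + t) (F * G)"
proof -
  have "F * G - Poly_Mapping.single (s + t) 1 =
      (F - Poly_Mapping.single s 1) * G + Poly_Mapping.single s 1 * (G - Poly_Mapping.single t 1)"
    by (simp add: algebra_simps mult_single)
  moreover have "mon_degree v \<le> mon_degree t" if "v \<in> Poly_Mapping.keys G" for v
  proof (cases "v = t")
    case False
    then have "v \<in> Poly_Mapping.keys (G - Poly_Mapping.single t 1)"
      using that by (simp add: in_keys_iff lookup_minus lookup_single)
    then show ?thesis using assms(2) by (auto simp: monic_at_def lower_terms_def)
  qed simp
  ultimately show ?thesis
    using assms unfolding monic_at_def lower_terms_def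
    by (auto dest!: subsetD[OF Poly_Mapping.keys_add] subsetD[OF keys_mult] split: if_splits)
       (meson add_less_le_mono add_le_less_mono add_strict_left_mono)+
qed

lemma monic_at_1: "monic_at 0 1"
  by (simp add: monic_at_def lower_terms_def)

lemma monic_at_shift_monomial:
  "monic_at t (\<Prod>i\<in>UNIV. (Poly_Mapping.single 0 (r i) + variable i) ^ Poly_Mapping.lookup t i)"
  for t :: "'n::finite \<Rightarrow>\<^sub>0 nat" and r :: "'n \<Rightarrow> 'r::comm_ring_1"
proof -
  have base: "monic_at (Poly_Mapping.single i 1) (Poly_Mapping.single 0 (r i) + variable i)" for i
    by (auto simp: monic_at_def lower_terms_def variable_def split: if_splits)
  have pow: "monic_at (Poly_Mapping.single i m) ((Poly_Mapping.single 0 (r i) + variable i) ^ m)" for i m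
  proof (induction m)
    case (Suc m)
    have "Poly_Mapping.single i (Suc m) = Poly_Mapping.single i 1 + Poly_Mapping.single i m"
      by (simp flip: single_add)
    then show ?case using monic_at_mult[OF base Suc, of i] by simp
  qed (simp add: monic_at_1)
  have "monic_at (\<Sum>i\<in>A. Poly_Mapping.single i (g i))
      (\<Prod>i\<in>A. (Poly_Mapping.single 0 (r i) + variable i) ^ g i)" for A :: "'n set" and g
    by (induction A rule: infinite_finite_induct) (auto simp: monic_at_1 intro: monic_at_mult pow)
  from this[of "Poly_Mapping.lookup t" UNIV] show ?thesis
    by (simp add: sum_single_lookup)
qed

text \<open>The part of top degree of (x + z)^s in z is z^s, and all monomials of f have the same
  degree; hence the coefficients of order d of the expansion are those of f itself.\<close>

lemma lookup_taylor_top: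
  assumes "homogeneous d f" "t \<in> Poly_Mapping.keys f"
  shows "Poly_Mapping.lookup (taylor f) t = Poly_Mapping.single 0 (Poly_Mapping.lookup f t)"
proof -
  let ?M = "\<lambda>s. \<Prod>i\<in>UNIV. (Poly_Mapping.single 0 (variable i) + variable i) ^ Poly_Mapping.lookup s i
    :: ('a, ('a, 'b) mpol) mpol"
  have M: "Poly_Mapping.lookup (?M s) t = (1 when s = t)" if "s \<in> Poly_Mapping.keys f" for s
  proof -
    have "mon_degree s = mon_degree t" using assms that by (simp add: homogeneous_def) (metis of_nat_eq_iff)
    then have "t \<notin> Poly_Mapping.keys (?M s - Poly_Mapping.single s 1)"
      using monic_at_shift_monomial[of s variable] by (auto simp: monic_at_def lower_terms_def)
    then show ?thesis by (simp add: in_keys_iff lookup_minus lookup_single)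
  qed
  have "Poly_Mapping.lookup (taylor f) t = (\<Sum>s\<in>Poly_Mapping.keys f.
      Poly_Mapping.lookup (Poly_Mapping.single 0 (Poly_Mapping.single 0 (Poly_Mapping.lookup f s)) * ?M s) (0 + t))"
    by (simp add: taylor_def meval_def lookup_sum)
  also have "\<dots> = (\<Sum>s\<in>Poly_Mapping.keys f. if s = t then Poly_Mapping.single 0 (Poly_Mapping.lookup f s) else 0)"
    unfolding lookup_single_times by (intro sum.cong refl) (simp add: M when_def)
  also have "\<dots> = Poly_Mapping.single 0 (Poly_Mapping.lookup f t)" using assms(2) by simp
  finally show ?thesis .
qed

text \<open>The Taylor coefficients of order less than \<open>m\<close> of an element of the symbolic power lie in the
  prime, whereas those of top order are constants.\<close>

lemma symbolic_degree_bound: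
  fixes f :: "('n::finite, 'k::field) mpol"
  assumes P: "is_prime_ideal P" and s: "s \<notin> P" "s * f \<in> ideal_power P m"
    and f: "homogeneous (int d) f" "f \<noteq> 0"
  shows "m \<le> d"
proof (rule ccontr)
  assume "\<not> m \<le> d"
  obtain t where t: "t \<in> Poly_Mapping.keys f" using f(2) by fastforce
  have "mon_degree t = d" using f(1) t by (simp add: homogeneous_def)
  let ?c = "Poly_Mapping.lookup f t"
  have "Poly_Mapping.lookup (taylor f) t \<in> P"
    using \<open>\<not> m \<le> d\<close> \<open>mon_degree t = d\<close> by (intro lookup_taylor_symbolic[OF P s]) simp
  then have "Poly_Mapping.single 0 ?c \<in> P" by (simp add: lookup_taylor_top[OF f(1) t])
  then have "Poly_Mapping.single 0 (inverse ?c) * Poly_Mapping.single 0 ?c \<in> P"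
    by (rule ideal_mult_left[OF prime_is_ideal[OF P]])
  then show False using t prime_1[OF P] by (simp add: mult_single in_keys_iff)
qed

lemma ideal_power_mono: "I \<subseteq> J \<Longrightarrow> ideal_power I m \<subseteq> ideal_power J m"
proof (induction m)
  case (Suc m)
  then show ?case unfolding ideal_power.simps by (intro ring_module.span_mono) blast
qed simp

section \<open>Initial degrees and the Waldschmidt constant\<close>

lemma alpha_le: "f \<in> J \<Longrightarrow> f \<noteq> 0 \<Longrightarrow> homogeneous (int t) f \<Longrightarrow> alpha J \<le> t"
  unfolding alpha_def by (rule Least_le) (auto simp: hom_component_def)

lemma alpha_attained:
  assumes "0 \<in> J" "f \<in> J" "f \<noteq> 0" "homogeneous (int t) f"
  obtains g where "g \<in> J" "g \<noteq> 0" "homogeneous (int (alpha J)) g"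
proof -
  have "hom_component J t \<noteq> {0}" using assms by (auto simp: hom_component_def)
  then have "hom_component J (alpha J) \<noteq> {0}" unfolding alpha_def by (rule LeastI)
  \<comment> \<open>An empty component would differ from {0} too; it is 0 in \<open>J\<close> that
    turns the inequality into a nonzero element.\<close>
  moreover have "0 \<in> hom_component J (alpha J)" using assms(1) by (simp add: hom_component_def)
  ultimately obtain g where "g \<in> hom_component J (alpha J)" "g \<noteq> 0" by blast
  then show thesis using that by (auto simp: hom_component_def)
qed

locale proper_homogeneous_ideal =
  fixes I :: "('n::{finite,linorder}, 'k::field) mpol set"
  assumes graded_I: "graded I" and I_neq_0: "I \<noteq> {0}" and I_neq_UNIV: "I \<noteq> UNIV"
begin

lemma ideal_I: "is_ideal I"
  using graded_I by (rule graded_ideal)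

lemma one_notin_I: "1 \<notin> I"
  using I_neq_UNIV ideal_eq_UNIV_iff[OF ideal_I] by simp

lemma alpha_I_attained:
  obtains g where "g \<in> I" "g \<noteq> 0" "homogeneous (int (alpha I)) g"
proof -
  obtain f where f: "f \<in> I" "f \<noteq> 0" using I_neq_0 ideal_0[OF ideal_I] by blast
  then obtain d where d: "d \<in> hdegrees f" using hdegrees_eq_empty by blast
  have "hcomp d f \<in> I" "hcomp d f \<noteq> 0" "homogeneous (int (nat d)) (hcomp d f)"
    using graded_hcomp[OF graded_I f(1)] d hdegrees_nonneg[OF d] by (auto simp: hcomp_eq_0_iff)
  then show thesis by (rule alpha_attained[OF ideal_0[OF ideal_I] _ _ _ that])
qed

lemma alpha_le_key_degree: "f \<in> I \<Longrightarrow> t \<in> Poly_Mapping.keys f \<Longrightarrow> alpha I \<le> mon_degree t"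
  using graded_hcomp[OF graded_I, of f "int (mon_degree t)"]
  by (intro alpha_le[of "hcomp (int (mon_degree t)) f"]) (auto simp: hcomp_eq_0_iff hdegrees_def)

lemma alpha_pos: "alpha I \<ge> 1"
proof -
  obtain g where g: "g \<in> I" "g \<noteq> 0" "homogeneous (int (alpha I)) g" by (rule alpha_I_attained)
  have "alpha I \<noteq> 0"
  proof
    assume "alpha I = 0"
    then have g0: "g = Poly_Mapping.single 0 (Poly_Mapping.lookup g 0)"
      using homogeneous_degree_0 g(3) by simp
    let ?c = "Poly_Mapping.lookup g 0"
    have "?c \<noteq> 0" using g(2) g0 by (metis single_zero)
    have "Poly_Mapping.single 0 (inverse ?c) * Poly_Mapping.single 0 ?c \<in> I"
      using ideal_mult_left[OF ideal_I g(1)] g0 by metis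
    then show False using \<open>?c \<noteq> 0\<close> one_notin_I by (simp add: mult_single)
  qed
  then show ?thesis by simp
qed

text \<open>Bounding every monomial, and not just the degree of homogeneous elements, is what
  survives sums in the induction.\<close>

lemma ideal_power_key_degree:
  "f \<in> ideal_power I r \<Longrightarrow> t \<in> Poly_Mapping.keys f \<Longrightarrow> r * alpha I \<le> mon_degree t"
proof (induction r arbitrary: f t)
  case (Suc r)
  have "\<forall>t\<in>Poly_Mapping.keys f. Suc r * alpha I \<le> mon_degree t"
    using Suc.prems(1)
  proof (induction rule: ideal_power_Suc_induct)
    case (mult a b)
    show ?case
    proof
      fix t assume "t \<in> Poly_Mapping.keys (a * b)"
      then obtain u v where "u \<in> Poly_Mapping.keys a" "v \<in> Poly_Mapping.keys b" "t = u + v"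
        using keys_mult[of a b] by blast
      then show "Suc r * alpha I \<le> mon_degree t"
        using alpha_le_key_degree[OF mult(1)] Suc.IH[OF mult(2)] by (simp add: add_mono)
    qed
  next
    case (add f g)
    then show ?case using Poly_Mapping.keys_add[of f g] by blast
  qed simp
  then show ?case using Suc.prems(2) by blast
qed simp

lemma symbolic_power_alpha_attained:
  obtains g where "g \<in> symbolic_power I m" "g \<noteq> 0" "homogeneous (int (alpha (symbolic_power I m))) g"
proof -
  obtain g where g: "g \<in> I" "g \<noteq> 0" "homogeneous (int (alpha I)) g" by (rule alpha_I_attained)
  have "g ^ m \<in> symbolic_power I m"
    using power_in_ideal_power[OF g(1)] ideal_power_subset_symbolic[OF ideal_I I_neq_UNIV] by blast
  moreover have "g ^ m \<noteq> 0" using g(2) by simp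
  moreover have "homogeneous (int (m * alpha I)) (g ^ m)"
    using homogeneous_power[OF g(3), of m] by simp
  ultimately show thesis
    by (rule alpha_attained[OF ideal_0[OF is_ideal_symbolic_power[OF ideal_I I_neq_UNIV]] _ _ _ that])
qed

lemma alpha_symbolic_subadditive:
  "alpha (symbolic_power I (m + n)) \<le> alpha (symbolic_power I m) + alpha (symbolic_power I n)"
proof -
  obtain f where f: "f \<in> symbolic_power I m" "f \<noteq> 0" "homogeneous (int (alpha (symbolic_power I m))) f"
    by (rule symbolic_power_alpha_attained)
  obtain g where g: "g \<in> symbolic_power I n" "g \<noteq> 0" "homogeneous (int (alpha (symbolic_power I n))) g"
    by (rule symbolic_power_alpha_attained)
  show ?thesis
    using symbolic_power_mult[OF ideal_I I_neq_UNIV f(1) g(1)] f(2) g(2) homogeneous_mult[OF f(3) g(3)]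
    by (intro alpha_le[of "f * g"]) simp_all
qed

lemma le_alpha_symbolic: "m \<le> alpha (symbolic_power I m)"
proof -
  obtain f where f: "f \<in> symbolic_power I m" "f \<noteq> 0" "homogeneous (int (alpha (symbolic_power I m))) f"
    by (rule symbolic_power_alpha_attained)
  obtain s where s: "s \<notin> zero_divisors_mod I" "s * f \<in> ideal_power I m"
    using f(1) symbolic_power_iff[OF ideal_I I_neq_UNIV] by blast
  \<comment> \<open>Applied to g = 0 and f = 1, which only asserts that some associated prime
    exists.\<close>
  obtain P where P: "P \<in> associated_primes I"
    by (rule ex_associated_prime[OF ideal_I one_notin_I, of 0]) (simp add: ideal_0[OF ideal_I])
  then have prime: "is_prime_ideal P" by (simp add: associated_primes_def)
  have "I \<subseteq> P" using P by (auto simp: associated_primes_def ideal_mult_right[OF ideal_I])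
  then have "s * f \<in> ideal_power P m" using s(2) ideal_power_mono by blast
  moreover have "s \<notin> P" using s(1) P Union_associated_primes[OF ideal_I] by blast
  ultimately show ?thesis using symbolic_degree_bound[OF prime _ _ f(3,2)] by blast
qed

end

text \<open>The limit is the infimum L. If a(m)/m is near L and n = qm + s with s < m, then a(n) <=
  q a(m) + a(s), and the last term is bounded independently of n.\<close>

lemma fekete:
  fixes a :: "nat \<Rightarrow> real"
  assumes sub: "\<And>m n. a (m + n) \<le> a m + a n" and nonneg: "\<And>n. a n \<ge> 0"
  obtains L where "(\<lambda>n. a n / real n) \<longlonglongrightarrow> L" "\<And>n. n \<ge> 1 \<Longrightarrow> L \<le> a n / real n"
proof -
  define L where "L = Inf ((\<lambda>n. a n / real n) ` {1..})"
  have bdd: "bdd_below ((\<lambda>n. a n / real n) ` {1..})"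
    by (rule bdd_belowI[of _ 0]) (auto simp: nonneg)
  have L_le: "L \<le> a n / real n" if "n \<ge> 1" for n
    unfolding L_def using that bdd by (intro cInf_lower) auto
  have multiple: "a (q * m + r) \<le> real q * a m + a r" for q m r
  proof (induction q)
    case (Suc q)
    then show ?case using sub[of m "q * m + r"] by (simp add: algebra_simps)
  qed simp
  have "(\<lambda>n. a n / real n) \<longlonglongrightarrow> L"
  proof (rule LIMSEQ_I)
    fix e :: real assume e: "e > 0"
    obtain m where m: "m \<ge> 1" "a m / real m < L + e / 2"
      using cInf_lessD[of "(\<lambda>n. a n / real n) ` {1..}" "L + e / 2"] e unfolding L_def by auto
    define C where "C = Max (a ` {..<m})"
    have C: "a r \<le> C" if "r < m" for r using that by (simp add: C_def)
    obtain N where N: "real N > 2 * C / e" using reals_Archimedean2 by blast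
    show "\<exists>N. \<forall>n\<ge>N. norm (a n / real n - L) < e"
    proof (intro exI[of _ "Suc N"] allI impI)
      fix n assume n: "n \<ge> Suc N"
      have "a n \<le> real (n div m) * a m + a (n mod m)" using multiple[of "n div m" m "n mod m"] by simp
      also have "real (n div m) * a m \<le> real n / real m * a m"
      proof (rule mult_right_mono)
        have "real (n div m * m) \<le> real n" by (simp only: of_nat_le_iff div_times_less_eq_dividend)
        then show "real (n div m) \<le> real n / real m" using m(1) by (simp add: field_simps)
      qed (rule nonneg)
      also have "a (n mod m) \<le> C" using m(1) by (intro C) simp
      finally have "a n / real n \<le> a m / real m + C / real n"
        using n by (simp add: field_simps)
      moreover have "C / real n < e / 2"
        using N n e by (simp add: field_simps) (smt (verit) mult_left_mono of_nat_Suc of_nat_le_iff)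
      ultimately have "a n / real n < L + e" using m(2) by linarith
      then show "norm (a n / real n - L) < e" using L_le[of n] n by (simp add: abs_less_iff)
    qed
  qed
  then show thesis using that L_le by blast
qed

context proper_homogeneous_ideal
begin

text \<open>\<open>gamma\<close> is given by \<open>lim\<close>, which carries information only once
  convergence is known. The bound by the infimum is what the upper estimate uses.\<close>

lemma gamma_tendsto: "(\<lambda>m. real (alpha (symbolic_power I m)) / real m) \<longlonglongrightarrow> gamma I"
  and gamma_le: "m \<ge> 1 \<Longrightarrow> gamma I \<le> real (alpha (symbolic_power I m)) / real m"
proof -
  obtain L where L: "(\<lambda>m. real (alpha (symbolic_power I m)) / real m) \<longlonglongrightarrow> L"
    "\<And>m. m \<ge> 1 \<Longrightarrow> L \<le> real (alpha (symbolic_power I m)) / real m"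
    by (rule fekete[of "\<lambda>m. real (alpha (symbolic_power I m))"])
       (use alpha_symbolic_subadditive in \<open>auto simp flip: of_nat_add\<close>)
  have "gamma I = L" unfolding gamma_def using L(1) by (rule limI)
  then show "(\<lambda>m. real (alpha (symbolic_power I m)) / real m) \<longlonglongrightarrow> gamma I"
    "m \<ge> 1 \<Longrightarrow> gamma I \<le> real (alpha (symbolic_power I m)) / real m" using L by auto
qed

text \<open>Positivity of \<open>gamma I\<close> makes the quotients in the theorem genuine
  divisions.\<close>

lemma gamma_ge_1: "gamma I \<ge> 1"
proof (rule LIMSEQ_le_const[OF gamma_tendsto])
  show "\<exists>N. \<forall>n\<ge>N. 1 \<le> real (alpha (symbolic_power I n)) / real n"
    using le_alpha_symbolic by (intro exI[of _ 1]) (auto simp: field_simps)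
qed

lemma gamma_le_alpha: "gamma I \<le> real (alpha I)"
proof -
  obtain g where g: "g \<in> I" "g \<noteq> 0" "homogeneous (int (alpha I)) g" by (rule alpha_I_attained)
  have "I \<subseteq> symbolic_power I 1"
    using ideal_power_subset_symbolic[OF ideal_I I_neq_UNIV, of "Suc 0"] ideal_power_1[OF ideal_I] by simp
  then have "alpha (symbolic_power I 1) \<le> alpha I" using g by (intro alpha_le[of g]) auto
  then show ?thesis using gamma_le[of 1] by simp
qed

lemma resurgence_lower_bound: "ereal (real (alpha I) / gamma I) \<le> resurgence I"
proof (rule ccontr)
  assume "\<not> ereal (real (alpha I) / gamma I) \<le> resurgence I"
  then obtain y where y: "resurgence I < ereal y" "ereal y < ereal (real (alpha I) / gamma I)"
    by (metis not_le ereal_dense2)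
  have "0 < real (alpha I) / gamma I" using alpha_pos gamma_ge_1 by simp
  \<comment> \<open>The resurgence is a supremum in \<open>ereal\<close> and \<open>y\<close> may be
    negative; the maximum with 0 makes \<open>q\<close> positive, so that \<open>m\<close> is
    nonzero.\<close>
  then obtain q where q: "q \<in> \<rat>" "max y 0 < q" "q < real (alpha I) / gamma I"
    using Rats_dense_in_real[of "max y 0"] y(2) by auto
  then obtain m r :: nat where mr: "r \<noteq> 0" "q = real m / real r"
    using Rats_abs_nat_div_natE[OF q(1)] by (metis abs_of_pos max_less_iff_conj)
  have "m \<noteq> 0"
  proof
    assume "m = 0"
    then show False using q(2) mr(2) by simp
  qed
  have "gamma I < real (alpha I) * real r / real m"
    using q(3) mr gamma_ge_1 \<open>m \<noteq> 0\<close> by (simp add: field_simps)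
  \<comment> \<open>Passing from m, r to km, kr keeps the ratio fixed, while the quotient for km
    approaches \<open>gamma I\<close>.\<close>
  moreover have "filterlim (\<lambda>k. k * m) at_top sequentially"
    using \<open>m \<noteq> 0\<close> by (intro filterlim_subseq) (simp add: strict_mono_def)
  ultimately have "eventually (\<lambda>k. real (alpha (symbolic_power I (k * m))) / real (k * m)
      < real (alpha I) * real r / real m) sequentially"
    by (intro order_tendstoD(2)[OF filterlim_compose[OF gamma_tendsto]])
  then obtain k where k: "k \<ge> 1"
    "real (alpha (symbolic_power I (k * m))) / real (k * m) < real (alpha I) * real r / real m"
    using eventually_happens'[OF sequentially_bot eventually_conj[OF eventually_ge_at_top]] by blast
  have "real (alpha (symbolic_power I (k * m))) < real ((k * r) * alpha I)"
    using k \<open>m \<noteq> 0\<close> by (simp add: field_simps)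
  then have lt: "alpha (symbolic_power I (k * m)) < (k * r) * alpha I" by linarith
  obtain f where f: "f \<in> symbolic_power I (k * m)" "f \<noteq> 0"
      "homogeneous (int (alpha (symbolic_power I (k * m)))) f"
    by (rule symbolic_power_alpha_attained)
  have "f \<notin> ideal_power I (k * r)"
  proof
    assume *: "f \<in> ideal_power I (k * r)"
    obtain t where t: "t \<in> Poly_Mapping.keys f" using f(2) by fastforce
    then show False using ideal_power_key_degree[OF * t] f(3) lt by (auto simp: homogeneous_def)
  qed
  then have "ereal (real (k * m) / real (k * r)) \<le> resurgence I"
    unfolding resurgence_def using f(1) k(1) \<open>m \<noteq> 0\<close> \<open>r \<noteq> 0\<close>
    by (intro Sup_upper CollectI exI[of _ "k * m"] exI[of _ "k * r"]) auto
  moreover have "real (k * m) / real (k * r) = q" using k(1) mr by simp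
  ultimately have "ereal q < ereal y" using y(1) by (metis order.strict_trans1)
  then show False using q(2) by simp
qed

end

section \<open>Regular sequences of linear forms\<close>

lemma mpol_induct [case_names const var add mult]:
  fixes f :: "('n::finite, 'k::comm_ring_1) mpol"
  assumes const: "\<And>c. P (Poly_Mapping.single 0 c)" and var: "\<And>i. P (variable i)"
    and add: "\<And>f g. P f \<Longrightarrow> P g \<Longrightarrow> P (f + g)" and mult: "\<And>f g. P f \<Longrightarrow> P g \<Longrightarrow> P (f * g)"
  shows "P f"
proof -
  have P0: "P 0" and P1: "P 1" using const[of 0] const[of 1] by simp_all
  have pow: "P (variable i ^ m)" for i m by (induction m) (auto simp: P1 var mult)
  have "P (\<Prod>i\<in>A. variable i ^ g i)" for g and A :: "'n set"
    by (induction A rule: infinite_finite_induct) (auto simp: P1 pow mult)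
  then have "P (Poly_Mapping.single t 1)" for t by (metis prod_variable_powers)
  then have "P (Poly_Mapping.single t c)" for t c
    using mult[OF const[of c], of "Poly_Mapping.single t 1"] by (simp add: mult_single)
  then have "P (\<Sum>t\<in>K. Poly_Mapping.single t (g t))" for g and K :: "('n \<Rightarrow>\<^sub>0 nat) set"
    by (induction K rule: infinite_finite_induct) (auto simp: P0 add)
  from this[of "Poly_Mapping.lookup f" "Poly_Mapping.keys f"] show ?thesis
    by (simp add: poly_mapping_sum_single)
qed

lemma is_ideal_zero_constant_term:
  "is_ideal {f :: ('n::finite, 'k::comm_ring_1) mpol. Poly_Mapping.lookup f 0 = 0}"
  by (rule is_idealI) (auto simp: lookup_add lookup_times_0)

text \<open>Every polynomial is congruent to its constant term modulo an ideal containing the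
  variables, by induction on its construction.\<close>

lemma zero_constant_term_in_ideal:
  fixes f :: "('n::finite, 'k::comm_ring_1) mpol"
  assumes K: "is_ideal K" "\<And>i. variable i \<in> K" and f: "Poly_Mapping.lookup f 0 = 0"
  shows "f \<in> K"
proof -
  have "f - Poly_Mapping.single 0 (Poly_Mapping.lookup f 0) \<in> K"
  proof (induction f rule: mpol_induct)
    case (const c)
    show ?case by (simp add: ideal_0[OF K(1)])
  next
    case (var i)
    show ?case by (simp add: K(2))
  next
    case (add f g)
    then show ?case using ideal_add[OF K(1) add] by (simp add: lookup_add single_add algebra_simps)
  next
    case (mult f g)
    let ?a = "Poly_Mapping.single 0 (Poly_Mapping.lookup f 0) :: ('n, 'k) mpol"
    let ?b = "Poly_Mapping.single 0 (Poly_Mapping.lookup g 0) :: ('n, 'k) mpol"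
    have "f * g - ?a * ?b = (f - ?a) * g + ?a * (g - ?b)" by (simp add: algebra_simps)
    then show ?case
      using mult ideal_add[OF K(1)] ideal_mult_left[OF K(1)] ideal_mult_right[OF K(1)]
      by (simp add: lookup_times_0 mult_single)
  qed
  then show ?thesis using f by simp
qed

lemma irrelevant_ideal_iff: "f \<in> irrelevant_ideal \<longleftrightarrow> Poly_Mapping.lookup f 0 = 0"
  for f :: "('n::finite, 'k::comm_ring_1) mpol"
proof
  assume "f \<in> irrelevant_ideal"
  moreover have "irrelevant_ideal \<subseteq> {f :: ('n, 'k) mpol. Poly_Mapping.lookup f 0 = 0}"
    unfolding irrelevant_ideal_def
    by (rule ring_module.span_minimal[OF _ is_ideal_zero_constant_term]) auto
  ultimately show "Poly_Mapping.lookup f 0 = 0" by blast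
next
  assume "Poly_Mapping.lookup f 0 = 0"
  show "f \<in> irrelevant_ideal"
    unfolding irrelevant_ideal_def
  proof (rule zero_constant_term_in_ideal)
    show "variable i \<in> ideal_span (range variable)" for i :: 'n
      by (rule ring_module.span_base[OF rangeI])
  qed (fact ring_module.subspace_span, fact)
qed

lemma homogeneous_pos_zero_constant_term:
  "homogeneous d f \<Longrightarrow> d > 0 \<Longrightarrow> Poly_Mapping.lookup f 0 = 0"
  unfolding homogeneous_def by (metis in_keys_iff mon_degree_0 of_nat_0 less_irrefl)

section \<open>Ideals generated by initial segments of a sequence\<close>

definition adjoin :: "'a::comm_ring_1 set \<Rightarrow> 'a \<Rightarrow> 'a set" where
  "adjoin J x = {j + c * x | j c. j \<in> J}"

lemma is_ideal_adjoin:
  assumes J: "is_ideal J"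
  shows "is_ideal (adjoin J x)"
proof (rule is_idealI)
  show "0 \<in> adjoin J x"
    unfolding adjoin_def using ideal_0[OF J] by (intro CollectI exI[of _ 0]) simp
  fix a b assume "a \<in> adjoin J x"
  then obtain j c where a: "a = j + c * x" "j \<in> J" by (auto simp: adjoin_def)
  have "b * a = b * j + (b * c) * x" by (simp add: a algebra_simps)
  then show "b * a \<in> adjoin J x"
    unfolding adjoin_def using ideal_mult_left[OF J a(2)] by blast
  assume "b \<in> adjoin J x"
  then obtain j' c' where b: "b = j' + c' * x" "j' \<in> J" by (auto simp: adjoin_def)
  have "a + b = (j + j') + (c + c') * x" by (simp add: a b algebra_simps)
  then show "a + b \<in> adjoin J x"
    unfolding adjoin_def using ideal_add[OF J a(2) b(2)] by blast
qed

lemma subset_adjoin: "J \<subseteq> adjoin J x"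
proof
  fix j assume "j \<in> J"
  then show "j \<in> adjoin J x" unfolding adjoin_def by (intro CollectI exI[of _ j] exI[of _ 0]) simp
qed

lemma mem_adjoin: "is_ideal J \<Longrightarrow> x \<in> adjoin J x"
  unfolding adjoin_def by (intro CollectI exI[of _ 0] exI[of _ 1]) (simp add: ideal_0)

lemma adjoin_minimal: "is_ideal K \<Longrightarrow> J \<subseteq> K \<Longrightarrow> x \<in> K \<Longrightarrow> adjoin J x \<subseteq> K"
  by (auto simp: adjoin_def intro!: ideal_add ideal_mult_left)

lemma graded_adjoin:
  assumes J: "graded J" and x: "homogeneous e x"
  shows "graded (adjoin J x)"
  unfolding graded_def
proof (intro conjI ballI allI)
  fix f d assume "f \<in> adjoin J x"
  then obtain j c where f: "f = j + x * c" "j \<in> J" by (auto simp: adjoin_def mult.commute)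
  have "hcomp d f = hcomp d j + x * hcomp (d - e) c"
    unfolding f(1) hcomp_add hcomp_mult_homogeneous[OF x] ..
  then have "hcomp d f = hcomp d j + hcomp (d - e) c * x" by (simp add: mult.commute)
  then show "hcomp d f \<in> adjoin J x" using graded_hcomp[OF J f(2)] unfolding adjoin_def by blast
qed (rule is_ideal_adjoin[OF graded_ideal[OF J]])

primrec seq_ideal :: "(nat \<Rightarrow> 'a::comm_ring_1) \<Rightarrow> nat \<Rightarrow> 'a set" where
  "seq_ideal y 0 = {0}"
| "seq_ideal y (Suc j) = adjoin (seq_ideal y j) (y j)"

lemma is_ideal_seq_ideal [simp]: "is_ideal (seq_ideal y j)"
  by (induction j) (simp_all add: is_ideal_adjoin)

lemma mem_seq_ideal: "l < j \<Longrightarrow> y l \<in> seq_ideal y j"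
  by (induction j) (auto simp: less_Suc_eq mem_adjoin dest: subsetD[OF subset_adjoin])

lemma seq_ideal_minimal:
  "is_ideal K \<Longrightarrow> (\<And>l. l < j \<Longrightarrow> y l \<in> K) \<Longrightarrow> seq_ideal y j \<subseteq> K"
proof (induction j)
  case (Suc j)
  then have "seq_ideal y j \<subseteq> K" "y j \<in> K" by simp_all
  then show ?case using adjoin_minimal[OF Suc.prems(1)] by simp
qed (simp add: ideal_0)

lemma graded_0: "graded {0}"
  by (simp add: graded_def)

lemma graded_seq_ideal: "(\<And>j. homogeneous 1 (y j)) \<Longrightarrow> graded (seq_ideal y j)"
  by (induction j) (auto simp: graded_0 intro: graded_adjoin)

definition linear_form :: "('n::finite \<Rightarrow> 'k) \<Rightarrow> ('n, 'k::comm_ring_1) mpol" where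
  "linear_form a = (\<Sum>i\<in>UNIV. Poly_Mapping.single 0 (a i) * variable i)"

lemma homogeneous_linear_form [simp]: "homogeneous 1 (linear_form a)"
  unfolding linear_form_def
  using homogeneous_mult[OF homogeneous_const homogeneous_variable] by (intro homogeneous_sum) simp

interpretation const: coefficient_hom
  "\<lambda>c :: 'k::comm_ring_1. Poly_Mapping.single 0 c :: ('n::finite, 'k) mpol"
  by standard (simp_all add: single_add mult_single)

text \<open>The ideal of the first \<open>j\<close> members of the sequence is the kernel of the substitution that
  eliminates the corresponding variables, hence prime.\<close>

lemma linear_form_regular_sequence:
  fixes a :: "'n::{finite,linorder} \<Rightarrow> 'k::field"
  assumes a: "a i0 \<noteq> 0"
  obtains y :: "nat \<Rightarrow> ('n, 'k) mpol" where "y 0 = linear_form a"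
    "\<And>j. j \<ge> 1 \<Longrightarrow> \<exists>i. y j = variable i" "\<And>j. homogeneous 1 (y j)"
    "\<And>j f. j < CARD('n) \<Longrightarrow> y j * f \<in> seq_ideal y j \<Longrightarrow> f \<in> seq_ideal y j"
    "\<And>i. variable i \<in> seq_ideal y (CARD('n))"
proof -
  let ?C = "\<lambda>c. Poly_Mapping.single 0 c :: ('n, 'k) mpol"
  obtain e0 :: "nat \<Rightarrow> 'n" where e0: "bij_betw e0 {0..<CARD('n)} UNIV"
    using ex_bij_betw_nat_finite[of "UNIV :: 'n set"] by auto
  then obtain k where k: "k < CARD('n)" "e0 k = i0"
    by (metis UNIV_I atLeastLessThan_iff bij_betw_imp_surj_on imageE)
  \<comment> \<open>The variables are enumerated with \<open>i0\<close> first, because the linear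
    form takes the place of that variable.\<close>
  define e where "e = e0 \<circ> transpose 0 k"
  have "bij_betw (transpose 0 k) {0..<CARD('n)} {0..<CARD('n)}"
    using k(1) by (intro bij_betw_byWitness[where f' = "transpose 0 k"])
      (auto simp: transpose_def)
  then have e: "bij_betw e {0..<CARD('n)} UNIV" unfolding e_def using e0 by (rule bij_betw_trans)
  have e_0: "e 0 = i0" by (simp add: e_def k(2))
  have inj: "e j = e l \<longleftrightarrow> j = l" if "j < CARD('n)" "l < CARD('n)" for j l
    using bij_betw_imp_inj_on[OF e] that by (auto simp: inj_on_def)
  define y where "y j = (if j = 0 then linear_form a else variable (e j))" for j
  have sigma: "\<exists>\<sigma> :: ('n, 'k) mpol \<Rightarrow> ('n, 'k) mpol. (\<forall>f. f \<in> seq_ideal y j \<longleftrightarrow> \<sigma> f = 0) \<and> (\<forall>f g. \<sigma> (f * g) = \<sigma> f * \<sigma> g) \<and>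
      (\<forall>i. i \<notin> e ` {0..<j} \<longrightarrow> \<sigma> (variable i) = variable i)"
    if j: "1 \<le> j" "j \<le> CARD('n)" for j
  proof -
    define A where "A = e ` {1..<j}"
    have i0A: "i0 \<notin> A"
    proof
      assume "i0 \<in> A"
      then obtain l where "e 0 = e l" "1 \<le> l" "l < j" using e_0 by (auto simp: A_def)
      then show False using inj[of 0 l] j by simp
    qed
    have A0: "e ` {0..<j} = insert i0 A"
    proof -
      have "{0..<j} = insert 0 {1..<j}" using j(1) by auto
      then show ?thesis by (simp add: A_def e_0)
    qed
    \<comment> \<open>Modulo the variables in \<open>A\<close> the linear form is
      \<open>a i0\<close> times \<open>variable i0 + r\<close>, so eliminating it means substituting
      \<open>- r\<close> for \<open>variable i0\<close>.\<close>
    define r where "r = (\<Sum>i\<in>UNIV - insert i0 A. ?C (a i / a i0) * variable i)"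
    define x where "x i = (if i \<in> A then 0 else if i = i0 then - r else variable i)" for i
    define \<sigma> where "\<sigma> = meval ?C x"
    have var: "\<sigma> (variable i) = x i" for i by (simp add: \<sigma>_def)
    have const: "\<sigma> (?C c) = ?C c" for c by (simp add: \<sigma>_def const.meval_single)
    have mult: "\<sigma> (f * g) = \<sigma> f * \<sigma> g" for f g by (simp add: \<sigma>_def const.meval_mult)
    have add: "\<sigma> (f + g) = \<sigma> f + \<sigma> g" for f g by (simp add: \<sigma>_def const.meval_add)
    have A_in: "variable i \<in> seq_ideal y j" if iA: "i \<in> A" for i
    proof -
      obtain l where l: "i = e l" "1 \<le> l" "l < j" using iA by (auto simp: A_def)
      then show ?thesis using mem_seq_ideal[of l j y] by (simp add: y_def)
    qed
    have ell_in: "linear_form a \<in> seq_ideal y j"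
      using mem_seq_ideal[of 0 j y] j(1) by (simp add: y_def)
    have split: "linear_form a = ?C (a i0) * (variable i0 + r) + (\<Sum>i\<in>A. ?C (a i) * variable i)"
    proof -
      have "linear_form a = (\<Sum>i\<in>UNIV - insert i0 A. ?C (a i) * variable i) +
          (\<Sum>i\<in>insert i0 A. ?C (a i) * variable i)"
        unfolding linear_form_def by (rule sum.subset_diff) auto
      also have "(\<Sum>i\<in>UNIV - insert i0 A. ?C (a i) * variable i) = ?C (a i0) * r"
        unfolding r_def sum_distrib_left using a
        by (intro sum.cong refl) (simp add: mult_single flip: mult.assoc)
      finally show ?thesis using i0A by (simp add: algebra_simps)
    qed
    have diff: "f - \<sigma> f \<in> seq_ideal y j" for f
    proof (induction f rule: mpol_induct)
      case (const c)
      then show ?case by (simp add: \<open>\<And>c. \<sigma> (?C c) = ?C c\<close> ideal_0)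
    next
      case (var i)
      have "variable i0 + r \<in> seq_ideal y j"
      proof -
        have "variable i0 + r = ?C (1 / a i0) * (?C (a i0) * (variable i0 + r))"
          using a by (simp add: mult_single flip: mult.assoc)
        also have "?C (a i0) * (variable i0 + r) = linear_form a - (\<Sum>i\<in>A. ?C (a i) * variable i)"
          by (simp add: split)
        also have "?C (1 / a i0) * \<dots> \<in> seq_ideal y j"
          by (intro ideal_mult_left ideal_diff ideal_sum ell_in A_in) simp_all
        finally show ?thesis .
      qed
      then show ?case unfolding \<open>\<And>i. \<sigma> (variable i) = x i\<close> x_def using A_in[of i]
        by (auto simp: ideal_0)
    next
      case (add f g)
      then have "(f - \<sigma> f) + (g - \<sigma> g) \<in> seq_ideal y j" by (intro ideal_add) simp_all
      then show ?case by (simp add: \<open>\<And>f g. \<sigma> (f + g) = \<sigma> f + \<sigma> g\<close> algebra_simps)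
    next
      case (mult f g)
      have "f * g - \<sigma> f * \<sigma> g = (f - \<sigma> f) * g + \<sigma> f * (g - \<sigma> g)" by (simp add: algebra_simps)
      moreover have "\<dots> \<in> seq_ideal y j"
        using mult by (intro ideal_add ideal_mult_left ideal_mult_right) simp_all
      ultimately show ?case by (simp add: \<open>\<And>f g. \<sigma> (f * g) = \<sigma> f * \<sigma> g\<close>)
    qed
    have "is_ideal {f. \<sigma> f = 0}"
      by (rule is_idealI) (auto simp: add mult, simp add: \<sigma>_def)
    moreover have "\<sigma> (y l) = 0" if "l < j" for l
    proof (cases "l = 0")
      case True
      have "\<sigma> r = r"
        unfolding r_def by (auto simp: \<sigma>_def const.meval_sum const.meval_mult const.meval_single x_def
            intro!: sum.cong)
      moreover have "\<sigma> (\<Sum>i\<in>A. ?C (a i) * variable i) = 0"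
        unfolding \<sigma>_def const.meval_sum by (intro sum.neutral) (simp add: const.meval_mult x_def)
      ultimately show ?thesis
        using True by (simp add: y_def split add mult var x_def i0A)
    next
      case False
      then show ?thesis using that by (simp add: y_def var x_def A_def)
    qed
    ultimately have "seq_ideal y j \<subseteq> {f. \<sigma> f = 0}" by (intro seq_ideal_minimal) simp_all
    moreover have "f \<in> seq_ideal y j" if "\<sigma> f = 0" for f using diff[of f] that by simp
    ultimately have "\<forall>f. f \<in> seq_ideal y j \<longleftrightarrow> \<sigma> f = 0" by blast
    moreover have "\<forall>i. i \<notin> e ` {0..<j} \<longrightarrow> \<sigma> (variable i) = variable i"
      unfolding A0 by (simp add: var x_def)
    ultimately show ?thesis using mult by (intro exI[of _ \<sigma>]) simp
  qed
  have var_nz: "variable i \<noteq> (0 :: ('n, 'k) mpol)" for i by (simp add: variable_def)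
  show thesis
  proof (rule that[of y])
    show "y 0 = linear_form a" by (simp add: y_def)
    show "\<exists>i. y j = variable i" if "j \<ge> 1" for j using that by (auto simp: y_def)
    show "homogeneous 1 (y j)" for j by (simp add: y_def)
    show "f \<in> seq_ideal y j" if j: "j < CARD('n)" and f: "y j * f \<in> seq_ideal y j" for j f
    proof (cases "j = 0")
      case True
      have "linear_form a \<noteq> 0"
      proof
        assume "linear_form a = 0"
        then have "Poly_Mapping.lookup (linear_form a) (Poly_Mapping.single i0 1) = 0" by simp
        moreover have "Poly_Mapping.lookup (linear_form a) (Poly_Mapping.single i0 1) =
            (\<Sum>i\<in>UNIV. if i = i0 then a i else 0)"
          unfolding linear_form_def lookup_sum variable_def mult_single
        proof (intro sum.cong refl)
          fix i
          have "Poly_Mapping.single i (1::nat) = Poly_Mapping.single i0 1 \<longleftrightarrow> i = i0"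
            by (metis lookup_single_eq lookup_single_not_eq one_neq_zero)
          then show "Poly_Mapping.lookup (Poly_Mapping.single (0 + Poly_Mapping.single i (1::nat)) (a i * 1))
              (Poly_Mapping.single i0 1) = (if i = i0 then a i else 0)"
            by (simp add: lookup_single when_def)
        qed
        ultimately show False using a by simp
      qed
      then show ?thesis using f True by (simp add: y_def)
    next
      case False
      then obtain \<sigma> where \<sigma>: "\<And>f. f \<in> seq_ideal y j \<longleftrightarrow> \<sigma> f = 0" "\<And>f g. \<sigma> (f * g) = \<sigma> f * \<sigma> g"
        "\<And>i. i \<notin> e ` {0..<j} \<Longrightarrow> \<sigma> (variable i) = (variable i :: ('n, 'k) mpol)"
        using sigma[of j] j by auto
      \<comment> \<open>The variable \<open>e j\<close> has not been eliminated yet, so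
        \<open>y j\<close> is sent to a nonzero element of a domain and cancels there.\<close>
      have "e j \<notin> e ` {0..<j}" using inj j by auto
      then have "\<sigma> (y j) = variable (e j)" using False \<sigma>(3) by (simp add: y_def)
      then show ?thesis using f var_nz by (simp add: \<sigma>(1,2))
    qed
    show "variable i \<in> seq_ideal y (CARD('n))" for i
    proof -
      have C: "1 \<le> CARD('n)" by (simp add: Suc_leI)
      obtain l where l: "l < CARD('n)" "i = e l"
        using bij_betw_imp_surj_on[OF e] by (metis UNIV_I atLeastLessThan_iff imageE)
      show ?thesis
      proof (cases "l = 0")
        case False
        then show ?thesis using mem_seq_ideal[of l "CARD('n)" y] l by (simp add: y_def)
      next
        case True
        have others: "variable (e l) \<in> seq_ideal y (CARD('n))" if "l \<noteq> 0" "l < CARD('n)" for l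
          using mem_seq_ideal[of l "CARD('n)" y] that by (simp add: y_def)
        have "variable i' \<in> seq_ideal y (CARD('n))" if "i' \<noteq> i0" for i'
        proof -
          obtain l where "l < CARD('n)" "i' = e l"
            using bij_betw_imp_surj_on[OF e] by (metis UNIV_I atLeastLessThan_iff imageE)
          then show ?thesis using others that e_0 by metis
        qed
        then have sum_in: "(\<Sum>i'\<in>UNIV - {i0}. ?C (a i') * variable i') \<in> seq_ideal y (CARD('n))"
          by (intro ideal_sum ideal_mult_left) auto
        have ell_in: "linear_form a \<in> seq_ideal y (CARD('n))"
          using mem_seq_ideal[of 0 "CARD('n)" y] C by (simp add: y_def)
        have "linear_form a = ?C (a i0) * variable i0 + (\<Sum>i'\<in>UNIV - {i0}. ?C (a i') * variable i')"
          unfolding linear_form_def by (rule sum.remove) auto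
        then have "?C (a i0) * variable i0 = linear_form a - (\<Sum>i'\<in>UNIV - {i0}. ?C (a i') * variable i')"
          by simp
        then have "?C (a i0) * variable i0 \<in> seq_ideal y (CARD('n))"
          using ideal_diff[OF is_ideal_seq_ideal ell_in sum_in] by simp
        then have "?C (1 / a i0) * (?C (a i0) * variable i0) \<in> seq_ideal y (CARD('n))"
          by (rule ideal_mult_left[OF is_ideal_seq_ideal])
        then show ?thesis using a True l(2) e_0 by (simp add: mult_single flip: mult.assoc)
      qed
    qed
  qed
qed

section \<open>Graded complexes of free modules\<close>

text \<open>Homogeneity of degree d in the sum of the modules R[-sh p], whose p-th generator sits in
  degree \<open>sh p\<close>.\<close>

definition vhom :: "(nat \<Rightarrow> int) \<Rightarrow> int \<Rightarrow> ('n::finite, 'k::zero) mvec \<Rightarrow> bool" where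
  "vhom sh d v \<longleftrightarrow> (\<forall>p. homogeneous (d - sh p) (Poly_Mapping.lookup v p))"

definition vcomp :: "(nat \<Rightarrow> int) \<Rightarrow> int \<Rightarrow> ('n::finite, 'k::zero) mvec \<Rightarrow> ('n, 'k) mvec" where
  "vcomp sh d v = Poly_Mapping.mapp (\<lambda>p. hcomp (d - sh p)) v"

lemma lookup_vcomp [simp]:
  "Poly_Mapping.lookup (vcomp sh d v) p = hcomp (d - sh p) (Poly_Mapping.lookup v p)"
  by (simp add: vcomp_def lookup_mapp when_def in_keys_iff)

lemma vhom_vcomp [simp]: "vhom sh d (vcomp sh d v)"
  by (simp add: vhom_def)

lemma vcomp_vhom:
  assumes "vhom sh d v"
  shows "vcomp sh e v = (if e = d then v else 0)"
proof (rule poly_mapping_eqI)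
  fix p
  from assms have "homogeneous (d - sh p) (Poly_Mapping.lookup v p)" by (simp add: vhom_def)
  from hcomp_homogeneous[OF this, of "e - sh p"]
  show "Poly_Mapping.lookup (vcomp sh e v) p = Poly_Mapping.lookup (if e = d then v else 0) p" by simp
qed

lemma vcomp_free_mod: "v \<in> free_mod m \<Longrightarrow> vcomp sh d v \<in> free_mod m"
  by (simp add: free_mod_iff)

lemma vcomp_add: "vcomp sh d (v + w) = vcomp sh d v + vcomp sh d w"
  for v :: "('n::finite, 'k::comm_ring_1) mvec"
  by (rule poly_mapping_eqI) (simp add: lookup_add hcomp_add)

lemma vcomp_diff: "vcomp sh d (v - w) = vcomp sh d v - vcomp sh d w"
  for v :: "('n::finite, 'k::comm_ring_1) mvec"
  by (rule poly_mapping_eqI) (simp add: lookup_minus hcomp_diff)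

lemma vcomp_0 [simp]: "vcomp sh d 0 = 0"
  by (rule poly_mapping_eqI) simp

lemma vcomp_sum: "vcomp sh d (sum f A) = (\<Sum>i\<in>A. vcomp sh d (f i))"
  for f :: "_ \<Rightarrow> ('n::finite, 'k::comm_ring_1) mvec"
  by (induction A rule: infinite_finite_induct) (auto simp: vcomp_add)

lemma vcomp_vscale_vhom:
  fixes v :: "('n::finite, 'k::comm_ring_1) mvec"
  assumes "vhom sh e v"
  shows "vcomp sh d (vscale c v) = vscale (hcomp (d - e) c) v"
proof (rule poly_mapping_eqI)
  fix p
  have "homogeneous (e - sh p) (Poly_Mapping.lookup v p)" using assms by (simp add: vhom_def)
  from hcomp_mult_homogeneous[OF this, of "d - sh p" c]
  show "Poly_Mapping.lookup (vcomp sh d (vscale c v)) p =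
      Poly_Mapping.lookup (vscale (hcomp (d - e) c) v) p"
    by (simp add: mult.commute)
qed

lemma vcomp_vscale_homogeneous:
  fixes v :: "('n::finite, 'k::comm_ring_1) mvec"
  assumes "homogeneous e c"
  shows "vcomp sh d (vscale c v) = vscale c (vcomp sh (d - e) v)"
  by (rule poly_mapping_eqI) (simp add: hcomp_mult_homogeneous[OF assms] diff_diff_eq add.commute)

definition jvec :: "'r::comm_ring_1 set \<Rightarrow> (nat \<Rightarrow>\<^sub>0 'r) set" where
  "jvec J = {v. \<forall>p. Poly_Mapping.lookup v p \<in> J}"

lemma subspace_jvec: "is_ideal J \<Longrightarrow> vec_module.subspace (jvec J)"
  by (auto simp: vec_module.subspace_def jvec_def lookup_add ideal_0 ideal_add ideal_mult_left)

lemma jvec_mono: "J \<subseteq> K \<Longrightarrow> jvec J \<subseteq> jvec K"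
  by (auto simp: jvec_def)

lemma jvec_0 [simp]: "jvec {0} = {0}"
  by (auto simp: jvec_def intro!: poly_mapping_eqI)

lemma jvec_vscale: "is_ideal J \<Longrightarrow> c \<in> J \<Longrightarrow> vscale c v \<in> jvec J"
  by (simp add: jvec_def ideal_mult_right)

lemma jvec_cancel:
  "vscale x v \<in> jvec J \<Longrightarrow> (\<And>f. x * f \<in> J \<Longrightarrow> f \<in> J) \<Longrightarrow> v \<in> jvec J"
  by (simp add: jvec_def)

lemma jvec_vcomp: "graded J \<Longrightarrow> v \<in> jvec J \<Longrightarrow> vcomp sh d v \<in> jvec J"
  by (simp add: jvec_def graded_hcomp)

lemma jvec_adjoin:
  assumes J: "is_ideal J" and v: "v \<in> jvec (adjoin J x)" "v \<in> free_mod m"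
  obtains w where "w \<in> free_mod m" "v - vscale x w \<in> jvec J"
proof -
  have "\<exists>c. Poly_Mapping.lookup v p - x * c \<in> J" for p
  proof -
    have "Poly_Mapping.lookup v p \<in> adjoin J x" using v(1) by (simp add: jvec_def)
    then obtain j c where jc: "j \<in> J" "Poly_Mapping.lookup v p = j + c * x"
      unfolding adjoin_def by blast
    then have "Poly_Mapping.lookup v p - x * c = j" by (simp add: mult.commute)
    then show ?thesis using jc(1) by metis
  qed
  then obtain c where c: "\<And>p. Poly_Mapping.lookup v p - x * c p \<in> J" by metis
  \<comment> \<open>The quotients are used only on the support of \<open>v\<close>, which keeps the
    witness in \<open>free_mod m\<close>; elsewhere the difference is 0.\<close>
  define w where "w = (\<Sum>p\<in>Poly_Mapping.keys v. Poly_Mapping.single p (c p))"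
  have w: "Poly_Mapping.lookup w p = (if p \<in> Poly_Mapping.keys v then c p else 0)" for p
    by (simp add: w_def lookup_sum lookup_single when_def)
  show thesis
  proof
    show "w \<in> free_mod m" using v(2) by (auto simp: free_mod_iff w in_keys_iff)
    show "v - vscale x w \<in> jvec J"
      using c ideal_0[OF J] by (auto simp: jvec_def lookup_minus w in_keys_iff)
  qed
qed

text \<open>The map of free modules with matrix columns \<open>g 0\<close>, ...,
  \<open>g (m - 1)\<close>. Entries of \<open>v\<close> from position m on are ignored, so linearity
  holds on the whole type.\<close>

definition vlin :: "nat \<Rightarrow> (nat \<Rightarrow> (nat \<Rightarrow>\<^sub>0 'r)) \<Rightarrow> (nat \<Rightarrow>\<^sub>0 'r::comm_ring_1) \<Rightarrow> (nat \<Rightarrow>\<^sub>0 'r)" where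
  "vlin m g v = (\<Sum>q<m. vscale (Poly_Mapping.lookup v q) (g q))"

lemma lookup_vlin: "Poly_Mapping.lookup (vlin m g v) p =
    (\<Sum>q<m. Poly_Mapping.lookup v q * Poly_Mapping.lookup (g q) p)"
  by (simp add: vlin_def lookup_sum)

lemma vlin_add: "vlin m g (v + w) = vlin m g v + vlin m g w"
  by (simp add: vlin_def lookup_add vec_module.scale_left_distrib sum.distrib)

lemma vlin_diff: "vlin m g (v - w) = vlin m g v - vlin m g w"
  by (simp add: vlin_def lookup_minus vec_module.scale_left_diff_distrib sum_subtractf)

lemma vlin_vscale: "vlin m g (vscale c v) = vscale c (vlin m g v)"
  by (simp add: vlin_def vec_module.scale_sum_right)

lemma vlin_0 [simp]: "vlin m g 0 = 0"
  by (simp add: vlin_def)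

lemma vlin_in_subspace:
  "vec_module.subspace N \<Longrightarrow> (\<And>q. q < m \<Longrightarrow> g q \<in> N) \<Longrightarrow> vlin m g v \<in> N"
  unfolding vlin_def by (intro vec_module.subspace_sum vec_module.subspace_scale) auto

lemma vlin_jvec: "is_ideal J \<Longrightarrow> v \<in> jvec J \<Longrightarrow> vlin m g v \<in> jvec J"
  unfolding vlin_def by (intro vec_module.subspace_sum subspace_jvec jvec_vscale) (auto simp: jvec_def)

lemma vlin_single: "q < m \<Longrightarrow> vlin m g (Poly_Mapping.single q c) = vscale c (g q)"
proof -
  assume "q < m"
  have "vlin m g (Poly_Mapping.single q c) = (\<Sum>p<m. if p = q then vscale c (g p) else 0)"
    unfolding vlin_def by (intro sum.cong refl) (auto simp: lookup_single when_def)
  then show ?thesis using \<open>q < m\<close> by simp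
qed

lemma vcomp_vlin:
  fixes g :: "nat \<Rightarrow> ('n::finite, 'k::comm_ring_1) mvec"
  assumes "\<And>q. q < m \<Longrightarrow> vhom sh (sh' q) (g q)"
  shows "vcomp sh d (vlin m g v) = vlin m g (vcomp sh' d v)"
  unfolding vlin_def vcomp_sum using assms by (intro sum.cong refl) (simp add: vcomp_vscale_vhom)

text \<open>The columns \<open>g i\<close> describe the map from the module of index
  \<open>Suc i\<close> to that of index \<open>i\<close>. Exactness is required at all positive
  indices; at index 0 the cokernel is the module being resolved.\<close>

locale graded_complex =
  fixes rk :: "nat \<Rightarrow> nat" and sh :: "nat \<Rightarrow> nat \<Rightarrow> int"
    and g :: "nat \<Rightarrow> nat \<Rightarrow> ('n::{finite,linorder}, 'k::field) mvec"
  assumes cols: "\<And>i q. q < rk (Suc i) \<Longrightarrow> g i q \<in> free_mod (rk i)"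
    and cols_hom: "\<And>i q. q < rk (Suc i) \<Longrightarrow> vhom (sh i) (sh (Suc i) q) (g i q)"
    and complex: "\<And>i w. vlin (rk (Suc i)) (g i) (vlin (rk (Suc (Suc i))) (g (Suc i)) w) = 0"
    and exact: "\<And>i v. v \<in> free_mod (rk (Suc i)) \<Longrightarrow> vlin (rk (Suc i)) (g i) v = 0 \<Longrightarrow>
      \<exists>w\<in>free_mod (rk (Suc (Suc i))). vlin (rk (Suc (Suc i))) (g (Suc i)) w = v"
begin

definition phi :: "nat \<Rightarrow> ('n, 'k) mvec \<Rightarrow> ('n, 'k) mvec" where
  "phi i v = vlin (rk (Suc i)) (g i) v"

lemma phi_add: "phi i (v + w) = phi i v + phi i w"
  and phi_diff: "phi i (v - w) = phi i v - phi i w"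
  and phi_vscale: "phi i (vscale c v) = vscale c (phi i v)"
  and phi_0 [simp]: "phi i 0 = 0"
  and phi_jvec: "is_ideal J \<Longrightarrow> v \<in> jvec J \<Longrightarrow> phi i v \<in> jvec J"
  by (simp_all add: phi_def vlin_add vlin_diff vlin_vscale vlin_jvec)

lemma phi_free_mod: "phi i v \<in> free_mod (rk i)"
  unfolding phi_def by (intro vlin_in_subspace subspace_free_mod cols)

lemma phi_phi [simp]: "phi i (phi (Suc i) w) = 0"
  using complex by (simp add: phi_def)

lemma phi_exact:
  "v \<in> free_mod (rk (Suc i)) \<Longrightarrow> phi i v = 0 \<Longrightarrow> \<exists>w\<in>free_mod (rk (Suc (Suc i))). phi (Suc i) w = v"
  using exact by (simp add: phi_def)

lemma vcomp_phi: "vcomp (sh i) d (phi i v) = phi i (vcomp (sh (Suc i)) d v)"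
  unfolding phi_def by (intro vcomp_vlin cols_hom)

section \<open>Reduction of a complex modulo regular sequences\<close>

definition near :: "nat \<Rightarrow> ('n, 'k) mpol set \<Rightarrow> ('n, 'k) mvec \<Rightarrow> bool" where
  "near j K v \<longleftrightarrow> (\<exists>u\<in>free_mod (rk (Suc j)). v - phi j u \<in> jvec K)"

text \<open>Exactness at index \<open>Suc i\<close> after reduction modulo \<open>J\<close>. Working
  with congruences through \<open>near\<close> avoids quotient rings.\<close>

definition exact_mod :: "('n, 'k) mpol set \<Rightarrow> nat \<Rightarrow> bool" where
  "exact_mod J i \<longleftrightarrow> (\<forall>v\<in>free_mod (rk (Suc i)). phi i v \<in> jvec J \<longrightarrow> near (Suc i) J v)"

lemma exact_mod_0: "exact_mod {0} i"
  unfolding exact_mod_def near_def using phi_exact by force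

text \<open>The chase behind the long exact sequence of multiplication by x: homology modulo x is
  squeezed between the homology at the same index and at the preceding one. Hence each further
  element costs one index.\<close>

lemma exact_mod_adjoin:
  assumes J: "is_ideal J" and reg: "\<And>f. x * f \<in> J \<Longrightarrow> f \<in> J"
    and ex: "exact_mod J i" "exact_mod J (Suc i)"
  shows "exact_mod (adjoin J x) (Suc i)"
  unfolding exact_mod_def
proof (intro ballI impI)
  note S = subspace_jvec[OF J]
  fix v assume v: "v \<in> free_mod (rk (Suc (Suc i)))" and "phi (Suc i) v \<in> jvec (adjoin J x)"
  then obtain w where w: "w \<in> free_mod (rk (Suc i))" "phi (Suc i) v - vscale x w \<in> jvec J"
    using jvec_adjoin[OF J _ phi_free_mod] by blast
  have "phi i (phi (Suc i) v - vscale x w) \<in> jvec J" by (rule phi_jvec[OF J w(2)])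
  then have "vscale x (phi i w) \<in> jvec J"
    using vec_module.subspace_neg[OF S] by (fastforce simp: phi_diff phi_vscale)
  then have "phi i w \<in> jvec J" by (rule jvec_cancel) (rule reg)
  then obtain u where u: "u \<in> free_mod (rk (Suc (Suc i)))" "w - phi (Suc i) u \<in> jvec J"
    using ex(1) w(1) by (auto simp: exact_mod_def near_def)
  have "phi (Suc i) (v - vscale x u) = (phi (Suc i) v - vscale x w) + vscale x (w - phi (Suc i) u)"
    by (simp add: phi_diff phi_vscale vec_module.scale_right_diff_distrib)
  also have "\<dots> \<in> jvec J"
    using w(2) u(2) by (intro vec_module.subspace_add[OF S] vec_module.subspace_scale[OF S])
  finally have "near (Suc (Suc i)) J (v - vscale x u)"
    using ex(2) v u(1) by (simp add: exact_mod_def vec_module.subspace_diff vec_module.subspace_scale)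
  then obtain u' where u': "u' \<in> free_mod (rk (Suc (Suc (Suc i))))"
      "v - vscale x u - phi (Suc (Suc i)) u' \<in> jvec J"
    by (auto simp: near_def)
  have "v - phi (Suc (Suc i)) u' = (v - vscale x u - phi (Suc (Suc i)) u') + vscale x u" by simp
  also have "\<dots> \<in> jvec (adjoin J x)"
    using u'(2) jvec_mono[OF subset_adjoin, of J x]
    by (intro vec_module.subspace_add[OF subspace_jvec[OF is_ideal_adjoin[OF J]]]
        jvec_vscale[OF is_ideal_adjoin[OF J] mem_adjoin[OF J]]) blast
  finally show "near (Suc (Suc i)) (adjoin J x) v" using u'(1) by (auto simp: near_def)
qed

lemma exact_mod_seq_ideal:
  assumes reg: "\<And>j f. j < m \<Longrightarrow> y j * f \<in> seq_ideal y j \<Longrightarrow> f \<in> seq_ideal y j"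
  shows "j \<le> m \<Longrightarrow> j \<le> i \<Longrightarrow> exact_mod (seq_ideal y j) i"
proof (induction j arbitrary: i)
  case (Suc j)
  then obtain i' where "i = Suc i'" by (cases i) auto
  then show ?case using Suc reg[of j] by (auto intro!: exact_mod_adjoin)
qed (simp add: exact_mod_0)

text \<open>If the first element is regular also on the cokernel of \<open>phi 0\<close>, the first
  reduction costs no index, and one index more survives throughout: \<open>j \<le> Suc i\<close> in
  place of \<open>j \<le> i\<close>.\<close>

lemma exact_mod_seq_ideal':
  assumes reg: "\<And>j f. j < m \<Longrightarrow> y j * f \<in> seq_ideal y j \<Longrightarrow> f \<in> seq_ideal y j"
    and ex: "exact_mod (seq_ideal y 1) 0"
  shows "1 \<le> j \<Longrightarrow> j \<le> m \<Longrightarrow> j \<le> Suc i \<Longrightarrow> exact_mod (seq_ideal y j) i"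
proof (induction j arbitrary: i rule: nat_induct_at_least)
  case base
  show ?case using ex exact_mod_seq_ideal[OF reg, of m 1 i] base by (cases i) auto
next
  case (Suc j)
  then obtain i' where "i = Suc i'" by (cases i) auto
  then show ?case using Suc reg[of j] by (auto intro!: exact_mod_adjoin)
qed

text \<open>Hilbert's syzygy theorem: modulo the irrelevant ideal the complex stays exact from index
  \<open>CARD('n)\<close> on, whereas minimality makes its maps zero.\<close>

lemma minimal_complex_length:
  assumes minimal: "\<And>i p q. q < rk (Suc (Suc i)) \<Longrightarrow>
      Poly_Mapping.lookup (Poly_Mapping.lookup (g (Suc i) q) p) 0 = 0"
    and i: "i \<ge> CARD('n)"
  shows "rk (Suc i) = 0"
proof (rule ccontr)
  assume "rk (Suc i) \<noteq> 0"
  obtain y :: "nat \<Rightarrow> ('n, 'k) mpol" where y: "\<And>j. homogeneous 1 (y j)"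
    "\<And>j f. j < CARD('n) \<Longrightarrow> y j * f \<in> seq_ideal y j \<Longrightarrow> f \<in> seq_ideal y j"
    "\<And>i. variable i \<in> seq_ideal y (CARD('n))"
    by (rule linear_form_regular_sequence[of "\<lambda>_. 1"]) auto
  let ?M = "seq_ideal y (CARD('n))"
  have M: "f \<in> ?M \<longleftrightarrow> Poly_Mapping.lookup f 0 = 0" for f
  proof -
    have "?M \<subseteq> {f. Poly_Mapping.lookup f 0 = 0}"
      using homogeneous_pos_zero_constant_term[OF y(1)]
      by (intro seq_ideal_minimal is_ideal_zero_constant_term) simp
    then show ?thesis using zero_constant_term_in_ideal[OF is_ideal_seq_ideal y(3)] by blast
  qed
  have S: "vec_module.subspace (jvec ?M)" by (simp add: subspace_jvec)
  have im: "phi (Suc i) w \<in> jvec ?M" for i w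
    unfolding phi_def using minimal by (intro vlin_in_subspace S) (simp add: jvec_def M)
  \<comment> \<open>\<open>phi i\<close> itself must vanish modulo the variables, and minimality
    speaks of maps of positive index.\<close>
  obtain i' where i': "i = Suc i'" using i by (cases i) auto
  let ?v = "Poly_Mapping.single 0 1 :: ('n, 'k) mvec"
  have "exact_mod ?M i" using exact_mod_seq_ideal[OF y(2)] i by blast
  moreover have "?v \<in> free_mod (rk (Suc i))" using \<open>rk (Suc i) \<noteq> 0\<close> by (auto simp: free_mod_def)
  ultimately obtain u where "?v - phi (Suc i) u \<in> jvec ?M"
    using im[of i' ?v] by (auto simp: exact_mod_def near_def i')
  then have "?v \<in> jvec ?M" using vec_module.subspace_add[OF S _ im[of i u]] by fastforce
  then have "Poly_Mapping.lookup ?v 0 \<in> ?M" unfolding jvec_def by blast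
  then show False by (simp add: M)
qed

text \<open>The socle of \<open>coker (phi j)\<close> modulo \<open>K\<close> vanishes in degrees at least \<open>d\<close>.\<close>

definition socle_vanishes :: "int \<Rightarrow> nat \<Rightarrow> ('n, 'k) mpol set \<Rightarrow> bool" where
  "socle_vanishes d j K \<longleftrightarrow> (\<forall>e v. e \<ge> d \<longrightarrow> v \<in> free_mod (rk j) \<longrightarrow> vhom (sh j) e v \<longrightarrow>
     (\<forall>i. near j K (vscale (variable i) v)) \<longrightarrow> near j K v)"

text \<open>Multiplying a socle element v by x gives \<open>phi j u\<close> modulo \<open>J\<close>,
  with u of degree one higher. This u is a socle element at the next index modulo x; if u is trivial
  there, x can be cancelled and v is trivial. The socle thus moves along the resolution, gaining one
  degree at each index.\<close>

lemma socle_vanishes_step: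
  assumes J: "graded J" and reg: "\<And>f. variable k * f \<in> J \<Longrightarrow> f \<in> J" and ex: "exact_mod J j"
    and step: "socle_vanishes (d + 1) (Suc j) (adjoin J (variable k))"
  shows "socle_vanishes d j J"
  unfolding socle_vanishes_def
proof (intro allI impI)
  note I = graded_ideal[OF J]
  note S = subspace_jvec[OF I]
  let ?x = "variable k" and ?K = "adjoin J (variable k)"
  note S' = subspace_jvec[OF is_ideal_adjoin[OF I, of ?x]]
  fix e v assume e: "e \<ge> d" and v: "v \<in> free_mod (rk j)" "vhom (sh j) e v"
    and soc: "\<forall>i. near j J (vscale (variable i) v)"
  then obtain u0 where u0: "u0 \<in> free_mod (rk (Suc j))" "vscale ?x v - phi j u0 \<in> jvec J"
    by (auto simp: near_def)
  \<comment> \<open>Passing to the component of degree e + 1 makes the lift homogeneous, as the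
    socle condition at the next index demands.\<close>
  define u where "u = vcomp (sh (Suc j)) (e + 1) u0"
  have u: "u \<in> free_mod (rk (Suc j))" "vhom (sh (Suc j)) (e + 1) u"
    using u0(1) by (simp_all add: u_def vcomp_free_mod)
  have "vcomp (sh j) (e + 1) (vscale ?x v - phi j u0) \<in> jvec J" by (rule jvec_vcomp[OF J u0(2)])
  then have xv: "vscale ?x v - phi j u \<in> jvec J"
    using v(2) by (simp add: vcomp_diff vcomp_phi u_def vcomp_vscale_homogeneous[OF homogeneous_variable] vcomp_vhom)
  have "near (Suc j) ?K (vscale (variable i) u)" for i
  proof -
    obtain ui where ui: "ui \<in> free_mod (rk (Suc j))" "vscale (variable i) v - phi j ui \<in> jvec J"
      using soc by (auto simp: near_def)
    \<comment> \<open>Multiplying by \<open>variable i\<close> and by x commutes, so the difference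
      of the two lifts is a cycle modulo \<open>J\<close>, and exactness makes it a
      boundary.\<close>
    have "phi j (vscale (variable i) u - vscale ?x ui) =
        vscale ?x (vscale (variable i) v - phi j ui) - vscale (variable i) (vscale ?x v - phi j u)"
      by (simp add: phi_diff phi_vscale vec_module.scale_right_diff_distrib mult.commute)
    also have "\<dots> \<in> jvec J"
      by (rule vec_module.subspace_diff[OF S vec_module.subspace_scale[OF S ui(2)]
            vec_module.subspace_scale[OF S xv]])
    finally have "near (Suc j) J (vscale (variable i) u - vscale ?x ui)"
      using ex u(1) ui(1) by (simp add: exact_mod_def vec_module.subspace_diff vec_module.subspace_scale)
    then obtain w where w: "w \<in> free_mod (rk (Suc (Suc j)))"
        "vscale (variable i) u - vscale ?x ui - phi (Suc j) w \<in> jvec J"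
      by (auto simp: near_def)
    have "vscale (variable i) u - phi (Suc j) w =
        (vscale (variable i) u - vscale ?x ui - phi (Suc j) w) + vscale ?x ui" by simp
    also have "\<dots> \<in> jvec ?K"
      using w(2) jvec_mono[OF subset_adjoin, of J ?x]
      by (intro vec_module.subspace_add[OF S'] jvec_vscale[OF is_ideal_adjoin[OF I] mem_adjoin[OF I]]) blast
    finally show ?thesis using w(1) by (auto simp: near_def)
  qed
  then have "near (Suc j) ?K u" using step u e
    unfolding socle_vanishes_def by (metis add_le_cancel_right)
  then obtain w where w: "w \<in> free_mod (rk (Suc (Suc j)))" "u - phi (Suc j) w \<in> jvec ?K"
    by (auto simp: near_def)
  have "u - phi (Suc j) w \<in> free_mod (rk (Suc j))"
    using u(1) phi_free_mod by (simp add: vec_module.subspace_diff)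
  then obtain a where a: "a \<in> free_mod (rk (Suc j))" "u - phi (Suc j) w - vscale ?x a \<in> jvec J"
    using jvec_adjoin[OF I w(2)] by blast
  have "phi j (u - phi (Suc j) w - vscale ?x a) \<in> jvec J" by (rule phi_jvec[OF I a(2)])
  then have "phi j u - vscale ?x (phi j a) \<in> jvec J" by (simp add: phi_diff phi_vscale)
  from vec_module.subspace_add[OF S xv this] have "vscale ?x (v - phi j a) \<in> jvec J"
    by (simp add: vec_module.scale_right_diff_distrib)
  then have "v - phi j a \<in> jvec J" by (rule jvec_cancel) (rule reg)
  then show "near j J v" using a(1) by (auto simp: near_def)
qed

text \<open>Modulo all variables only the generators survive, and these have degrees below
  d.\<close>

lemma socle_vanishes_base:
  assumes K: "is_ideal K" "\<And>i. variable i \<in> K" and sh: "\<And>p. p < rk j \<Longrightarrow> sh j p < d"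
  shows "socle_vanishes d j K"
  unfolding socle_vanishes_def
proof (intro allI impI)
  fix e and v :: "('n, 'k) mvec"
  assume e: "e \<ge> d" and v: "v \<in> free_mod (rk j)" "vhom (sh j) e v"
  have "Poly_Mapping.lookup v p \<in> K" for p
  proof (cases "p < rk j")
    case True
    then have "homogeneous (e - sh j p) (Poly_Mapping.lookup v p)" "e - sh j p > 0"
      using v(2) sh[OF True] e by (auto simp: vhom_def)
    then show ?thesis
      by (intro zero_constant_term_in_ideal[OF K] homogeneous_pos_zero_constant_term)
  next
    case False
    then show ?thesis using v(1) ideal_0[OF K(1)] by (simp add: free_mod_iff)
  qed
  then have "v - phi j 0 \<in> jvec K" by (simp add: jvec_def)
  then show "near j K v"
    using vec_module.subspace_0[OF subspace_free_mod] unfolding near_def by blast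
qed

end

section \<open>Minimal free resolutions\<close>

text \<open>Bridge between vectors of fixed dimension, in which resolutions are defined, and
  finitely supported ones, in which the chases are done.\<close>

definition tovec :: "nat \<Rightarrow> (nat \<Rightarrow>\<^sub>0 'r::zero) \<Rightarrow> 'r vec" where
  "tovec m v = Matrix.vec m (Poly_Mapping.lookup v)"

definition ofvec :: "'r::comm_ring_1 vec \<Rightarrow> (nat \<Rightarrow>\<^sub>0 'r)" where
  "ofvec w = (\<Sum>p<dim_vec w. Poly_Mapping.single p (w $ p))"

lemma tovec_carrier [simp]: "tovec m v \<in> carrier_vec m"
  by (simp add: tovec_def)

lemma index_tovec [simp]: "p < m \<Longrightarrow> tovec m v $ p = Poly_Mapping.lookup v p"
  by (simp add: tovec_def)

lemma dim_tovec [simp]: "dim_vec (tovec m v) = m"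
  by (simp add: tovec_def)

lemma lookup_ofvec: "Poly_Mapping.lookup (ofvec w) p = (if p < dim_vec w then w $ p else 0)"
  by (simp add: ofvec_def lookup_sum lookup_single when_def)

lemma tovec_ofvec: "w \<in> carrier_vec m \<Longrightarrow> tovec m (ofvec w) = w"
  by (intro eq_vecI) (auto simp: lookup_ofvec)

lemma ofvec_free_mod: "w \<in> carrier_vec m \<Longrightarrow> ofvec w \<in> free_mod m"
  by (auto simp: free_mod_iff lookup_ofvec)

lemma tovec_eq_iff:
  "v \<in> free_mod m \<Longrightarrow> w \<in> free_mod m \<Longrightarrow> tovec m v = tovec m w \<longleftrightarrow> v = w"
  by (metis (no_types, lifting) free_mod_iff index_tovec not_le poly_mapping_eqI)

lemma mult_mat_tovec:
  assumes "A \<in> carrier_mat r c" and "\<And>p q. p < r \<Longrightarrow> q < c \<Longrightarrow> Poly_Mapping.lookup (h q) p = A $$ (p, q)"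
  shows "A *\<^sub>v tovec c v = tovec r (vlin c h v)"
proof (rule eq_vecI)
  fix p assume "p < dim_vec (tovec r (vlin c h v))"
  then have p: "p < r" by simp
  have "(A *\<^sub>v tovec c v) $ p = (\<Sum>q<c. A $$ (p, q) * Poly_Mapping.lookup v q)"
    using assms(1) p by (auto simp: scalar_prod_def lessThan_atLeast0 intro!: sum.cong)
  also have "\<dots> = (\<Sum>q<c. Poly_Mapping.lookup v q * Poly_Mapping.lookup (h q) p)"
    using p assms(2) by (intro sum.cong refl) (simp add: mult.commute)
  finally show "(A *\<^sub>v tovec c v) $ p = tovec r (vlin c h v) $ p"
    using p by (simp add: lookup_vlin)
qed (use assms(1) in simp)

lemma mult_mat_eq_tovec:
  assumes "A \<in> carrier_mat r c" and "\<And>p q. p < r \<Longrightarrow> q < c \<Longrightarrow> Poly_Mapping.lookup (h q) p = A $$ (p, q)"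
    and "w \<in> carrier_vec c"
  shows "A *\<^sub>v w = tovec r (vlin c h (ofvec w))"
  using mult_mat_tovec[OF assms(1,2), of "ofvec w"] tovec_ofvec[OF assms(3)] by simp

lemma tovec_mem_mat_kernel_iff:
  assumes "A \<in> carrier_mat r c" and "\<And>p q. p < r \<Longrightarrow> q < c \<Longrightarrow> Poly_Mapping.lookup (h q) p = A $$ (p, q)"
    and "\<And>q. q < c \<Longrightarrow> h q \<in> free_mod r"
  shows "tovec c v \<in> mat_kernel A \<longleftrightarrow> vlin c h v = 0"
proof -
  have "tovec c v \<in> mat_kernel A \<longleftrightarrow> tovec r (vlin c h v) = tovec r 0"
    using assms(1) mult_mat_tovec[OF assms(1,2)] by (auto simp: mat_kernel_def tovec_def)
  also have "\<dots> \<longleftrightarrow> vlin c h v = 0"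
    using assms(3) by (intro tovec_eq_iff vlin_in_subspace subspace_free_mod)
      (simp_all add: vec_module.subspace_0)
  finally show ?thesis .
qed

lemma minimal_resolution_complex:
  fixes I :: "('n::{finite,linorder}, 'k::field) mpol set"
  assumes res: "minimal_graded_free_resolution I b \<phi>"
  obtains g where "graded_complex (\<lambda>i. length (target_shifts b i)) (\<lambda>i p. target_shifts b i ! p) g"
    "I = {Poly_Mapping.lookup (vlin (length (b 0)) (g 0) v) 0 | v. v \<in> free_mod (length (b 0))}"
proof -
  let ?rk = "\<lambda>i. length (target_shifts b i)"
  define g where "g i q = ofvec (col (\<phi> i) q)" for i q
  have rkS: "?rk (Suc i) = length (b i)" for i by (simp add: target_shifts_def)
  have A: "\<phi> i \<in> carrier_mat (?rk i) (?rk (Suc i))" for i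
    using res by (simp add: minimal_graded_free_resolution_def rkS)
  have g: "Poly_Mapping.lookup (g i q) p = (if p < ?rk i then \<phi> i $$ (p, q) else 0)"
    if "q < ?rk (Suc i)" for i p q
    using that A[of i] by (auto simp: g_def lookup_ofvec)
  have g_free: "g i q \<in> free_mod (?rk i)" if "q < ?rk (Suc i)" for i q
    using g[OF that] by (simp add: free_mod_iff)
  have ker: "{\<phi> (Suc i) *\<^sub>v v | v. v \<in> carrier_vec (?rk (Suc (Suc i)))} = mat_kernel (\<phi> i)" for i
    using res by (simp add: minimal_graded_free_resolution_def rkS)
  have mem_ker: "tovec (?rk (Suc i)) v \<in> mat_kernel (\<phi> i) \<longleftrightarrow> vlin (?rk (Suc i)) (g i) v = 0" for i v
    by (rule tovec_mem_mat_kernel_iff[OF A]) (simp_all add: g g_free)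
  have mult: "\<phi> i *\<^sub>v w = tovec (?rk i) (vlin (?rk (Suc i)) (g i) (ofvec w))"
    if "w \<in> carrier_vec (?rk (Suc i))" for i w
    by (rule mult_mat_eq_tovec[OF A _ that]) (simp add: g)
  have vlin_free: "vlin (?rk (Suc i)) (g i) v \<in> free_mod (?rk i)" for i v
    by (intro vlin_in_subspace subspace_free_mod g_free)
  have "graded_complex ?rk (\<lambda>i p. target_shifts b i ! p) g"
  proof
    show "g i q \<in> free_mod (?rk i)" if "q < ?rk (Suc i)" for i q by (rule g_free[OF that])
    show "vhom (\<lambda>p. target_shifts b i ! p) (target_shifts b (Suc i) ! q) (g i q)"
      if "q < ?rk (Suc i)" for i q
    proof -
      have "homogeneous (b i ! q - target_shifts b i ! p) (\<phi> i $$ (p, q))" if "p < ?rk i" for p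
        using res that \<open>q < ?rk (Suc i)\<close> by (simp add: minimal_graded_free_resolution_def rkS)
      then show ?thesis using that by (simp add: vhom_def g target_shifts_def)
    qed
    show "vlin (?rk (Suc i)) (g i) (vlin (?rk (Suc (Suc i))) (g (Suc i)) w) = 0" for i w
    proof -
      have "tovec (?rk (Suc i)) (vlin (?rk (Suc (Suc i))) (g (Suc i)) w) =
          \<phi> (Suc i) *\<^sub>v tovec (?rk (Suc (Suc i))) w"
        by (rule mult_mat_tovec[OF A, symmetric]) (simp add: g)
      also have "\<dots> \<in> mat_kernel (\<phi> i)" unfolding ker[symmetric] using tovec_carrier by blast
      finally show ?thesis by (simp add: mem_ker)
    qed
    show "\<exists>w\<in>free_mod (?rk (Suc (Suc i))). vlin (?rk (Suc (Suc i))) (g (Suc i)) w = v"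
      if v: "v \<in> free_mod (?rk (Suc i))" "vlin (?rk (Suc i)) (g i) v = 0" for i v
    proof -
      have "tovec (?rk (Suc i)) v \<in> mat_kernel (\<phi> i)" using v(2) by (simp add: mem_ker)
      then obtain w where w: "w \<in> carrier_vec (?rk (Suc (Suc i)))"
          "tovec (?rk (Suc i)) v = \<phi> (Suc i) *\<^sub>v w"
        unfolding ker[symmetric] by blast
      then have "v = vlin (?rk (Suc (Suc i))) (g (Suc i)) (ofvec w)"
        using tovec_eq_iff[OF v(1) vlin_free] by (simp add: mult)
      then show ?thesis using ofvec_free_mod[OF w(1)] by blast
    qed
  qed
  moreover have "I = {Poly_Mapping.lookup (vlin (length (b 0)) (g 0) v) 0 | v. v \<in> free_mod (length (b 0))}"
  proof -
    have rk0: "?rk 0 = 1" by (simp add: target_shifts_def)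
    have I: "I = {(\<phi> 0 *\<^sub>v v) $ 0 | v. v \<in> carrier_vec (?rk (Suc 0))}"
      using res by (simp add: minimal_graded_free_resolution_def rkS)
    have "(\<phi> 0 *\<^sub>v w) $ 0 = Poly_Mapping.lookup (vlin (?rk (Suc 0)) (g 0) (ofvec w)) 0"
      if "w \<in> carrier_vec (?rk (Suc 0))" for w
      using mult[OF that] rk0 by simp
    moreover have "Poly_Mapping.lookup (vlin (?rk (Suc 0)) (g 0) v) 0 = (\<phi> 0 *\<^sub>v tovec (?rk (Suc 0)) v) $ 0" for v
      using mult_mat_tovec[OF A, of 0 "g 0" v] g[of _ 0] rk0 by simp
    ultimately show ?thesis
      unfolding I rkS by (metis (no_types, opaque_lifting) ofvec_free_mod tovec_carrier)
  qed
  ultimately show thesis by (rule that)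
qed

section \<open>Existence of minimal graded free resolutions\<close>

definition vdegrees :: "(nat \<Rightarrow> int) \<Rightarrow> ('n::finite, 'k::zero) mvec \<Rightarrow> int set" where
  "vdegrees sh v = (\<Union>p\<in>Poly_Mapping.keys v. (\<lambda>d. d + sh p) ` hdegrees (Poly_Mapping.lookup v p))"

lemma sum_vcomp: "(\<Sum>d\<in>vdegrees sh v. vcomp sh d v) = v"
  for v :: "('n::finite, 'k::comm_ring_1) mvec"
proof (intro poly_mapping_eqI)
  fix p t
  have fin: "finite (vdegrees sh v)" by (simp add: vdegrees_def)
  let ?c = "Poly_Mapping.lookup (Poly_Mapping.lookup v p) t"
  have "Poly_Mapping.lookup (Poly_Mapping.lookup (\<Sum>d\<in>vdegrees sh v. vcomp sh d v) p) t =
      (\<Sum>d\<in>vdegrees sh v. if d = int (mon_degree t) + sh p then ?c else 0)"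
    unfolding lookup_sum lookup_vcomp lookup_hcomp by (intro sum.cong refl) (auto simp: when_def)
  also have "\<dots> = (if int (mon_degree t) + sh p \<in> vdegrees sh v then ?c else 0)"
    using fin by (rule sum.delta)
  also have "\<dots> = ?c"
  proof (cases "?c = 0")
    case False
    then have "t \<in> Poly_Mapping.keys (Poly_Mapping.lookup v p)" "p \<in> Poly_Mapping.keys v"
      by (auto simp: in_keys_iff)
    then have "int (mon_degree t) + sh p \<in> vdegrees sh v"
      unfolding vdegrees_def hdegrees_def by blast
    then show ?thesis by simp
  qed simp
  finally show "Poly_Mapping.lookup (Poly_Mapping.lookup (\<Sum>d\<in>vdegrees sh v. vcomp sh d v) p) t = ?c" .
qed

text \<open>The last clause places the entries of all relations in the irrelevant ideal. By graded
  Nakayama this is minimality of the generators, in the form that the next matrix of a minimal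
  resolution has to satisfy.\<close>

definition minimal_generators ::
    "(nat \<Rightarrow> int) \<Rightarrow> ('n::finite, 'k::comm_ring_1) mvec set \<Rightarrow> int list \<Rightarrow> (nat \<Rightarrow> ('n, 'k) mvec) \<Rightarrow> bool" where
  "minimal_generators sh N ds g \<longleftrightarrow>
     (\<forall>q<length ds. g q \<in> N \<and> vhom sh (ds ! q) (g q)) \<and>
     (\<forall>v\<in>N. \<exists>w\<in>free_mod (length ds). vlin (length ds) g w = v) \<and>
     (\<forall>w p. w \<in> free_mod (length ds) \<longrightarrow> vlin (length ds) g w = 0 \<longrightarrow>
        Poly_Mapping.lookup (Poly_Mapping.lookup w p) 0 = 0)"

definition graded_submodule :: "nat \<Rightarrow> (nat \<Rightarrow> int) \<Rightarrow> ('n::finite, 'k::comm_ring_1) mvec set \<Rightarrow> bool" where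
  "graded_submodule m sh N \<longleftrightarrow> vec_module.subspace N \<and> N \<subseteq> free_mod m \<and> (\<forall>v\<in>N. \<forall>d. vcomp sh d v \<in> N)"

lemma ex_homogeneous_generators:
  fixes N :: "('n::{finite,linorder}, 'k::field) mvec set"
  assumes N: "graded_submodule m sh N"
  obtains S where "finite S" "S \<subseteq> N" "N = vec_module.span S" "\<forall>v\<in>S. \<exists>d. vhom sh d v"
proof -
  have sub: "vec_module.subspace N" "N \<subseteq> free_mod m" "\<And>v d. v \<in> N \<Longrightarrow> vcomp sh d v \<in> N"
    using N by (auto simp: graded_submodule_def)
  obtain S0 where S0: "finite S0" "S0 \<subseteq> N" "N = vec_module.span S0"
    using submodule_finitely_generated[OF sub(1,2)] .
  let ?S = "\<Union>v\<in>S0. (\<lambda>d. vcomp sh d v) ` vdegrees sh v"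
  have "finite ?S" using S0(1) by (simp add: vdegrees_def)
  moreover have SN: "?S \<subseteq> N" using S0(2) sub(3) by blast
  moreover have "N = vec_module.span ?S"
  proof
    have "v \<in> vec_module.span ?S" if v: "v \<in> S0" for v
    proof -
      have "(\<Sum>d\<in>vdegrees sh v. vcomp sh d v) \<in> vec_module.span ?S"
        using v by (intro vec_module.span_sum vec_module.span_base) blast
      then show ?thesis by (simp add: sum_vcomp)
    qed
    then show "N \<subseteq> vec_module.span ?S"
      unfolding S0(3) by (intro vec_module.span_minimal vec_module.subspace_span) blast
    show "vec_module.span ?S \<subseteq> N" by (rule vec_module.span_minimal[OF SN sub(1)])
  qed
  moreover have "\<forall>v\<in>?S. \<exists>d. vhom sh d v"
  proof
    fix v assume "v \<in> ?S"
    then obtain d u where "v = vcomp sh d u" by blast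
    then show "\<exists>d. vhom sh d v" using vhom_vcomp by blast
  qed
  ultimately show thesis by (rule that)
qed

text \<open>Take homogeneous generators of least number. A relation with a nonzero constant term in
  its q-th entry would express the q-th generator by the others.\<close>

lemma ex_minimal_generators:
  fixes N :: "('n::{finite,linorder}, 'k::field) mvec set"
  assumes N: "graded_submodule m sh N"
  shows "\<exists>ds g. minimal_generators sh N ds g"
proof -
  define gen where "gen S \<longleftrightarrow> finite S \<and> S \<subseteq> N \<and> N = vec_module.span S \<and> (\<forall>v\<in>S. \<exists>d. vhom sh d v)" for S
  obtain S0 where "finite S0" "S0 \<subseteq> N" "N = vec_module.span S0" "\<forall>v\<in>S0. \<exists>d. vhom sh d v"
    using ex_homogeneous_generators[OF N] .
  then have "gen S0" unfolding gen_def by simp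
  from ex_has_least_nat[of gen, OF this, of card]
  obtain S where gen_S: "gen S" and least: "\<And>T. gen T \<Longrightarrow> card S \<le> card T" by metis
  have S: "finite S" "S \<subseteq> N" "N = vec_module.span S" "\<And>v. v \<in> S \<Longrightarrow> \<exists>d. vhom sh d v"
    using gen_S unfolding gen_def by auto
  obtain xs where xs: "set xs = S" "distinct xs" using finite_distinct_list[OF S(1)] by blast
  obtain deg where deg: "\<And>v. v \<in> S \<Longrightarrow> vhom sh (deg v) v" using S(4) by metis
  define g where "g q = xs ! q" for q
  define ds where "ds = map deg xs"
  let ?m = "length xs"
  have bij: "bij_betw (\<lambda>q. xs ! q) {..<?m} S" using xs by (simp add: bij_betw_nth)
  have hom: "vhom sh (ds ! q) (g q)" if "q < ?m" for q
    using deg[of "xs ! q"] that xs(1) nth_mem by (auto simp: ds_def g_def)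
  have gen: "\<exists>w\<in>free_mod ?m. vlin ?m g w = v" if v: "v \<in> N" for v
  proof -
    obtain u where u: "v = (\<Sum>x\<in>S. vscale (u x) x)"
      using v vec_module.span_finite[OF S(1)] S(3) by auto
    define w where "w = (\<Sum>q<?m. Poly_Mapping.single q (u (xs ! q)))"
    have w: "Poly_Mapping.lookup w q = (if q < ?m then u (xs ! q) else 0)" for q
      by (simp add: w_def lookup_sum lookup_single when_def)
    have "vlin ?m g w = (\<Sum>q<?m. vscale (u (xs ! q)) (xs ! q))"
      unfolding vlin_def g_def by (intro sum.cong refl) (simp add: w)
    also have "\<dots> = v" unfolding u by (rule sum.reindex_bij_betw[OF bij])
    finally show ?thesis using w by (auto simp: free_mod_iff)
  qed
  have minimal: "Poly_Mapping.lookup (Poly_Mapping.lookup w q) 0 = 0"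
    if w: "w \<in> free_mod ?m" "vlin ?m g w = 0" for w q
  proof (rule ccontr)
    assume neq: "Poly_Mapping.lookup (Poly_Mapping.lookup w q) 0 \<noteq> 0"
    let ?c = "Poly_Mapping.lookup (Poly_Mapping.lookup w q) 0"
    have q: "q < ?m"
    proof (rule ccontr)
      assume "\<not> q < ?m"
      then have "Poly_Mapping.lookup w q = 0" using w(1) by (simp add: free_mod_iff)
      then show False using neq by simp
    qed
    \<comment> \<open>In degree \<open>ds ! q\<close> the q-th coefficient has degree 0, so it
      becomes the constant \<open>?c\<close> and is invertible.\<close>
    define w' where "w' = vcomp (\<lambda>p. ds ! p) (ds ! q) w"
    have "vlin ?m g w' = vcomp sh (ds ! q) (vlin ?m g w)"
      unfolding w'_def by (rule vcomp_vlin[symmetric]) (rule hom)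
    then have w'0: "vlin ?m g w' = 0" by (simp add: w(2))
    have w'q: "Poly_Mapping.lookup w' q = Poly_Mapping.single 0 ?c"
      using homogeneous_degree_0[OF homogeneous_hcomp[of 0 "Poly_Mapping.lookup w q"]]
      by (simp add: w'_def lookup_hcomp)
    let ?x = "xs ! q"
    let ?T = "S - {?x}"
    have xS: "?x \<in> S" using q xs(1) nth_mem by blast
    have "0 = vscale (Poly_Mapping.lookup w' q) ?x + (\<Sum>p\<in>{..<?m} - {q}. vscale (Poly_Mapping.lookup w' p) (xs ! p))"
      using q w'0 unfolding vlin_def g_def by (simp add: sum.remove)
    then have "vscale (Poly_Mapping.single 0 ?c) ?x = - (\<Sum>p\<in>{..<?m} - {q}. vscale (Poly_Mapping.lookup w' p) (xs ! p))"
      by (simp add: w'q eq_neg_iff_add_eq_0)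
    moreover have "(\<Sum>p\<in>{..<?m} - {q}. vscale (Poly_Mapping.lookup w' p) (xs ! p)) \<in> vec_module.span ?T"
    proof (intro vec_module.span_sum vec_module.span_scale vec_module.span_base)
      fix p assume "p \<in> {..<?m} - {q}"
      then show "xs ! p \<in> ?T" using xs q nth_mem by (auto simp: nth_eq_iff_index_eq)
    qed
    ultimately have "vscale (Poly_Mapping.single 0 ?c) ?x \<in> vec_module.span ?T"
      by (simp add: vec_module.span_neg)
    then have "vscale (Poly_Mapping.single 0 (inverse ?c)) (vscale (Poly_Mapping.single 0 ?c) ?x) \<in> vec_module.span ?T"
      by (rule vec_module.span_scale)
    then have x: "?x \<in> vec_module.span ?T" using neq by (simp add: mult_single)
    have "S \<subseteq> vec_module.span ?T"
    proof
      fix v assume "v \<in> S"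
      then show "v \<in> vec_module.span ?T"
        using x vec_module.span_base[of v ?T] by (cases "v = ?x") simp_all
    qed
    then have "vec_module.span S \<subseteq> vec_module.span ?T"
      by (rule vec_module.span_minimal) (rule vec_module.subspace_span)
    moreover have "vec_module.span ?T \<subseteq> vec_module.span S" by (rule vec_module.span_mono) blast
    ultimately have "N = vec_module.span ?T" using S(3) by simp
    moreover have "?T \<subseteq> N" "finite ?T" using S(1,2) by auto
    ultimately have "gen ?T" using S(4) unfolding gen_def by blast
    then have "card S \<le> card ?T" by (rule least)
    then show False using card_Diff1_less[OF S(1) xS] by linarith
  qed
  have "minimal_generators sh N ds g"
    unfolding minimal_generators_def
  proof (intro conjI allI impI ballI)
    fix q assume "q < length ds"
    then show "g q \<in> N" "vhom sh (ds ! q) (g q)"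
      using hom S xs(1) nth_mem[of q xs] by (auto simp: ds_def g_def)
  qed (use gen minimal in \<open>simp_all add: ds_def\<close>)
  then show ?thesis by blast
qed

definition kernel :: "int list \<Rightarrow> (nat \<Rightarrow> ('n, 'k::comm_ring_1) mvec) \<Rightarrow> ('n, 'k) mvec set" where
  "kernel ds g = {w \<in> free_mod (length ds). vlin (length ds) g w = 0}"

lemma graded_submodule_kernel:
  assumes "minimal_generators sh N ds g"
  shows "graded_submodule (length ds) (\<lambda>q. ds ! q) (kernel ds g)"
  unfolding graded_submodule_def
proof (intro conjI ballI allI)
  show "vec_module.subspace (kernel ds g)"
    by (rule vec_module.subspaceI)
       (auto simp: kernel_def vlin_add vlin_vscale vec_module.subspace_0 vec_module.subspace_add
         vec_module.subspace_scale)
  show "kernel ds g \<subseteq> free_mod (length ds)" by (auto simp: kernel_def)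
  fix v d assume v: "v \<in> kernel ds g"
  have "vlin (length ds) g (vcomp (\<lambda>q. ds ! q) d v) = vcomp sh d (vlin (length ds) g v)"
    using assms by (intro vcomp_vlin[symmetric]) (simp add: minimal_generators_def)
  then show "vcomp (\<lambda>q. ds ! q) d v \<in> kernel ds g"
    using v by (simp add: kernel_def vcomp_free_mod)
qed

text \<open>Existence is what gives the choice in \<open>regularity\<close> its meaning. Minimal
  generators of successive syzygy modules form an infinite exact complex, and
  \<open>minimal_complex_length\<close> shows that it stops in time.\<close>

lemma ex_minimal_graded_free_resolution:
  fixes I :: "('n::{finite,linorder}, 'k::field) mpol set"
  assumes I: "graded I"
  shows "\<exists>b \<phi>. minimal_graded_free_resolution I b \<phi>"
proof -
  define P where "P x \<longleftrightarrow> graded_submodule (length (fst x)) (\<lambda>p. fst x ! p) (snd x)"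
    for x :: "int list \<times> ('n, 'k) mvec set"
  define Q where "Q x y \<longleftrightarrow> (\<exists>g. minimal_generators (\<lambda>p. fst x ! p) (snd x) (fst y) g \<and>
    snd y = kernel (fst y) g)" for x y :: "int list \<times> ('n, 'k) mvec set"
  define N0 where "N0 = {v \<in> free_mod 1. Poly_Mapping.lookup v 0 \<in> I}"
  note idI = graded_ideal[OF I]
  have "vec_module.subspace N0"
    unfolding N0_def
    by (rule vec_module.subspaceI)
       (auto simp: lookup_add vec_module.subspace_0 vec_module.subspace_add vec_module.subspace_scale
         ideal_0[OF idI] ideal_add[OF idI] ideal_mult_left[OF idI])
  then have "graded_submodule 1 (\<lambda>p. [0] ! p) N0"
    by (auto simp: graded_submodule_def N0_def vcomp_free_mod graded_hcomp[OF I])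
  then have P0: "P ([0], N0)" by (simp add: P_def)
  have step: "\<exists>y. P y \<and> Q x y" if "P x" for x
  proof -
    obtain ds g where "minimal_generators (\<lambda>p. fst x ! p) (snd x) ds g"
      using ex_minimal_generators[OF \<open>P x\<close>[unfolded P_def]] by blast
    then have "P (ds, kernel ds g) \<and> Q x (ds, kernel ds g)"
      using graded_submodule_kernel unfolding P_def Q_def by auto
    then show ?thesis ..
  qed
  \<comment> \<open>Dependent choice; the clause for index 0 pins the start of the sequence to I
    inside the ring.\<close>
  have "\<exists>f. \<forall>i. (P (f i) \<and> (i = 0 \<longrightarrow> f i = ([0], N0))) \<and> Q (f i) (f (Suc i))"
    by (rule dependent_nat_choice) (use P0 step in auto)
  then obtain f where f: "f 0 = ([0], N0)" "\<And>i. P (f i)" "\<And>i. Q (f i) (f (Suc i))" by blast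
  define B where "B i = fst (f i)" for i
  define N where "N i = snd (f i)" for i
  have "\<exists>g. minimal_generators (\<lambda>p. B i ! p) (N i) (B (Suc i)) g \<and> N (Suc i) = kernel (B (Suc i)) g" for i
    using f(3)[of i] by (simp add: B_def N_def Q_def)
  then obtain g where g: "\<And>i. minimal_generators (\<lambda>p. B i ! p) (N i) (B (Suc i)) (g i)"
    "\<And>i. N (Suc i) = kernel (B (Suc i)) (g i)" by metis
  have N: "graded_submodule (length (B i)) (\<lambda>p. B i ! p) (N i)" for i
    using f(2)[of i] by (simp add: B_def N_def P_def)
  have B0: "B 0 = [0]" and N0: "N 0 = N0" using f(1) by (simp_all add: B_def N_def)
  let ?rk = "\<lambda>i. length (B i)"
  have gN: "g i q \<in> N i" if "q < ?rk (Suc i)" for i q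
    using g(1)[of i] that by (simp add: minimal_generators_def)
  have vlinN: "vlin (?rk (Suc i)) (g i) w \<in> N i" for i w
    using N[of i] gN by (intro vlin_in_subspace) (simp_all add: graded_submodule_def)
  have surj: "\<exists>w\<in>free_mod (?rk (Suc i)). vlin (?rk (Suc i)) (g i) w = v" if "v \<in> N i" for i v
    using g(1)[of i] that by (simp add: minimal_generators_def)
  interpret graded_complex ?rk "\<lambda>i p. B i ! p" g
  proof
    show "g i q \<in> free_mod (?rk i)" if "q < ?rk (Suc i)" for i q
      using gN[OF that] N[of i] by (auto simp: graded_submodule_def)
    show "vhom (\<lambda>p. B i ! p) (B (Suc i) ! q) (g i q)" if "q < ?rk (Suc i)" for i q
      using g(1)[of i] that by (simp add: minimal_generators_def)
    show "vlin (?rk (Suc i)) (g i) (vlin (?rk (Suc (Suc i))) (g (Suc i)) w) = 0" for i w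
      using vlinN[of "Suc i" w] g(2)[of i] by (simp add: kernel_def)
    show "\<exists>w\<in>free_mod (?rk (Suc (Suc i))). vlin (?rk (Suc (Suc i))) (g (Suc i)) w = v"
      if "v \<in> free_mod (?rk (Suc i))" "vlin (?rk (Suc i)) (g i) v = 0" for i v
      using that by (intro surj) (simp add: g(2) kernel_def)
  qed
  have minimal: "Poly_Mapping.lookup (Poly_Mapping.lookup (g (Suc i) q) p) 0 = 0"
    if "q < ?rk (Suc (Suc i))" for i p q
    using gN[OF that] g(1)[of i] by (simp add: minimal_generators_def g(2) kernel_def)
  define b where "b i = B (Suc i)" for i
  have ts: "target_shifts b i = B i" for i by (cases i) (simp_all add: target_shifts_def b_def B0)
  define \<phi> where "\<phi> i = mat (?rk i) (?rk (Suc i)) (\<lambda>(p, q). Poly_Mapping.lookup (g i q) p)" for i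
  have A: "\<phi> i \<in> carrier_mat (?rk i) (?rk (Suc i))" for i by (simp add: \<phi>_def)
  have entry: "Poly_Mapping.lookup (g i q) p = \<phi> i $$ (p, q)" if "p < ?rk i" "q < ?rk (Suc i)" for i p q
    using that by (simp add: \<phi>_def)
  have mult: "\<phi> i *\<^sub>v w = tovec (?rk i) (vlin (?rk (Suc i)) (g i) (ofvec w))"
    if "w \<in> carrier_vec (?rk (Suc i))" for i w
    by (rule mult_mat_eq_tovec[OF A entry that])
  have mult': "\<phi> i *\<^sub>v tovec (?rk (Suc i)) v = tovec (?rk i) (vlin (?rk (Suc i)) (g i) v)" for i v
    by (rule mult_mat_tovec[OF A entry])
  have mem_ker: "tovec (?rk (Suc i)) v \<in> mat_kernel (\<phi> i) \<longleftrightarrow> vlin (?rk (Suc i)) (g i) v = 0" for i v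
    by (rule tovec_mem_mat_kernel_iff[OF A entry cols])
  have "minimal_graded_free_resolution I b \<phi>"
    unfolding minimal_graded_free_resolution_def ts
  proof (intro conjI allI impI)
    fix i assume "CARD('n) - 1 < i"
    then have "?rk (Suc i) = 0" by (intro minimal_complex_length minimal) simp_all
    then show "b i = []" by (simp add: b_def)
  next
    show "\<phi> i \<in> carrier_mat (?rk i) (length (b i))" for i using A by (simp add: b_def)
  next
    fix i p q assume "p < ?rk i" "q < length (b i)"
    then show "homogeneous (b i ! q - B i ! p) (\<phi> i $$ (p, q))"
      using cols_hom[of q i] by (simp add: vhom_def b_def flip: entry)
  next
    show "{(\<phi> 0 *\<^sub>v v) $ 0 | v. v \<in> carrier_vec (length (b 0))} = I"
    proof (intro equalityI subsetI)
      fix x assume "x \<in> {(\<phi> 0 *\<^sub>v v) $ 0 | v. v \<in> carrier_vec (length (b 0))}"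
      then obtain v where "v \<in> carrier_vec (?rk (Suc 0))" "x = (\<phi> 0 *\<^sub>v v) $ 0" by (auto simp: b_def)
      then have "x = Poly_Mapping.lookup (vlin (?rk (Suc 0)) (g 0) (ofvec v)) 0"
        by (simp add: mult B0)
      then show "x \<in> I" using vlinN[of 0] by (simp add: N0 N0_def)
    next
      fix x assume x: "x \<in> I"
      then have "Poly_Mapping.single 0 x \<in> N 0" by (auto simp: N0 N0_def free_mod_def)
      then obtain w where w: "vlin (?rk (Suc 0)) (g 0) w = Poly_Mapping.single 0 x" using surj by blast
      have "(\<phi> 0 *\<^sub>v tovec (?rk (Suc 0)) w) $ 0 = x" by (simp add: mult' w B0)
      then show "x \<in> {(\<phi> 0 *\<^sub>v v) $ 0 | v. v \<in> carrier_vec (length (b 0))}"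
        unfolding b_def using tovec_carrier by blast
    qed
  next
    show "{\<phi> (Suc i) *\<^sub>v v | v. v \<in> carrier_vec (length (b (Suc i)))} = mat_kernel (\<phi> i)" for i
    proof (intro equalityI subsetI)
      fix x assume "x \<in> {\<phi> (Suc i) *\<^sub>v v | v. v \<in> carrier_vec (length (b (Suc i)))}"
      then obtain v where "v \<in> carrier_vec (?rk (Suc (Suc i)))" "x = \<phi> (Suc i) *\<^sub>v v" by (auto simp: b_def)
      then show "x \<in> mat_kernel (\<phi> i)" by (simp add: mult mem_ker complex)
    next
      fix x assume x: "x \<in> mat_kernel (\<phi> i)"
      then have xc: "x \<in> carrier_vec (?rk (Suc i))" using A[of i] by (auto simp: mat_kernel_def)
      then have "vlin (?rk (Suc i)) (g i) (ofvec x) = 0" using x mem_ker tovec_ofvec[OF xc] by metis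
      then obtain w where w: "vlin (?rk (Suc (Suc i))) (g (Suc i)) w = ofvec x"
        using exact ofvec_free_mod[OF xc] by blast
      have "\<phi> (Suc i) *\<^sub>v tovec (?rk (Suc (Suc i))) w = x"
        by (simp add: mult' w tovec_ofvec[OF xc])
      then show "x \<in> {\<phi> (Suc i) *\<^sub>v v | v. v \<in> carrier_vec (length (b (Suc i)))}"
        unfolding b_def using tovec_carrier by blast
    qed
  next
    fix i p q assume "p < length (b i)" "q < length (b (Suc i))"
    then show "\<phi> (Suc i) $$ (p, q) \<in> irrelevant_ideal"
      using minimal[of q i p] by (simp add: irrelevant_ideal_iff b_def flip: entry)
  qed
  then show ?thesis by blast
qed

text \<open>Here \<open>rk 0 = 1\<close> is the ring itself, so that the \<open>i\<close>-th module of the resolution of \<open>I\<close> has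
  index \<open>Suc i\<close>.\<close>

lemma regularity_complex:
  fixes I :: "('n::{finite,linorder}, 'k::field) mpol set"
  assumes "graded I"
  obtains rk sh g where "graded_complex rk sh g" "rk 0 = 1" "sh 0 0 = 0"
    "I = {Poly_Mapping.lookup (vlin (rk 1) (g 0) v) 0 | v. v \<in> free_mod (rk 1)}"
    "\<And>i p. i < CARD('n) \<Longrightarrow> p < rk (Suc i) \<Longrightarrow> sh (Suc i) p \<le> regularity I + int i"
proof -
  let ?reg = "\<lambda>d. \<exists>b \<phi>. minimal_graded_free_resolution I b \<phi> \<and>
     d = Max {b i ! j - int i | i j. i \<le> CARD('n) - 1 \<and> j < length (b i)}"
  have "\<exists>d. ?reg d" using ex_minimal_graded_free_resolution[OF assms] by blast
  then have "?reg (regularity I)" unfolding regularity_def by (rule someI_ex)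
  then obtain b \<phi> where b: "minimal_graded_free_resolution I b \<phi>"
    "regularity I = Max {b i ! j - int i | i j. i \<le> CARD('n) - 1 \<and> j < length (b i)}" by blast
  obtain g where g: "graded_complex (\<lambda>i. length (target_shifts b i)) (\<lambda>i p. target_shifts b i ! p) g"
    "I = {Poly_Mapping.lookup (vlin (length (b 0)) (g 0) v) 0 | v. v \<in> free_mod (length (b 0))}"
    by (rule minimal_resolution_complex[OF b(1)])
  have "{b i ! j - int i | i j. i \<le> CARD('n) - 1 \<and> j < length (b i)} =
      (\<lambda>(i, j). b i ! j - int i) ` (SIGMA i:{..CARD('n) - 1}. {..<length (b i)})" by auto
  then have fin: "finite {b i ! j - int i | i j. i \<le> CARD('n) - 1 \<and> j < length (b i)}" by simp
  show thesis
  proof (rule that[OF g(1)])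
    show "length (target_shifts b 0) = 1" "target_shifts b 0 ! 0 = 0" by (simp_all add: target_shifts_def)
    show "I = {Poly_Mapping.lookup (vlin (length (target_shifts b 1)) (g 0) v) 0 | v.
        v \<in> free_mod (length (target_shifts b 1))}"
      using g(2) by (simp add: target_shifts_def)
    show "target_shifts b (Suc i) ! p \<le> regularity I + int i"
      if "i < CARD('n)" "p < length (target_shifts b (Suc i))" for i p
    proof -
      have "i \<le> CARD('n) - 1 \<and> p < length (b i)" using that by (simp add: target_shifts_def)
      then have "b i ! p - int i \<le> regularity I"
        unfolding b(2) by (intro Max_ge fin) blast
      then show ?thesis by (simp add: target_shifts_def)
    qed
  qed
qed

section \<open>Products of homogeneous primes\<close>

text \<open>Sets of single products rather than the ideals they generate; these suffice for testing
  containment in an ideal.\<close>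

primrec set_prod :: "'a::comm_ring_1 set list \<Rightarrow> 'a set" where
  "set_prod [] = {1}"
| "set_prod (A # As) = {a * b | a b. a \<in> A \<and> b \<in> set_prod As}"

lemma set_prod_append:
  "x \<in> set_prod (As @ Bs) \<Longrightarrow> \<exists>a b. x = a * b \<and> a \<in> set_prod As \<and> b \<in> set_prod Bs"
proof (induction As arbitrary: x)
  case Nil
  then show ?case by (intro exI[of _ 1] exI[of _ x]) simp
next
  case (Cons A As)
  then obtain a y where "a \<in> A" "y \<in> set_prod (As @ Bs)" "x = a * y" by auto
  moreover from this obtain b c where "y = b * c" "b \<in> set_prod As" "c \<in> set_prod Bs"
    using Cons.IH by blast
  ultimately show ?case by (intro exI[of _ "a * b"] exI[of _ c]) (auto simp: mult.assoc)
qed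

lemma set_prod_replicate_mono:
  "(\<And>Q. Q \<in> set Qs \<Longrightarrow> V \<subseteq> Q) \<Longrightarrow> set_prod (replicate (length Qs) V) \<subseteq> set_prod Qs"
proof (induction Qs)
  case (Cons Q Qs)
  then have "V \<subseteq> Q" "set_prod (replicate (length Qs) V) \<subseteq> set_prod Qs" by simp_all
  then show ?case by auto
qed simp

lemma power_in_set_prod:
  "(\<And>Q. Q \<in> set Qs \<Longrightarrow> z \<in> Q) \<Longrightarrow> z ^ length Qs \<in> set_prod Qs"
  by (induction Qs) auto

lemma prime_contains_factor:
  assumes Q: "is_prime_ideal Q"
  shows "set_prod Ps \<subseteq> Q \<Longrightarrow> \<exists>P\<in>set Ps. P \<subseteq> Q"
proof (induction Ps)
  case Nil
  then show ?case using prime_1[OF Q] by simp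
next
  case (Cons P Ps)
  show ?case
  proof (cases "P \<subseteq> Q")
    case False
    then obtain p where p: "p \<in> P" "p \<notin> Q" by blast
    have "set_prod Ps \<subseteq> Q"
    proof
      fix x assume "x \<in> set_prod Ps"
      then have "p * x \<in> Q" using p(1) Cons.prems by auto
      then show "x \<in> Q" using prime_mult[OF Q] p(2) by blast
    qed
    then show ?thesis using Cons.IH by auto
  qed auto
qed

lemma prime_power_mem:
  assumes "is_prime_ideal P" "a ^ n \<in> P"
  shows "a \<in> P"
  using assms(2)
proof (induction n)
  case 0
  then show ?case using prime_1[OF assms(1)] by simp
next
  case (Suc n)
  then show ?case using prime_mult[OF assms(1), of a "a ^ n"] by auto
qed

text \<open>If a and b lie outside I, let p and q be the highest degrees of components outside I.
  Then the component of ab in degree p + q is congruent to the product of these two components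
  modulo I.\<close>

lemma graded_prime_test:
  assumes I: "graded I" "I \<noteq> UNIV"
    and test: "\<And>a b c d. homogeneous c a \<Longrightarrow> homogeneous d b \<Longrightarrow> a * b \<in> I \<Longrightarrow> a \<in> I \<or> b \<in> I"
  shows "is_prime_ideal I"
  unfolding is_prime_ideal_def
proof (intro conjI allI impI)
  note idI = graded_ideal[OF I(1)]
  show "is_ideal I" "I \<noteq> UNIV" using idI I(2) by auto
  fix a b assume ab: "a * b \<in> I"
  show "a \<in> I \<or> b \<in> I"
  proof (rule ccontr)
    assume *: "\<not> (a \<in> I \<or> b \<in> I)"
    have top: "\<exists>p. hcomp p x \<notin> I \<and> (\<forall>e>p. hcomp e x \<in> I)" if x: "x \<notin> I" for x
    proof -
      let ?D = "{d \<in> hdegrees x. hcomp d x \<notin> I}"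
      have fin: "finite ?D" by simp
      have "?D \<noteq> {}" using graded_memI[OF I(1), of x] x by blast
      then have "Max ?D \<in> ?D" by (rule Max_in[OF fin])
      moreover have "hcomp e x \<in> I" if "e > Max ?D" for e
      proof (rule ccontr)
        assume "hcomp e x \<notin> I"
        then have "e \<in> ?D" using ideal_0[OF idI] hcomp_eq_0_iff[of e x] by auto
        then show False using Max_ge[OF fin] that by fastforce
      qed
      ultimately show ?thesis by blast
    qed
    obtain p where p: "hcomp p a \<notin> I" "\<And>e. e > p \<Longrightarrow> hcomp e a \<in> I" using top * by blast
    obtain q where q: "hcomp q b \<notin> I" "\<And>e. e > q \<Longrightarrow> hcomp e b \<in> I" using top * by blast
    have pD: "p \<in> hdegrees a" using p(1) ideal_0[OF idI] hcomp_eq_0_iff[of p a] by auto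
    have rest: "(\<Sum>e\<in>hdegrees a - {p}. hcomp e a * hcomp (p + q - e) b) \<in> I"
    proof (rule ideal_sum[OF idI])
      fix e assume "e \<in> hdegrees a - {p}"
      then consider "e > p" | "p + q - e > q" by fastforce
      then show "hcomp e a * hcomp (p + q - e) b \<in> I"
        using p(2) q(2) by cases (auto intro: ideal_mult_left[OF idI] ideal_mult_right[OF idI])
    qed
    have "hcomp (p + q) (a * b) = hcomp p a * hcomp q b +
        (\<Sum>e\<in>hdegrees a - {p}. hcomp e a * hcomp (p + q - e) b)"
      unfolding hcomp_mult using pD by (simp add: sum.remove)
    then have "hcomp p a * hcomp q b =
        hcomp (p + q) (a * b) - (\<Sum>e\<in>hdegrees a - {p}. hcomp e a * hcomp (p + q - e) b)" by simp
    also have "\<dots> \<in> I" by (rule ideal_diff[OF idI graded_hcomp[OF I(1) ab] rest])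
    finally show False using test p(1) q(1) homogeneous_hcomp by blast
  qed
qed

text \<open>Noetherian induction: if I is proper and not prime, there are homogeneous a, b outside I
  with ab in I, and then (I + (a))(I + (b)) lies in I. The whole ring is covered by the empty
  product. This supplies the minimal primes without primary decomposition.\<close>

lemma ex_prime_product:
  fixes I :: "('n::{finite,linorder}, 'k::field) mpol set"
  assumes "graded I"
  shows "\<exists>Ps. (\<forall>P\<in>set Ps. is_prime_ideal P \<and> graded P \<and> I \<subseteq> P) \<and> set_prod Ps \<subseteq> I"
  using wf_ideal_chain assms
proof (induction I rule: wf_induct_rule)
  case (less I)
  note I = less.prems and idI = graded_ideal[OF less.prems]
  consider "I = UNIV" | "is_prime_ideal I" | "I \<noteq> UNIV" "\<not> is_prime_ideal I" by blast
  then show ?case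
  proof cases
    case 1
    then show ?thesis by (intro exI[of _ "[]"]) simp
  next
    case 2
    then show ?thesis using I by (intro exI[of _ "[I]"]) auto
  next
    case 3
    obtain a b c d where ab: "homogeneous c a" "homogeneous d b" "a * b \<in> I" "a \<notin> I" "b \<notin> I"
      using graded_prime_test[OF I 3(1)] 3(2) by metis
    have IH: "\<exists>Ps. (\<forall>P\<in>set Ps. is_prime_ideal P \<and> graded P \<and> I \<subseteq> P) \<and> set_prod Ps \<subseteq> adjoin I x"
      if x: "homogeneous e x" "x \<notin> I" for x e
    proof -
      have "I \<subset> adjoin I x" using subset_adjoin[of I x] mem_adjoin[OF idI, of x] x(2) by blast
      then have "(adjoin I x, I) \<in> {(J, I). is_ideal I \<and> is_ideal J \<and> I \<subset> J}"
        using idI is_ideal_adjoin[OF idI] by simp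
      from less.IH[OF this graded_adjoin[OF I x(1)]] show ?thesis
        using subset_adjoin[of I x] by (meson subset_trans)
    qed
    obtain Ps where Ps: "\<forall>P\<in>set Ps. is_prime_ideal P \<and> graded P \<and> I \<subseteq> P" "set_prod Ps \<subseteq> adjoin I a"
      using IH[OF ab(1,4)] by blast
    obtain Qs where Qs: "\<forall>P\<in>set Qs. is_prime_ideal P \<and> graded P \<and> I \<subseteq> P" "set_prod Qs \<subseteq> adjoin I b"
      using IH[OF ab(2,5)] by blast
    have "x \<in> I" if x: "x \<in> set_prod (Ps @ Qs)" for x
    proof -
      obtain y z where yz: "x = y * z" "y \<in> adjoin I a" "z \<in> adjoin I b"
        using set_prod_append[OF x] Ps(2) Qs(2) by blast
      then obtain i r j s where "y = i + r * a" "i \<in> I" "z = j + s * b" "j \<in> I"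
        by (auto simp: adjoin_def)
      then have "x = i * z + (r * a) * j + (r * s) * (a * b)" by (simp add: yz(1) algebra_simps)
      then show ?thesis using \<open>i \<in> I\<close> \<open>j \<in> I\<close> ab(3)
        by (auto intro!: ideal_add[OF idI] intro: ideal_mult_left[OF idI] ideal_mult_right[OF idI])
    qed
    then have "set_prod (Ps @ Qs) \<subseteq> I" by blast
    then show ?thesis using Ps(1) Qs(1) by (intro exI[of _ "Ps @ Qs"]) auto
  qed
qed

text \<open>The graded analogue of McCoy's theorem.\<close>

lemma graded_zero_divisor:
  fixes L :: "('n::finite, 'k::comm_ring_1) mpol set"
  assumes L: "graded L" and gh: "g * h \<in> L" "h \<notin> L"
  shows "\<exists>h' e. homogeneous e h' \<and> h' \<notin> L \<and> g * h' \<in> L"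
  using gh
proof (induction "card (hdegrees h)" arbitrary: h rule: less_induct)
  case less
  note idL = graded_ideal[OF L]
  show ?case
  proof (cases "\<forall>i. hcomp i g * h \<in> L")
    \<comment> \<open>If every component of g multiplies h into \<open>L\<close>, then so does it
      multiply each component of h, and one of those lies outside \<open>L\<close>.\<close>
    case True
    obtain c where c: "hcomp c h \<notin> L" using graded_memI[OF L, of h] less.prems(2) by blast
    have "hcomp i g * hcomp c h \<in> L" for i
    proof -
      have "hcomp (i + c) (hcomp i g * h) \<in> L" using True graded_hcomp[OF L] by blast
      then show ?thesis by (simp add: hcomp_mult_homogeneous[OF homogeneous_hcomp])
    qed
    then have "(\<Sum>i\<in>hdegrees g. hcomp i g) * hcomp c h \<in> L"
      unfolding sum_distrib_right by (intro ideal_sum[OF idL])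
    then have "g * hcomp c h \<in> L" by (simp add: sum_hcomp)
    then show ?thesis using c homogeneous_hcomp by blast
  next
    case False
    \<comment> \<open>Otherwise let i be the top degree with \<open>hcomp i g * h\<close> outside
      \<open>L\<close> and e the top degree of h. Comparing degrees i + e in gh puts the product of
      both top components into \<open>L\<close>, so \<open>hcomp i g * (h - hcomp e h)\<close>
      replaces h and has fewer components.\<close>
    let ?D = "{i \<in> hdegrees g. hcomp i g * h \<notin> L}"
    have fin: "finite ?D" by simp
    have mem_D: "i \<in> ?D" if "hcomp i g * h \<notin> L" for i
      using that ideal_0[OF idL] hcomp_eq_0_iff[of i g] by auto
    have "?D \<noteq> {}" using False mem_D by blast
    define i where "i = Max ?D"
    have i: "i \<in> hdegrees g" "hcomp i g * h \<notin> L"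
      using Max_in[OF fin \<open>?D \<noteq> {}\<close>] by (simp_all add: i_def)
    have above: "hcomp c g * h \<in> L" if "c > i" for c
      using mem_D[of c] Max_ge[OF fin, of c] that unfolding i_def by fastforce
    have "h \<noteq> 0" using less.prems(2) ideal_0[OF idL] by auto
    define e where "e = Max (hdegrees h)"
    have e: "e \<in> hdegrees h" "\<And>c. c > e \<Longrightarrow> hcomp c h = 0"
      using Max_in[of "hdegrees h"] Max_ge[of "hdegrees h"] \<open>h \<noteq> 0\<close>
      by (force simp: e_def hcomp_eq_0_iff)+
    have top: "hcomp i g * hcomp e h \<in> L"
    proof -
      have rest: "(\<Sum>c\<in>hdegrees g - {i}. hcomp c g * hcomp (i + e - c) h) \<in> L"
      proof (rule ideal_sum[OF idL])
        fix c assume "c \<in> hdegrees g - {i}"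
        then consider "c > i" | "i + e - c > e" by fastforce
        then show "hcomp c g * hcomp (i + e - c) h \<in> L"
        proof cases
          case 1
          then have "hcomp (i + e) (hcomp c g * h) \<in> L" using above graded_hcomp[OF L] by blast
          then show ?thesis by (simp add: hcomp_mult_homogeneous[OF homogeneous_hcomp])
        next
          case 2
          then show ?thesis using e(2)[OF 2] ideal_0[OF idL] by simp
        qed
      qed
      have "hcomp (i + e) (g * h) = hcomp i g * hcomp e h +
          (\<Sum>c\<in>hdegrees g - {i}. hcomp c g * hcomp (i + e - c) h)"
        unfolding hcomp_mult using i(1) by (simp add: sum.remove)
      then have "hcomp i g * hcomp e h =
          hcomp (i + e) (g * h) - (\<Sum>c\<in>hdegrees g - {i}. hcomp c g * hcomp (i + e - c) h)" by simp
      also have "\<dots> \<in> L" by (rule ideal_diff[OF idL graded_hcomp[OF L less.prems(1)] rest])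
      finally show ?thesis .
    qed
    define h' where "h' = hcomp i g * (h - hcomp e h)"
    have h'_eq: "h' = hcomp i g * h - hcomp i g * hcomp e h" by (simp add: h'_def algebra_simps)
    have "g * h' = hcomp i g * (g * h) - g * (hcomp i g * hcomp e h)"
      by (simp add: h'_eq algebra_simps)
    also have "\<dots> \<in> L"
      by (intro ideal_diff[OF idL] ideal_mult_left[OF idL] less.prems(1) top)
    finally have gh': "g * h' \<in> L" .
    have h'L: "h' \<notin> L"
    proof
      assume "h' \<in> L"
      then have "h' + hcomp i g * hcomp e h \<in> L" using top by (rule ideal_add[OF idL])
      then show False using i(2) by (simp add: h'_eq)
    qed
    have "hdegrees h' \<subseteq> (\<lambda>c. c + i) ` (hdegrees h - {e})"
    proof
      fix c assume "c \<in> hdegrees h'"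
      then have "hcomp i g * hcomp (c - i) (h - hcomp e h) \<noteq> 0"
        using hcomp_eq_0_iff[of c h'] by (simp add: h'_def hcomp_mult_homogeneous[OF homogeneous_hcomp])
      then have nz: "hcomp (c - i) (h - hcomp e h) \<noteq> 0" by auto
      have "c - i \<noteq> e" using nz by (auto simp: hcomp_diff hcomp_homogeneous[OF homogeneous_hcomp])
      moreover have "c - i \<in> hdegrees h"
        using nz \<open>c - i \<noteq> e\<close> hcomp_eq_0_iff[of "c - i" h]
        by (auto simp: hcomp_diff hcomp_homogeneous[OF homogeneous_hcomp])
      ultimately show "c \<in> (\<lambda>c. c + i) ` (hdegrees h - {e})" by (intro image_eqI[of _ _ "c - i"]) auto
    qed
    then have "card (hdegrees h') \<le> card ((\<lambda>c. c + i) ` (hdegrees h - {e}))"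
      by (rule card_mono[rotated]) simp
    also have "\<dots> \<le> card (hdegrees h - {e})" by (rule card_image_le) simp
    also have "\<dots> < card (hdegrees h)" using e(1) by (intro card_Diff1_less) simp_all
    finally show ?thesis using less.hyps gh' h'L by blast
  qed
qed

lemma graded_colon:
  assumes I: "graded I" and f: "homogeneous e f"
  shows "graded (colon I f)"
  unfolding graded_def
proof (intro conjI ballI allI)
  fix g d assume "g \<in> colon I f"
  then have "hcomp (d + e) (f * g) \<in> I" using graded_hcomp[OF I] by (simp add: colon_def mult.commute)
  then show "hcomp d g \<in> colon I f"
    by (simp add: colon_def hcomp_mult_homogeneous[OF f] mult.commute)
qed (rule is_ideal_colon[OF graded_ideal[OF I]])

section \<open>Zero-dimensional subschemes\<close>

lemma proj_zeros_homogeneous_elements: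
  assumes "graded P"
  shows "proj_zeros (P \<inter> homogeneous_elements) = proj_zeros P"
proof -
  have "P \<subseteq> Q" if Q: "Q \<in> Proj" "P \<inter> homogeneous_elements \<subseteq> Q" for Q
  proof
    fix f assume f: "f \<in> P"
    have "is_ideal Q" using Q(1) by (simp add: Proj_def is_prime_ideal_def)
    moreover have "hcomp d f \<in> Q" for d
    proof -
      have "hcomp d f \<in> homogeneous_elements"
        unfolding homogeneous_elements_def using homogeneous_hcomp by blast
      then show ?thesis using Q(2) graded_hcomp[OF assms f] by blast
    qed
    ultimately have "(\<Sum>d\<in>hdegrees f. hcomp d f) \<in> Q" by (rule ideal_sum)
    then show "f \<in> Q" by (simp add: sum_hcomp)
  qed
  then show ?thesis by (auto simp: proj_zeros_def)
qed

lemma topspace_proj_topology: "topspace proj_topology = Proj"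
proof
  show "topspace proj_topology \<subseteq> Proj"
    using openin_topspace[of proj_topology] unfolding openin_proj_topology by blast
  have "homogeneous 0 1" by simp
  then have "{1} \<subseteq> homogeneous_elements" unfolding homogeneous_elements_def by blast
  moreover have "proj_zeros {1} = {}" using prime_1 by (auto simp: proj_zeros_def Proj_def)
  ultimately have "openin proj_topology Proj" unfolding openin_proj_topology by (metis Diff_empty)
  then show "Proj \<subseteq> topspace proj_topology" by (rule openin_subset)
qed

lemma closedin_proj_topology:
  "closedin proj_topology C \<longleftrightarrow> (\<exists>S\<subseteq>homogeneous_elements. C = proj_zeros S)"
proof
  assume "closedin proj_topology C"
  then have "C \<subseteq> Proj" "openin proj_topology (Proj - C)"
    by (simp_all add: closedin_def topspace_proj_topology)
  then obtain S where S: "S \<subseteq> homogeneous_elements" "Proj - C = Proj - proj_zeros S"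
    unfolding openin_proj_topology by blast
  have "proj_zeros S \<subseteq> Proj" by (auto simp: proj_zeros_def)
  then have "C = proj_zeros S" using S(2) \<open>C \<subseteq> Proj\<close> by blast
  then show "\<exists>S\<subseteq>homogeneous_elements. C = proj_zeros S" using S(1) by blast
next
  assume "\<exists>S\<subseteq>homogeneous_elements. C = proj_zeros S"
  then show "closedin proj_topology C"
    unfolding closedin_def topspace_proj_topology openin_proj_topology
    by (auto simp: proj_zeros_def)
qed

text \<open>P is a generic point of its zero set: a closed set containing the point P contains all
  of \<open>proj_zeros P\<close>.\<close>

lemma irreducible_proj_zeros:
  fixes P :: "('n::finite, 'k::comm_ring_1) mpol set"
  assumes P: "P \<in> Proj" "I \<subseteq> P"
  defines "X \<equiv> subtopology proj_topology (proj_zeros I)"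
  shows "closedin X (proj_zeros P)" "irreducible_in X (proj_zeros P)"
proof -
  have sub: "proj_zeros P \<subseteq> proj_zeros I" using P(2) by (auto simp: proj_zeros_def)
  have "graded P" using P(1) by (simp add: Proj_def homogeneous_ideal_iff_graded)
  then have "closedin proj_topology (proj_zeros P)"
    unfolding closedin_proj_topology using proj_zeros_homogeneous_elements
    by (intro exI[of _ "P \<inter> homogeneous_elements"]) auto
  then show "closedin X (proj_zeros P)"
    unfolding X_def closedin_subtopology using sub by blast
  show "irreducible_in X (proj_zeros P)"
    unfolding irreducible_in_def
  proof (intro conjI allI impI)
    show "proj_zeros P \<subseteq> topspace X"
      using sub by (auto simp: X_def topspace_proj_topology proj_zeros_def)
    have mem: "P \<in> proj_zeros P" using P(1) by (simp add: proj_zeros_def)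
    then show "proj_zeros P \<noteq> {}" by blast
    fix C D assume *: "closedin X C \<and> closedin X D \<and> proj_zeros P \<subseteq> C \<union> D"
    have contains: "proj_zeros P \<subseteq> E" if E: "closedin X E" "P \<in> E" for E
    proof -
      obtain S where "E = proj_zeros S \<inter> proj_zeros I"
        using E(1) unfolding X_def closedin_subtopology closedin_proj_topology by blast
      then show ?thesis using E(2) by (auto simp: proj_zeros_def)
    qed
    have "P \<in> C \<or> P \<in> D" using * mem by blast
    then show "proj_zeros P \<subseteq> C \<or> proj_zeros P \<subseteq> D" using contains * by blast
  qed
qed

text \<open>A strict inclusion of primes would reverse to a strict chain of two irreducible closed
  subsets, forcing dimension at least 1.\<close>

lemma zero_dim_primes_incomparable:
  fixes P Q :: "('n::finite, 'k::comm_ring_1) mpol set"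
  assumes dim: "defines_zero_dim_subscheme I"
    and P: "is_prime_ideal P" "graded P" and Q: "is_prime_ideal Q" "graded Q"
    and sub: "I \<subseteq> P" "P \<subseteq> Q" and Qvar: "\<not> range variable \<subseteq> Q"
  shows "P = Q"
proof (rule ccontr)
  assume "P \<noteq> Q"
  have "range variable \<subseteq> (irrelevant_ideal :: ('n, 'k) mpol set)"
    unfolding irrelevant_ideal_def by (rule ring_module.span_superset)
  then have var: "\<not> irrelevant_ideal \<subseteq> Q" using Qvar by (meson subset_trans)
  then have QP: "Q \<in> Proj" using Q by (simp add: Proj_def homogeneous_ideal_iff_graded)
  have PP: "P \<in> Proj" using P var sub(2) by (auto simp: Proj_def homogeneous_ideal_iff_graded)
  let ?X = "subtopology proj_topology (proj_zeros I)"
  define Z where "Z i = (if i = 0 then proj_zeros Q else proj_zeros P)" for i :: nat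
  have "\<forall>i\<le>1. closedin ?X (Z i) \<and> irreducible_in ?X (Z i)"
    using irreducible_proj_zeros[OF PP sub(1)] irreducible_proj_zeros[OF QP, of I] sub
    by (simp add: Z_def)
  moreover have "\<forall>i<1. Z i \<subset> Z (Suc i)"
  proof -
    have "P \<in> proj_zeros P" "P \<notin> proj_zeros Q" using PP \<open>P \<noteq> Q\<close> sub(2) by (auto simp: proj_zeros_def)
    moreover have "proj_zeros Q \<subseteq> proj_zeros P" using sub(2) by (auto simp: proj_zeros_def)
    ultimately show ?thesis by (auto simp: Z_def)
  qed
  ultimately have "enat 1 \<le> krull_dimension ?X"
    unfolding krull_dimension_def by (intro Sup_upper CollectI exI[of _ 1] exI[of _ Z]) blast
  then show False using dim by (simp add: defines_zero_dim_subscheme_def zero_enat_def)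
qed

text \<open>Over a finite field, 1 plus the product of all X - x takes only the value 1 and has no
  root.\<close>

lemma infinite_alg_closed_field: "infinite (UNIV :: 'k::alg_closed_field set)"
proof
  assume fin: "finite (UNIV :: 'k set)"
  let ?p = "\<Prod>x\<in>(UNIV :: 'k set). [:- x, 1:]"
  have "degree ?p = card (UNIV :: 'k set)" by (simp add: degree_prod_eq_sum_degree)
  then have "degree (?p + 1) > 0"
    using fin by (subst degree_add_eq_left) (simp_all add: card_gt_0_iff)
  then obtain x where "poly (?p + 1) x = 0" using alg_closed_imp_poly_has_root by blast
  moreover have "poly ?p x = 0" using fin by (auto simp: poly_prod intro!: prod_zero)
  ultimately show False by simp
qed

text \<open>To avoid one more prime P, add a multiple c of a variable outside P. For each earlier
  prime Q at most one c is bad: two would put the variable, and then the old form, into Q. An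
  infinite field leaves a good c.\<close>

lemma linear_form_avoidance:
  fixes \<P> :: "('n::finite, 'k::field) mpol set set"
  assumes inf: "infinite (UNIV :: 'k set)" and "finite \<P>"
    and "\<And>P. P \<in> \<P> \<Longrightarrow> is_prime_ideal P \<and> \<not> range variable \<subseteq> P"
  shows "\<exists>a. \<forall>P\<in>\<P>. linear_form a \<notin> P"
  using assms(2,3)
proof (induction \<P> rule: finite_induct)
  case (insert P \<P>)
  then obtain a where a: "\<And>Q. Q \<in> \<P> \<Longrightarrow> linear_form a \<notin> Q" by auto
  show ?case
  proof (cases "linear_form a \<in> P")
    case True
    obtain i where i: "variable i \<notin> P" using insert.prems by blast
    define a' where "a' c j = a j + (if j = i then c else 0)" for c j
    let ?C = "\<lambda>c. Poly_Mapping.single 0 c :: ('n, 'k) mpol"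
    have a': "linear_form (a' c) = linear_form a + ?C c * variable i" for c
    proof -
      have "linear_form (a' c) = (\<Sum>j\<in>UNIV. ?C (a j) * variable j + (if j = i then ?C c * variable j else 0))"
        unfolding linear_form_def a'_def by (intro sum.cong refl) (auto simp: single_add algebra_simps)
      then show ?thesis by (simp add: sum.distrib linear_form_def)
    qed
    have unit: "g \<in> Q" if "is_ideal Q" "?C c * g \<in> Q" "c \<noteq> 0" for Q c g
      using ideal_mult_left[OF that(1,2), of "?C (inverse c)"] that(3)
      by (simp add: mult_single flip: mult.assoc)
    have "finite {c. linear_form (a' c) \<in> Q}" if Q: "Q \<in> \<P>" for Q
    proof -
      have idQ: "is_ideal Q" using insert.prems[of Q] Q by (auto simp: is_prime_ideal_def)
      have uniq: "c = c'" if c: "linear_form (a' c) \<in> Q" "linear_form (a' c') \<in> Q" for c c'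
      proof (rule ccontr)
        assume "c \<noteq> c'"
        have "linear_form (a' c) - linear_form (a' c') = ?C (c - c') * variable i"
          by (simp add: a' single_diff algebra_simps)
        then have "?C (c - c') * variable i \<in> Q" using ideal_diff[OF idQ c] by simp
        then have "variable i \<in> Q" using unit[OF idQ] \<open>c \<noteq> c'\<close> by auto
        then have "linear_form (a' c) - ?C c * variable i \<in> Q"
          by (intro ideal_diff[OF idQ] c(1) ideal_mult_left[OF idQ])
        then show False using a[OF Q] by (simp add: a')
      qed
      show ?thesis
      proof (cases "\<exists>c. linear_form (a' c) \<in> Q")
        case True
        then obtain c where "linear_form (a' c) \<in> Q" ..
        then have "{c. linear_form (a' c) \<in> Q} \<subseteq> {c}" using uniq by blast
        then show ?thesis by (rule finite_subset) simp
      qed simp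
    qed
    \<comment> \<open>The value 0 is excluded because it returns the old form, which lies in
      P.\<close>
    then have "finite (insert 0 (\<Union>Q\<in>\<P>. {c. linear_form (a' c) \<in> Q}))" using insert.hyps(1) by simp
    then obtain c where c: "c \<notin> insert 0 (\<Union>Q\<in>\<P>. {c. linear_form (a' c) \<in> Q})"
      using ex_new_if_finite[OF inf] by blast
    have idP: "is_ideal P" using insert.prems[of P] by (auto simp: is_prime_ideal_def)
    have "linear_form (a' c) \<notin> P"
    proof
      assume "linear_form (a' c) \<in> P"
      then have "linear_form (a' c) - linear_form a \<in> P" using True by (rule ideal_diff[OF idP])
      then have "?C c * variable i \<in> P" by (simp add: a')
      then show False using unit[OF idP] c i by blast
    qed
    then show ?thesis using c by (intro exI[of _ "a' c"]) blast
  qed (use a in blast)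
qed simp

section \<open>Powers of an ideal of regularity \<open>d\<close>\<close>

lemma monomial_split:
  fixes t :: "'n::finite \<Rightarrow>\<^sub>0 nat"
  assumes "m \<le> mon_degree t"
  obtains u v where "t = u + v" "mon_degree u = m"
proof -
  have "\<exists>u v. t = u + v \<and> mon_degree u = m"
    using assms
  proof (induction m)
    case 0
    show ?case by (intro exI[of _ 0] exI[of _ t]) simp
  next
    case (Suc m)
    then obtain u v where uv: "t = u + v" "mon_degree u = m" by auto
    then have "v \<noteq> 0" using Suc.prems by auto
    then obtain i where i: "Poly_Mapping.lookup v i \<noteq> 0" by (metis poly_mapping_eqI lookup_zero)
    define e where "e = Poly_Mapping.single i (1::nat)"
    have "v = e + (v - e)"
      using i by (intro poly_mapping_eqI)
        (auto simp: e_def lookup_add minus_poly_mapping.rep_eq lookup_single when_def)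
    then have "t = (u + e) + (v - e)" using uv(1) by (metis add.assoc)
    moreover have "mon_degree (u + e) = Suc m" using uv(2) by (simp add: e_def)
    ultimately show ?case by blast
  qed
  then show thesis using that by blast
qed

text \<open>Here \<open>d\<close> is a bound for the regularity read off the shifts. At least two
  variables put the first syzygies, of degree at most d + 1, within the range of
  \<open>sh_le\<close>.\<close>

locale resolved_ideal = graded_complex rk sh g + proper_homogeneous_ideal I
  for rk sh and g :: "nat \<Rightarrow> nat \<Rightarrow> ('n::{finite,linorder}, 'k::field) mvec" and I +
  fixes d :: int
  assumes rk_0: "rk 0 = 1" and sh_0: "sh 0 0 = 0"
    and I_eq: "I = {Poly_Mapping.lookup (phi 0 v) 0 | v. v \<in> free_mod (rk (Suc 0))}"
    and sh_le: "\<And>i p. i < CARD('n) \<Longrightarrow> p < rk (Suc i) \<Longrightarrow> sh (Suc i) p \<le> d + int i"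
    and card: "CARD('n) \<ge> 2"
begin

lemma phi_0_in_I: "Poly_Mapping.lookup (phi 0 v) 0 \<in> I"
proof -
  define w where "w = (\<Sum>q<rk (Suc 0). Poly_Mapping.single q (Poly_Mapping.lookup v q))"
  have w: "Poly_Mapping.lookup w q = (if q < rk (Suc 0) then Poly_Mapping.lookup v q else 0)" for q
    by (simp add: w_def lookup_sum lookup_single when_def)
  have "phi 0 v = phi 0 w" unfolding phi_def vlin_def by (intro sum.cong refl) (simp add: w)
  moreover have "w \<in> free_mod (rk (Suc 0))" by (simp add: free_mod_iff w)
  ultimately show ?thesis unfolding I_eq by auto
qed

lemma single_0_eqI: "v \<in> free_mod (rk 0) \<Longrightarrow> Poly_Mapping.lookup v 0 = f \<Longrightarrow> v = Poly_Mapping.single 0 f"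
  by (intro poly_mapping_eqI) (auto simp: free_mod_iff rk_0 lookup_single when_def)

lemma mem_I_iff: "f \<in> I \<longleftrightarrow> (\<exists>v\<in>free_mod (rk (Suc 0)). phi 0 v = Poly_Mapping.single 0 f)"
proof
  assume "f \<in> I"
  then obtain v where "v \<in> free_mod (rk (Suc 0))" "Poly_Mapping.lookup (phi 0 v) 0 = f"
    unfolding I_eq by blast
  then show "\<exists>v\<in>free_mod (rk (Suc 0)). phi 0 v = Poly_Mapping.single 0 f"
    using single_0_eqI[OF phi_free_mod] by blast
next
  assume "\<exists>v\<in>free_mod (rk (Suc 0)). phi 0 v = Poly_Mapping.single 0 f"
  then show "f \<in> I" using phi_0_in_I by (metis lookup_single_eq)
qed

lemma vhom_single_0: "homogeneous e f \<Longrightarrow> vhom (sh 0) e (Poly_Mapping.single 0 f)"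
  by (auto simp: vhom_def lookup_single when_def sh_0)

text \<open>The cokernel of \<open>phi 0\<close> is R/I.\<close>

lemma near_0_iff: "near 0 (adjoin {0} x) (Poly_Mapping.single 0 f) \<longleftrightarrow> f \<in> adjoin I x"
proof
  assume "near 0 (adjoin {0} x) (Poly_Mapping.single 0 f)"
  then obtain u where "Poly_Mapping.single 0 f - phi 0 u \<in> jvec (adjoin {0} x)" by (auto simp: near_def)
  then have "Poly_Mapping.lookup (Poly_Mapping.single 0 f - phi 0 u) 0 \<in> adjoin {0} x"
    unfolding jvec_def by blast
  then obtain c where "f - Poly_Mapping.lookup (phi 0 u) 0 = c * x"
    by (auto simp: adjoin_def lookup_minus)
  then have "f = Poly_Mapping.lookup (phi 0 u) 0 + c * x" by (simp add: algebra_simps)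
  then show "f \<in> adjoin I x" unfolding adjoin_def using phi_0_in_I by blast
next
  assume "f \<in> adjoin I x"
  then obtain j c where f: "f = j + c * x" "j \<in> I" by (auto simp: adjoin_def)
  obtain v where v: "v \<in> free_mod (rk (Suc 0))" "phi 0 v = Poly_Mapping.single 0 j"
    using f(2) mem_I_iff by blast
  have "Poly_Mapping.single 0 f - phi 0 v = Poly_Mapping.single 0 (c * x)"
    by (simp add: v(2) f(1) single_add)
  also have "\<dots> \<in> jvec (adjoin {0} x)"
    by (auto simp: jvec_def lookup_single when_def adjoin_def)
  finally show "near 0 (adjoin {0} x) (Poly_Mapping.single 0 f)" using v(1) by (auto simp: near_def)
qed

text \<open>As I is nonzero, some generator in the resolution is nonzero, and its degree is a shift
  at most d.\<close>

lemma alpha_le_d: "int (alpha I) \<le> d"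
proof -
  have "\<exists>q<rk (Suc 0). Poly_Mapping.lookup (g 0 q) 0 \<noteq> 0"
  proof (rule ccontr)
    assume *: "\<not> ?thesis"
    then have "Poly_Mapping.lookup (phi 0 v) 0 = 0" for v
      unfolding phi_def lookup_vlin by (intro sum.neutral) auto
    then have "I \<subseteq> {0}" unfolding I_eq by auto
    then show False using I_neq_0 ideal_0[OF ideal_I] by blast
  qed
  then obtain q where q: "q < rk (Suc 0)" "Poly_Mapping.lookup (g 0 q) 0 \<noteq> 0" by blast
  let ?f = "Poly_Mapping.lookup (g 0 q) 0"
  have "homogeneous (sh (Suc 0) q - sh 0 0) ?f" using cols_hom[OF q(1)] unfolding vhom_def by blast
  then have hom: "homogeneous (sh (Suc 0) q) ?f" by (simp add: sh_0)
  then have "sh (Suc 0) q \<ge> 0" using homogeneous_negative[OF hom] q(2) by force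
  moreover have "?f \<in> I"
    using phi_0_in_I[of "Poly_Mapping.single q 1"] q(1) by (simp add: phi_def vlin_single)
  ultimately have "alpha I \<le> nat (sh (Suc 0) q)" using q(2) hom by (intro alpha_le[of ?f]) simp_all
  then show ?thesis using sh_le[of 0 q] q(1) \<open>sh (Suc 0) q \<ge> 0\<close> by simp
qed

lemma d_pos: "d \<ge> 1"
  using alpha_le_d alpha_pos by simp

text \<open>The socle element is followed from index 0 to index N = CARD('n) - 1, starting modulo l
  and adding one variable per index. At the end all variables are zero and the shifts, at most d + N
  - 1, lie below the accumulated degree bound d + N.\<close>

lemma I_socle:
  assumes a: "a i0 \<noteq> 0" and regI: "\<And>f. linear_form a * f \<in> I \<Longrightarrow> f \<in> I"
    and f: "homogeneous e f" "e \<ge> d" and soc: "\<And>i. variable i * f \<in> adjoin I (linear_form a)"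
  shows "f \<in> adjoin I (linear_form a)"
proof -
  obtain y :: "nat \<Rightarrow> ('n, 'k) mpol" where y: "y 0 = linear_form a"
    "\<And>j. j \<ge> 1 \<Longrightarrow> \<exists>i. y j = variable i" "\<And>j. homogeneous 1 (y j)"
    "\<And>j f. j < CARD('n) \<Longrightarrow> y j * f \<in> seq_ideal y j \<Longrightarrow> f \<in> seq_ideal y j"
    "\<And>i. variable i \<in> seq_ideal y (CARD('n))"
    by (rule linear_form_regular_sequence[of a i0, OF a]) blast
  let ?N = "CARD('n) - 1"
  \<comment> \<open>This expresses regularity of l on R/I: if \<open>phi 0 v\<close> is l c, then c
    lies in I, and subtracting l times a lift of c from v leaves a syzygy.\<close>
  have ex1: "exact_mod (seq_ideal y 1) 0"
    unfolding exact_mod_def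
  proof (intro ballI impI)
    fix v assume v: "v \<in> free_mod (rk (Suc 0))" "phi 0 v \<in> jvec (seq_ideal y 1)"
    have "Poly_Mapping.lookup (phi 0 v) 0 \<in> seq_ideal y 1" using v(2) unfolding jvec_def by blast
    then obtain c where c: "Poly_Mapping.lookup (phi 0 v) 0 = linear_form a * c"
      by (auto simp: y(1) adjoin_def mult.commute)
    have "linear_form a * c \<in> I" unfolding c[symmetric] by (rule phi_0_in_I)
    then have "c \<in> I" by (rule regI)
    then obtain u where u: "u \<in> free_mod (rk (Suc 0))" "phi 0 u = Poly_Mapping.single 0 c"
      using mem_I_iff by blast
    have "phi 0 v = Poly_Mapping.single 0 (linear_form a * c)" by (rule single_0_eqI[OF phi_free_mod c])
    also have "\<dots> = vscale (linear_form a) (phi 0 u)"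
      unfolding u(2) by (intro poly_mapping_eqI) (simp add: lookup_single when_def)
    finally have "phi 0 (v - vscale (linear_form a) u) = 0" by (simp add: phi_diff phi_vscale)
    moreover have "v - vscale (linear_form a) u \<in> free_mod (rk (Suc 0))"
      using v(1) u(1) by (simp add: vec_module.subspace_diff vec_module.subspace_scale)
    ultimately obtain w where w: "w \<in> free_mod (rk (Suc (Suc 0)))"
        "phi (Suc 0) w = v - vscale (linear_form a) u"
      using phi_exact by blast
    have "linear_form a \<in> seq_ideal y 1" using mem_seq_ideal[of 0 1 y] y(1) by simp
    then have "vscale (linear_form a) u \<in> jvec (seq_ideal y 1)"
      by (rule jvec_vscale[OF is_ideal_seq_ideal])
    moreover have "v - phi (Suc 0) w = vscale (linear_form a) u" by (simp add: w(2))
    ultimately have "v - phi (Suc 0) w \<in> jvec (seq_ideal y 1)" by (simp only:)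
    then show "near (Suc 0) (seq_ideal y 1) v" using w(1) by (auto simp: near_def)
  qed
  \<comment> \<open>Descending induction on the index, always modulo one element more than the
    index.\<close>
  have "socle_vanishes (d + int (?N - k)) (?N - k) (seq_ideal y (Suc (?N - k)))" if "k \<le> ?N" for k
    using that
  proof (induction k)
    case 0
    show ?case
    proof (rule socle_vanishes_base)
      show "variable i \<in> seq_ideal y (Suc (?N - 0))" for i using y(5)[of i] card by simp
      fix p assume p: "p < rk (?N - 0)"
      \<comment> \<open>N is positive, so the shifts at index N are those of a syzygy module and
        bounded by d + N - 1.\<close>
      obtain N' where N': "?N = Suc N'" using card by (cases ?N) auto
      then have "sh ?N p \<le> d + int N'" using sh_le[of N' p] p by simp
      then show "sh (?N - 0) p < d + int (?N - 0)" using N' by simp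
    qed simp
  next
    case (Suc k)
    define j where "j = ?N - Suc k"
    have j: "Suc j = ?N - k" "Suc j < CARD('n)" using Suc.prems card by (auto simp: j_def)
    obtain i where i: "y (Suc j) = variable i" using y(2)[of "Suc j"] by auto
    have "socle_vanishes (d + int j) j (seq_ideal y (Suc j))"
    proof (rule socle_vanishes_step)
      show "graded (seq_ideal y (Suc j))" by (rule graded_seq_ideal[OF y(3)])
      show "f \<in> seq_ideal y (Suc j)" if "variable i * f \<in> seq_ideal y (Suc j)" for f
        using y(4)[OF j(2), of f] that i by simp
      \<comment> \<open>Exactness at index j + 1 modulo j + 1 elements is exactly the index gained
        by regularity of l on R/I.\<close>
      show "exact_mod (seq_ideal y (Suc j)) j"
        by (rule exact_mod_seq_ideal'[OF y(4) ex1 _ less_imp_le[OF j(2)]]) simp_all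
      have "socle_vanishes (d + int (Suc j)) (Suc j) (seq_ideal y (Suc (Suc j)))"
        using Suc by (simp add: j(1))
      then show "socle_vanishes (d + int j + 1) (Suc j) (adjoin (seq_ideal y (Suc j)) (variable i))"
        by (simp add: i add.assoc add.commute[of 1])
    qed
    then show ?case unfolding j_def .
  qed
  from this[of ?N] have soc0: "socle_vanishes d 0 (adjoin {0} (linear_form a))" by (simp add: y(1))
  have "near 0 (adjoin {0} (linear_form a)) (Poly_Mapping.single 0 f)"
  proof (rule soc0[unfolded socle_vanishes_def, rule_format, OF f(2)])
    show "Poly_Mapping.single 0 f \<in> free_mod (rk 0)" by (auto simp: free_mod_iff rk_0 lookup_single when_def)
    show "vhom (sh 0) e (Poly_Mapping.single 0 f)" by (rule vhom_single_0[OF f(1)])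
    fix i
    have "vscale (variable i) (Poly_Mapping.single 0 f) = Poly_Mapping.single 0 (variable i * f)"
      by (intro poly_mapping_eqI) (simp add: lookup_single when_def)
    then show "near 0 (adjoin {0} (linear_form a)) (vscale (variable i) (Poly_Mapping.single 0 f))"
      using soc[of i] by (simp add: near_0_iff)
  qed
  then show ?thesis by (simp add: near_0_iff)
qed

end

lemma homogeneous_set_prod_variables:
  "w \<in> set_prod (replicate k (range variable)) \<Longrightarrow> homogeneous (int k) (w :: ('n::finite, 'k::comm_ring_1) mpol)"
proof (induction k arbitrary: w)
  case (Suc k)
  then obtain i v where "w = variable i * v" "v \<in> set_prod (replicate k (range variable))" by auto
  then show ?case using homogeneous_mult[OF homogeneous_variable Suc.IH] by simp
qed simp

text \<open>\<open>primary\<close> says that I + (l) contains a power of the irrelevant ideal, so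
  that R/(I, l) has finite length.\<close>

locale resolved_ideal_parameter = resolved_ideal rk sh g I d
  for rk sh and g :: "nat \<Rightarrow> nat \<Rightarrow> ('n::{finite,linorder}, 'k::field) mvec" and I d +
  fixes lf :: "('n, 'k) mpol" and a :: "'n \<Rightarrow> 'k" and i0 :: 'n and K :: nat
  assumes ell: "lf = linear_form a" "a i0 \<noteq> 0" and ell_regular: "\<And>f. lf * f \<in> I \<Longrightarrow> f \<in> I"
    and primary: "set_prod (replicate K (range variable)) \<subseteq> adjoin I lf"
begin

lemma hom_ell: "homogeneous 1 lf"
  by (simp add: ell(1))

text \<open>All products of \<open>K\<close> variables multiply f into I + (l). Factors are stripped
  one at a time by \<open>I_socle\<close>, which applies because multiplication by variables only
  raises the degree.\<close>

lemma degree_ge_d: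
  assumes f: "homogeneous e f" "e \<ge> d"
  shows "f \<in> adjoin I lf"
proof -
  have id: "is_ideal (adjoin I lf)" by (rule is_ideal_adjoin[OF ideal_I])
  have "f \<in> adjoin I lf" if "\<And>w :: ('n, 'k) mpol. w \<in> set_prod (replicate k (range variable)) \<Longrightarrow> w * f \<in> adjoin I lf" for k
    using that
  proof (induction k)
    case 0
    then show ?case by simp
  next
    case (Suc k)
    show ?case
    proof (rule Suc.IH)
      fix w :: "('n, 'k) mpol" assume w: "w \<in> set_prod (replicate k (range variable))"
      have "variable i * (w * f) \<in> adjoin I lf" for i
      proof -
        have "variable i * w \<in> set_prod (replicate (Suc k) (range variable))" using w by auto
        from Suc.prems[OF this] show ?thesis by (simp only: mult.assoc)
      qed
      moreover have "homogeneous (int k + e) (w * f)"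
        by (rule homogeneous_mult[OF homogeneous_set_prod_variables[OF w] f(1)])
      ultimately show "w * f \<in> adjoin I lf"
        using I_socle[of a i0 "int k + e" "w * f"] ell(2) ell_regular f(2) by (simp add: ell(1))
    qed
  qed
  then show ?thesis using primary ideal_mult_right[OF id] by blast
qed

text \<open>Split each monomial into a factor of degree d and one of degree at least rd. Modulo l
  the first lies in I and the second in I^r.\<close>

lemma degree_ge_power:
  "homogeneous e f \<Longrightarrow> e \<ge> int r * d \<Longrightarrow> f \<in> adjoin (ideal_power I r) lf"
proof (induction r arbitrary: e f)
  case 0
  then show ?case using subset_adjoin[of UNIV lf] by auto
next
  case (Suc r)
  have id: "is_ideal (adjoin (ideal_power I (Suc r)) lf)" by (intro is_ideal_adjoin is_ideal_power)
  have mono: "Poly_Mapping.single t c \<in> adjoin (ideal_power I (Suc r)) lf"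
    if t: "int (mon_degree t) = e" for t c
  proof -
    have ed: "e \<ge> d + int r * d" using Suc.prems(2) by (simp add: algebra_simps)
    have "int r * d \<ge> 0" using d_pos by simp
    then have "nat d \<le> mon_degree t" using t ed by linarith
    then obtain u v where uv: "t = u + v" "mon_degree u = nat d" by (rule monomial_split)
    have "Poly_Mapping.single u 1 \<in> adjoin I lf"
      by (rule degree_ge_d[OF homogeneous_single]) (use uv(2) d_pos in simp)
    then obtain i x where ix: "Poly_Mapping.single u 1 = i + x * lf" "i \<in> I" by (auto simp: adjoin_def)
    have "Poly_Mapping.single v c \<in> adjoin (ideal_power I r) lf"
      by (rule Suc.IH[OF homogeneous_single]) (use uv t ed d_pos in simp)
    then obtain j z where jz: "Poly_Mapping.single v c = j + z * lf" "j \<in> ideal_power I r"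
      by (auto simp: adjoin_def)
    have "Poly_Mapping.single t c = Poly_Mapping.single u 1 * Poly_Mapping.single v c"
      by (simp add: mult_single uv(1))
    also have "\<dots> = i * j + (i * z + x * j + x * z * lf) * lf"
      unfolding ix(1) jz(1) by (simp add: algebra_simps)
    finally show ?thesis unfolding adjoin_def using ideal_power_mult[OF ix(2) jz(2)] by blast
  qed
  have "(\<Sum>t\<in>Poly_Mapping.keys f. Poly_Mapping.single t (Poly_Mapping.lookup f t)) \<in> adjoin (ideal_power I (Suc r)) lf"
    using Suc.prems(1) by (intro ideal_sum[OF id] mono) (simp add: homogeneous_def)
  then show ?case by (simp add: poly_mapping_sum_single)
qed

text \<open>I^(r+1) is I^r times I: expand the factor from I over the generators and move the other
  factor into the coefficients.\<close>

lemma ideal_power_Suc_lift: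
  "x \<in> ideal_power I (Suc r) \<Longrightarrow>
     \<exists>G\<in>free_mod (rk (Suc 0)). G \<in> jvec (ideal_power I r) \<and> phi 0 G = Poly_Mapping.single 0 x"
proof (induction rule: ideal_power_Suc_induct)
  case (mult a b)
  obtain v where v: "v \<in> free_mod (rk (Suc 0))" "phi 0 v = Poly_Mapping.single 0 a"
    using mult(1) mem_I_iff by blast
  have "phi 0 (vscale b v) = Poly_Mapping.single 0 (a * b)"
    unfolding phi_vscale v(2) by (intro poly_mapping_eqI) (simp add: lookup_single when_def mult.commute)
  moreover have "vscale b v \<in> jvec (ideal_power I r)" by (rule jvec_vscale[OF is_ideal_power mult(2)])
  moreover have "vscale b v \<in> free_mod (rk (Suc 0))" using v(1) by (simp add: vec_module.subspace_scale)
  ultimately show ?case by blast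
next
  case 0
  show ?case
    using vec_module.subspace_0[OF subspace_jvec[OF is_ideal_power]] vec_module.subspace_0[OF subspace_free_mod]
    by (intro bexI[of _ 0]) simp_all
next
  case (add x y)
  then obtain G H where "G \<in> free_mod (rk (Suc 0))" "G \<in> jvec (ideal_power I r)" "phi 0 G = Poly_Mapping.single 0 x"
    "H \<in> free_mod (rk (Suc 0))" "H \<in> jvec (ideal_power I r)" "phi 0 H = Poly_Mapping.single 0 y" by blast
  then show ?case
    using vec_module.subspace_add[OF subspace_jvec[OF is_ideal_power], of G I r H]
      vec_module.subspace_add[OF subspace_free_mod, of G "rk (Suc 0)" H]
    by (intro bexI[of _ "G + H"]) (simp_all add: phi_add single_add)
qed

text \<open>The syzygies of the generators of \<open>I\<close> have degree at most \<open>d + 1\<close>, so that their coefficients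
  in a relation of degree \<open>e + 1\<close> can be moved into \<open>ideal_power I r\<close> modulo \<open>lf\<close>.\<close>

lemma ell_cancel_power:
  "homogeneous e f \<Longrightarrow> e \<ge> int r * d \<Longrightarrow> lf * f \<in> ideal_power I r \<Longrightarrow> f \<in> ideal_power I r"
proof (induction r arbitrary: e f)
  case (Suc r)
  let ?J = "ideal_power I r"
  note gJ = graded_ideal_power[OF graded_I, of r]
  note S = subspace_jvec[OF is_ideal_power, of I r]
  note hom_f = Suc.prems(1)
  have "lf * f \<in> I" using Suc.prems(3) ideal_power_subset[OF ideal_I, of "Suc r"] by auto
  then have "f \<in> I" by (rule ell_regular)
  then obtain h0 where h0: "h0 \<in> free_mod (rk (Suc 0))" "phi 0 h0 = Poly_Mapping.single 0 f"
    using mem_I_iff by blast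
  define h where "h = vcomp (sh (Suc 0)) e h0"
  have h: "h \<in> free_mod (rk (Suc 0))" "vhom (sh (Suc 0)) e h" "phi 0 h = Poly_Mapping.single 0 f"
    using h0 vcomp_vhom[OF vhom_single_0[OF hom_f], of e]
    by (simp_all add: h_def vcomp_free_mod vcomp_phi[symmetric])
  have hom_lf: "homogeneous (e + 1) (lf * f)"
    using homogeneous_mult[OF hom_ell hom_f] by (simp add: add.commute)
  obtain G0 where G0: "G0 \<in> free_mod (rk (Suc 0))" "G0 \<in> jvec ?J"
      "phi 0 G0 = Poly_Mapping.single 0 (lf * f)"
    using ideal_power_Suc_lift[OF Suc.prems(3)] by blast
  define G where "G = vcomp (sh (Suc 0)) (e + 1) G0"
  have G: "G \<in> free_mod (rk (Suc 0))" "G \<in> jvec ?J" "vhom (sh (Suc 0)) (e + 1) G"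
      "phi 0 G = Poly_Mapping.single 0 (lf * f)"
    using G0 vcomp_vhom[OF vhom_single_0[OF hom_lf], of "e + 1"] jvec_vcomp[OF gJ]
    by (simp_all add: G_def vcomp_free_mod vcomp_phi[symmetric])
  \<comment> \<open>G and l h are two lifts of l f over the generators, so their difference is a
    syzygy.\<close>
  let ?D = "G - vscale lf h"
  have "vscale lf (Poly_Mapping.single 0 f) = Poly_Mapping.single 0 (lf * f)"
    by (intro poly_mapping_eqI) (simp add: lookup_single when_def)
  then have "phi 0 ?D = 0" by (simp add: phi_diff phi_vscale G(4) h(3))
  moreover have "?D \<in> free_mod (rk (Suc 0))"
    using G(1) h(1) by (simp add: vec_module.subspace_diff vec_module.subspace_scale)
  ultimately obtain A0 where A0: "A0 \<in> free_mod (rk (Suc (Suc 0)))" "phi (Suc 0) A0 = ?D"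
    using phi_exact by blast
  define A where "A = vcomp (sh (Suc (Suc 0))) (e + 1) A0"
  have "vcomp (sh (Suc 0)) (e + 1) ?D = ?D"
    by (simp add: vcomp_diff vcomp_vscale_homogeneous[OF hom_ell] vcomp_vhom[OF h(2)] vcomp_vhom[OF G(3)])
  then have A: "A \<in> free_mod (rk (Suc (Suc 0)))" "phi (Suc 0) A = ?D"
    using A0 by (simp_all add: A_def vcomp_free_mod vcomp_phi[symmetric])
  have "Poly_Mapping.lookup A q \<in> adjoin ?J lf" for q
  proof (cases "q < rk (Suc (Suc 0))")
    case True
    have "homogeneous (e + 1 - sh (Suc (Suc 0)) q) (Poly_Mapping.lookup A q)" by (simp add: A_def)
    \<comment> \<open>(r + 1)d + 1 - (d + 1) = rd: the extra degree of the syzygies is compensated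
      by the factor l.\<close>
    moreover have "e + 1 - sh (Suc (Suc 0)) q \<ge> int r * d"
      using sh_le[of "Suc 0" q] True card Suc.prems(2) by (simp add: algebra_simps)
    ultimately show ?thesis by (rule degree_ge_power)
  next
    case False
    then show ?thesis
      using A(1) ideal_0[OF is_ideal_adjoin[OF is_ideal_power]] by (simp add: free_mod_iff)
  qed
  then have "A \<in> jvec (adjoin ?J lf)" by (simp add: jvec_def)
  then obtain B where B: "B \<in> free_mod (rk (Suc (Suc 0)))" "A - vscale lf B \<in> jvec ?J"
    using jvec_adjoin[OF is_ideal_power _ A(1)] by blast
  \<comment> \<open>Adding a syzygy gives another lift of f. Now l times it is G - phi(A - l B),
    with entries in I^r, so the induction hypothesis cancels l entry by entry.\<close>
  define H where "H = vcomp (sh (Suc 0)) e (h + phi (Suc 0) B)"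
  have "vscale lf (h + phi (Suc 0) B) = G - phi (Suc 0) (A - vscale lf B)"
    by (simp add: phi_diff phi_vscale A(2) vec_module.scale_right_distrib)
  also have "\<dots> \<in> jvec ?J"
    by (rule vec_module.subspace_diff[OF S G(2) phi_jvec[OF is_ideal_power B(2)]])
  finally have "vcomp (sh (Suc 0)) (e + 1) (vscale lf (h + phi (Suc 0) B)) \<in> jvec ?J"
    by (rule jvec_vcomp[OF gJ])
  then have lH: "vscale lf H \<in> jvec ?J" by (simp add: vcomp_vscale_homogeneous[OF hom_ell] H_def)
  have H_free: "H \<in> free_mod (rk (Suc 0))"
    unfolding H_def using h(1) phi_free_mod by (intro vcomp_free_mod) (simp add: vec_module.subspace_add)
  have HJ: "Poly_Mapping.lookup H q \<in> ?J" for q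
  proof (cases "q < rk (Suc 0)")
    case True
    have "homogeneous (e - sh (Suc 0) q) (Poly_Mapping.lookup H q)" by (simp add: H_def)
    moreover have "e - sh (Suc 0) q \<ge> int r * d"
      using sh_le[of 0 q] True card Suc.prems(2) by (simp add: algebra_simps)
    moreover have "lf * Poly_Mapping.lookup H q \<in> ?J" using lH by (simp add: jvec_def)
    ultimately show ?thesis by (rule Suc.IH)
  next
    case False
    then show ?thesis using H_free ideal_0[OF is_ideal_power] by (simp add: free_mod_iff)
  qed
  have "phi 0 H = vcomp (sh 0) e (phi 0 (h + phi (Suc 0) B))" by (simp add: H_def vcomp_phi)
  also have "\<dots> = Poly_Mapping.single 0 f"
    using vcomp_vhom[OF vhom_single_0[OF hom_f], of e] by (simp add: phi_add h(3))
  finally have "f = Poly_Mapping.lookup (phi 0 H) 0" by simp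
  also have "\<dots> = (\<Sum>q<rk (Suc 0). Poly_Mapping.lookup H q * Poly_Mapping.lookup (g 0 q) 0)"
    by (simp add: phi_def lookup_vlin)
  also have "\<dots> \<in> ideal_power I (Suc r)"
  proof (rule ideal_sum[OF is_ideal_power])
    fix q assume "q \<in> {..<rk (Suc 0)}"
    then have "Poly_Mapping.lookup (g 0 q) 0 \<in> I"
      using phi_0_in_I[of "Poly_Mapping.single q 1"] by (simp add: phi_def vlin_single)
    from ideal_power_mult[OF this HJ[of q]]
    show "Poly_Mapping.lookup H q * Poly_Mapping.lookup (g 0 q) 0 \<in> ideal_power I (Suc r)"
      by (simp only: mult.commute)
  qed
  finally show ?case .
qed simp

lemma ell_power_cancel:
  "homogeneous e f \<Longrightarrow> e \<ge> int r * d \<Longrightarrow> lf ^ k * f \<in> ideal_power I r \<Longrightarrow> f \<in> ideal_power I r"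
proof (induction k arbitrary: e f)
  case (Suc k)
  have "homogeneous (1 + e) (lf * f)" by (rule homogeneous_mult[OF hom_ell Suc.prems(1)])
  moreover have "lf ^ k * (lf * f) \<in> ideal_power I r" using Suc.prems(3) by (simp add: mult_ac)
  moreover have "int r * d \<le> 1 + e" using Suc.prems(2) by simp
  ultimately have "lf * f \<in> ideal_power I r" using Suc.IH by blast
  then show ?case by (rule ell_cancel_power[OF Suc.prems(1,2)])
qed simp

end

section \<open>The upper bound for the resurgence\<close>

lemma linear_form_in_ideal: "is_ideal Q \<Longrightarrow> range variable \<subseteq> Q \<Longrightarrow> linear_form a \<in> Q"
  unfolding linear_form_def by (intro ideal_sum ideal_mult_left) auto

lemma not_zero_divisor_power_cancel:
  "s \<notin> zero_divisors_mod I \<Longrightarrow> s ^ k * f \<in> I \<Longrightarrow> f \<in> I"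
proof (induction k)
  case (Suc k)
  then have "s * (s ^ k * f) \<in> I" by (simp add: mult.assoc)
  then show ?case using Suc not_zero_divisor_cancel by blast
qed simp

text \<open>\<open>sat\<close> removes one factor from the products at a time.\<close>

lemma set_prod_replicate_annihilates:
  assumes sat: "\<And>u. (\<And>z. z \<in> V \<Longrightarrow> z * u \<in> I) \<Longrightarrow> u \<in> I"
    and "\<And>w. w \<in> set_prod (replicate k V) \<Longrightarrow> w * f \<in> I"
  shows "f \<in> I"
  using assms(2)
proof (induction k)
  case (Suc k)
  show ?case
  proof (rule Suc.IH)
    fix w assume w: "w \<in> set_prod (replicate k V)"
    show "w * f \<in> I"
    proof (rule sat)
      fix z assume "z \<in> V"
      then have "z * w \<in> set_prod (replicate (Suc k) V)" using w by auto
      from Suc.prems[OF this] show "z * (w * f) \<in> I" by (simp only: mult.assoc)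
    qed
  qed
qed simp

text \<open>Localizing at Q turns the factors other than Q into unit ideals. The element h collects
  one member outside Q from each of them, and n counts the occurrences of Q.\<close>

lemma set_prod_localize:
  assumes Q: "is_prime_ideal Q" and Ps: "\<And>P. P \<in> set Ps \<Longrightarrow> P \<subseteq> Q \<Longrightarrow> P = Q"
  shows "\<exists>h n. h \<notin> Q \<and> (\<forall>z\<in>Q. h * z ^ n \<in> set_prod Ps)"
  using Ps
proof (induction Ps)
  case Nil
  show ?case using prime_1[OF Q] by (intro exI[of _ 1] exI[of _ 0]) simp
next
  case (Cons P Ps)
  then obtain h n where h: "h \<notin> Q" "\<And>z. z \<in> Q \<Longrightarrow> h * z ^ n \<in> set_prod Ps" by auto
  show ?case
  proof (cases "P = Q")
    case True
    have "h * z ^ Suc n \<in> set_prod (P # Ps)" if z: "z \<in> Q" for z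
    proof -
      have "z * (h * z ^ n) \<in> set_prod (P # Ps)" using z h(2)[OF z] True by auto
      moreover have "h * z ^ Suc n = z * (h * z ^ n)" by (simp add: mult_ac)
      ultimately show ?thesis by (simp only:)
    qed
    then show ?thesis using h(1) by blast
  next
    case False
    then obtain p where p: "p \<in> P" "p \<notin> Q" using Cons.prems[of P] by auto
    have "(p * h) * z ^ n \<in> set_prod (P # Ps)" if z: "z \<in> Q" for z
      using p(1) h(2)[OF z] by (auto simp: mult.assoc)
    moreover have "p * h \<notin> Q" using prime_mult[OF Q] p(2) h(1) by blast
    ultimately show ?thesis by blast
  qed
qed

context proper_homogeneous_ideal
begin

text \<open>The proper ideal (I : u) contains all variables, so a multiplier s has a nonzero
  constant term. In degree n, s f is that constant times the component of f plus multiples of lower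
  components; induction on n solves for the components of f in the graded ideal I^m.\<close>

lemma unsaturated_symbolic_power:
  assumes u: "u \<notin> I" "\<And>i. variable i * u \<in> I"
  shows "symbolic_power I m = ideal_power I m"
proof
  show "ideal_power I m \<subseteq> symbolic_power I m" by (rule ideal_power_subset_symbolic[OF ideal_I I_neq_UNIV])
  show "symbolic_power I m \<subseteq> ideal_power I m"
  proof
    let ?J = "ideal_power I m"
    note gJ = graded_ideal_power[OF graded_I, of m]
    fix f assume "f \<in> symbolic_power I m"
    then obtain s where s: "s \<notin> zero_divisors_mod I" "s * f \<in> ?J"
      using symbolic_power_iff[OF ideal_I I_neq_UNIV] by blast
    let ?c = "Poly_Mapping.lookup s 0"
    have c: "?c \<noteq> 0"
    proof
      assume "?c = 0"
      then have "s \<in> colon I u"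
        using u(2) by (intro zero_constant_term_in_ideal[OF is_ideal_colon[OF ideal_I] _ \<open>?c = 0\<close>])
          (simp add: colon_def)
      then show False using s(1) u(1) by (auto simp: colon_def zero_divisors_mod_def)
    qed
    have hc: "hcomp 0 s = Poly_Mapping.single 0 ?c"
      using homogeneous_degree_0[OF homogeneous_hcomp[of 0 s]] by (simp add: lookup_hcomp)
    then have D: "0 \<in> hdegrees s" using c hcomp_eq_0_iff[of 0 s] by auto
    have comp: "hcomp (int n) f \<in> ?J" for n
    proof (induction n rule: less_induct)
      case (less n)
      have rest: "(\<Sum>e\<in>hdegrees s - {0}. hcomp e s * hcomp (int n - e) f) \<in> ?J"
      proof (rule ideal_sum[OF is_ideal_power])
        fix e assume e: "e \<in> hdegrees s - {0}"
        then have "e > 0" using hdegrees_nonneg[of e s] by auto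
        have "hcomp (int n - e) f \<in> ?J"
        proof (cases "int n - e < 0")
          case True
          then have "hcomp (int n - e) f = 0" using homogeneous_negative[OF homogeneous_hcomp] by blast
          then show ?thesis using ideal_0[OF is_ideal_power] by simp
        next
          case False
          then have "int (nat (int n - e)) = int n - e" "nat (int n - e) < n" using \<open>e > 0\<close> by auto
          then show ?thesis using less.IH by metis
        qed
        then show "hcomp e s * hcomp (int n - e) f \<in> ?J" by (rule ideal_mult_left[OF is_ideal_power])
      qed
      have "hcomp (int n) (s * f) = Poly_Mapping.single 0 ?c * hcomp (int n) f +
          (\<Sum>e\<in>hdegrees s - {0}. hcomp e s * hcomp (int n - e) f)"
        unfolding hcomp_mult using D by (simp add: sum.remove hc)
      then have "Poly_Mapping.single 0 ?c * hcomp (int n) f =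
          hcomp (int n) (s * f) - (\<Sum>e\<in>hdegrees s - {0}. hcomp e s * hcomp (int n - e) f)" by simp
      also have "\<dots> \<in> ?J" by (rule ideal_diff[OF is_ideal_power graded_hcomp[OF gJ s(2)] rest])
      finally have "Poly_Mapping.single 0 (inverse ?c) * (Poly_Mapping.single 0 ?c * hcomp (int n) f) \<in> ?J"
        by (rule ideal_mult_left[OF is_ideal_power])
      then show ?case using c by (simp add: mult_single flip: mult.assoc)
    qed
    show "f \<in> ?J"
    proof (rule graded_memI[OF gJ])
      fix e assume "e \<in> hdegrees f"
      then show "hcomp e f \<in> ?J" using comp[of "nat e"] hdegrees_nonneg[of e f] by simp
    qed
  qed
qed

text \<open>In dimension 0 such a Q is minimal over I, so some h outside Q satisfies h z^n in I for
  each z in Q. A nonzerodivisor z would put h into I and hence into Q.\<close>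

lemma zero_dim_prime_zero_divisors:
  assumes dim: "defines_zero_dim_subscheme I"
    and Q: "is_prime_ideal Q" "graded Q" "I \<subseteq> Q" "\<not> range variable \<subseteq> Q"
  shows "Q \<subseteq> zero_divisors_mod I"
proof
  fix z assume z: "z \<in> Q"
  obtain Ps where Ps: "\<forall>P\<in>set Ps. is_prime_ideal P \<and> graded P \<and> I \<subseteq> P" "set_prod Ps \<subseteq> I"
    using ex_prime_product[OF graded_I] by blast
  obtain h n where h: "h \<notin> Q" "\<forall>z\<in>Q. h * z ^ n \<in> set_prod Ps"
    using set_prod_localize[OF Q(1), of Ps] zero_dim_primes_incomparable[OF dim _ _ Q(1,2) _ _ Q(4)] Ps(1)
    by blast
  show "z \<in> zero_divisors_mod I"
  proof (rule ccontr)
    assume "z \<notin> zero_divisors_mod I"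
    moreover have "z ^ n * h \<in> I" using h(2) z Ps(2) by (auto simp: mult.commute)
    ultimately have "h \<in> I" by (rule not_zero_divisor_power_cancel)
    then show False using h(1) Q(3) by blast
  qed
qed

text \<open>The form l avoids those primes of a product inside I that omit some variable. In
  dimension 0 a graded prime over I and l then contains all variables. For the primes over (I : f)
  with f homogeneous this gives regularity through \<open>sat\<close>; for those over I + (l) it
  gives a power of the irrelevant ideal.\<close>

lemma ex_parameter:
  assumes dim: "defines_zero_dim_subscheme I" and inf: "infinite (UNIV :: 'k set)"
    and sat: "\<And>u. (\<And>i. variable i * u \<in> I) \<Longrightarrow> u \<in> I"
  obtains a i0 K where "a i0 \<noteq> 0" "\<And>f. linear_form a * f \<in> I \<Longrightarrow> f \<in> I"
    "set_prod (replicate K (range variable)) \<subseteq> adjoin I (linear_form a)"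
proof -
  obtain Ps where Ps: "\<forall>P\<in>set Ps. is_prime_ideal P \<and> graded P \<and> I \<subseteq> P" "set_prod Ps \<subseteq> I"
    using ex_prime_product[OF graded_I] by blast
  \<comment> \<open>Avoiding the zero ideal as well makes the linear form nonzero.\<close>
  define \<P> where "\<P> = insert {0} {P \<in> set Ps. \<not> range variable \<subseteq> P}"
  have primes: "is_prime_ideal P \<and> \<not> range variable \<subseteq> P" if P: "P \<in> \<P>" for P
  proof -
    have "is_prime_ideal {0 :: ('n, 'k) mpol}"
      by (auto simp: is_prime_ideal_def) (metis UNIV_I singletonD zero_neq_one)
    moreover have "variable undefined \<noteq> (0 :: ('n, 'k) mpol)" by (simp add: variable_def)
    then have "\<not> range variable \<subseteq> {0 :: ('n, 'k) mpol}" by blast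
    moreover have "P = {0} \<or> P \<in> set Ps \<and> \<not> range variable \<subseteq> P" using P unfolding \<P>_def by blast
    ultimately show ?thesis using Ps(1) by blast
  qed
  have "finite \<P>" by (simp add: \<P>_def)
  from linear_form_avoidance[OF inf this primes]
  obtain a where a: "\<And>P. P \<in> \<P> \<Longrightarrow> linear_form a \<notin> P" by blast
  let ?l = "linear_form a"
  have "?l \<noteq> 0" using a[of "{0}"] by (simp add: \<P>_def)
  have "\<exists>i. a i \<noteq> 0"
  proof (rule ccontr)
    assume "\<not> (\<exists>i. a i \<noteq> 0)"
    then show False using \<open>?l \<noteq> 0\<close> by (simp add: linear_form_def)
  qed
  then obtain i0 where i0: "a i0 \<noteq> 0" ..
  have not_in: "range variable \<subseteq> Q" if Q: "is_prime_ideal Q" "graded Q" "I \<subseteq> Q" "?l \<in> Q" for Q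
  proof (rule ccontr)
    assume var: "\<not> range variable \<subseteq> Q"
    obtain P where P: "P \<in> set Ps" "P \<subseteq> Q" using prime_contains_factor[OF Q(1)] Ps(2) Q(3) by blast
    then have "P = Q" using zero_dim_primes_incomparable[OF dim _ _ Q(1,2) _ P(2) var] Ps(1) by blast
    then have "Q \<in> \<P>" using P(1) var by (simp add: \<P>_def)
    then show False using a Q(4) by blast
  qed
  have reg: "f \<in> I" if f: "?l * f \<in> I" for f
  proof (rule graded_memI[OF graded_I])
    fix c
    have lf: "?l * hcomp c f \<in> I"
      using graded_hcomp[OF graded_I f, of "c + 1"]
      by (simp add: hcomp_mult_homogeneous[OF homogeneous_linear_form])
    let ?J = "colon I (hcomp c f)"
    obtain Qs where Qs: "\<forall>Q\<in>set Qs. is_prime_ideal Q \<and> graded Q \<and> ?J \<subseteq> Q" "set_prod Qs \<subseteq> ?J"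
      using ex_prime_product[OF graded_colon[OF graded_I homogeneous_hcomp]] by blast
    have "?l \<in> ?J" using lf by (simp add: colon_def)
    then have "range variable \<subseteq> Q" if "Q \<in> set Qs" for Q
      using not_in[of Q] Qs(1) that subset_colon[OF ideal_I, of "hcomp c f"] by blast
    then have sub: "set_prod (replicate (length Qs) (range variable)) \<subseteq> ?J"
      using set_prod_replicate_mono Qs(2) by (meson subset_trans)
    show "hcomp c f \<in> I"
    proof (rule set_prod_replicate_annihilates[of "range variable" I "length Qs"])
      show "u \<in> I" if "\<And>z. z \<in> range variable \<Longrightarrow> z * u \<in> I" for u using sat that by blast
      show "w * hcomp c f \<in> I" if "w \<in> set_prod (replicate (length Qs) (range variable))" for w
        using sub that by (auto simp: colon_def)
    qed
  qed
  have "graded (adjoin I ?l)" by (rule graded_adjoin[OF graded_I homogeneous_linear_form])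
  then obtain Qs where Qs: "\<forall>Q\<in>set Qs. is_prime_ideal Q \<and> graded Q \<and> adjoin I ?l \<subseteq> Q"
      "set_prod Qs \<subseteq> adjoin I ?l"
    using ex_prime_product by blast
  have "range variable \<subseteq> Q" if "Q \<in> set Qs" for Q
    using not_in[of Q] Qs(1) that subset_adjoin[of I ?l] mem_adjoin[OF ideal_I, of ?l] by blast
  then have "set_prod (replicate (length Qs) (range variable)) \<subseteq> adjoin I ?l"
    using set_prod_replicate_mono Qs(2) by (meson subset_trans)
  then show thesis using that i0 reg by blast
qed

text \<open>A graded prime over (I^r : f) contains s and, through r-th powers, I. Unless it
  contained all variables it would consist of zero divisors, which s is not; so it contains every
  linear form.\<close>

lemma not_zero_divisor_power_annihilates:
  assumes dim: "defines_zero_dim_subscheme I"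
    and s: "s \<notin> zero_divisors_mod I" "s * f \<in> ideal_power I r" and f: "homogeneous e f"
  shows "\<exists>k. linear_form a ^ k * f \<in> ideal_power I r"
proof -
  let ?J = "colon (ideal_power I r) f"
  obtain Qs where Qs: "\<forall>Q\<in>set Qs. is_prime_ideal Q \<and> graded Q \<and> ?J \<subseteq> Q" "set_prod Qs \<subseteq> ?J"
    using ex_prime_product[OF graded_colon[OF graded_ideal_power[OF graded_I] f]] by blast
  have "linear_form a \<in> Q" if "Q \<in> set Qs" for Q
  proof -
    have Q: "is_prime_ideal Q" "graded Q" "?J \<subseteq> Q" using Qs(1) that by auto
    have "s \<in> Q" using s(2) Q(3) by (auto simp: colon_def)
    have "I \<subseteq> Q"
    proof
      fix x assume "x \<in> I"
      then have "x ^ r \<in> ?J" using power_in_ideal_power subset_colon[OF is_ideal_power] by blast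
      then show "x \<in> Q" using prime_power_mem[OF Q(1)] Q(3) by blast
    qed
    then have "range variable \<subseteq> Q"
      using zero_dim_prime_zero_divisors[OF dim Q(1,2)] s(1) \<open>s \<in> Q\<close> by blast
    then show ?thesis using linear_form_in_ideal graded_ideal[OF Q(2)] by blast
  qed
  then have "linear_form a ^ length Qs \<in> set_prod Qs" by (rule power_in_set_prod)
  then show ?thesis using Qs(2) by (auto simp: colon_def)
qed

lemma symbolic_power_zero_dim:
  assumes dim: "defines_zero_dim_subscheme I" and reg: "\<And>f. linear_form a * f \<in> I \<Longrightarrow> f \<in> I"
  shows "symbolic_power I m = {f. \<exists>k. linear_form a ^ k * f \<in> ideal_power I m}" (is "_ = ?L")
    and "graded (symbolic_power I m)"
proof -
  let ?l = "linear_form a" and ?J = "ideal_power I m"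
  note gJ = graded_ideal_power[OF graded_I, of m]
  have lift: "?l ^ (k + k') * f \<in> ?J" if "?l ^ k * f \<in> ?J" for k k' f
    using ideal_mult_left[OF is_ideal_power that, of "?l ^ k'"] by (simp add: power_add mult_ac)
  have gL: "graded ?L"
    unfolding graded_def
  proof (intro conjI ballI allI)
    show "is_ideal ?L"
    proof (rule is_idealI)
      show "0 \<in> ?L" using ideal_0[OF is_ideal_power] by simp
      fix f g assume "f \<in> ?L"
      then obtain k where k: "?l ^ k * f \<in> ?J" by blast
      have "?l ^ k * (g * f) \<in> ?J"
        using ideal_mult_left[OF is_ideal_power k, of g] by (simp add: mult.left_commute)
      then show "g * f \<in> ?L" by blast
      assume "g \<in> ?L"
      then obtain k' where k': "?l ^ k' * g \<in> ?J" by blast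
      have "?l ^ (k + k') * (f + g) = ?l ^ (k + k') * f + ?l ^ (k' + k) * g"
        by (simp add: distrib_left add.commute)
      then have "?l ^ (k + k') * (f + g) \<in> ?J"
        using ideal_add[OF is_ideal_power lift[OF k] lift[OF k']] by metis
      then show "f + g \<in> ?L" by blast
    qed
    fix f d assume "f \<in> ?L"
    then obtain k where k: "?l ^ k * f \<in> ?J" by blast
    have "homogeneous (int k) (?l ^ k)" using homogeneous_power[OF homogeneous_linear_form] by fastforce
    then have "hcomp (d + int k) (?l ^ k * f) = ?l ^ k * hcomp d f"
      by (simp add: hcomp_mult_homogeneous)
    then show "hcomp d f \<in> ?L" using graded_hcomp[OF gJ k] by (metis (mono_tags) mem_Collect_eq)
  qed
  have "f \<in> ?L" if f: "f \<in> symbolic_power I m" for f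
  proof (rule ccontr)
    assume fL: "f \<notin> ?L"
    obtain s where s: "s \<notin> zero_divisors_mod I" "s * f \<in> ?J"
      using f symbolic_power_iff[OF ideal_I I_neq_UNIV] by blast
    have "s * f \<in> ?L" using s(2) by (intro CollectI exI[of _ 0]) simp
    \<comment> \<open>The multiplier s need not be homogeneous. Since \<open>?L\<close> is graded,
      the element it multiplies into \<open>?L\<close> can at least be replaced by a homogeneous
      one.\<close>
    then obtain h e where h: "homogeneous e h" "h \<notin> ?L" "s * h \<in> ?L"
      using graded_zero_divisor[OF gL _ fL] by blast
    obtain k where k: "?l ^ k * (s * h) \<in> ?J" using h(3) by blast
    then have "s * (?l ^ k * h) \<in> ?J" by (simp add: mult.left_commute)
    moreover have "homogeneous (int k * 1 + e) (?l ^ k * h)"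
      by (intro homogeneous_mult homogeneous_power homogeneous_linear_form h(1))
    ultimately obtain k' where "?l ^ k' * (?l ^ k * h) \<in> ?J"
      using not_zero_divisor_power_annihilates[OF dim s(1)] by blast
    then have "?l ^ (k' + k) * h \<in> ?J" by (simp add: power_add mult.assoc)
    then show False using h(2) by blast
  qed
  moreover have "f \<in> symbolic_power I m" if f: "f \<in> ?L" for f
  proof -
    obtain k where k: "?l ^ k * f \<in> ?J" using f by blast
    have "?l \<notin> zero_divisors_mod I" using reg by (auto simp: zero_divisors_mod_def)
    from not_zero_divisor_power_cancel[OF this, of k]
    have "?l ^ k \<notin> zero_divisors_mod I" unfolding zero_divisors_mod_def by blast
    then show ?thesis using k symbolic_power_iff[OF ideal_I I_neq_UNIV] by blast
  qed
  ultimately show eq: "symbolic_power I m = ?L" by blast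
  show "graded (symbolic_power I m)" unfolding eq by (rule gL)
qed

end

context resolved_ideal
begin

lemma symbolic_power_subset_ideal_power:
  assumes dim: "defines_zero_dim_subscheme I" and inf: "infinite (UNIV :: 'k set)"
    and sat: "\<And>u. (\<And>i. variable i * u \<in> I) \<Longrightarrow> u \<in> I"
    and mr: "r \<le> m" "int r * d \<le> int (alpha (symbolic_power I m))"
  shows "symbolic_power I m \<subseteq> ideal_power I r"
proof -
  obtain a i0 K where a: "a i0 \<noteq> 0" "\<And>f. linear_form a * f \<in> I \<Longrightarrow> f \<in> I"
    "set_prod (replicate K (range variable)) \<subseteq> adjoin I (linear_form a)"
    using ex_parameter[OF dim inf sat] by blast
  interpret resolved_ideal_parameter rk sh g I d "linear_form a" a i0 K
    using a by unfold_locales auto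
  note sym = symbolic_power_zero_dim[OF dim a(2), where m = m]
  show ?thesis
  proof
    fix f assume f: "f \<in> symbolic_power I m"
    show "f \<in> ideal_power I r"
    proof (rule graded_memI[OF graded_ideal_power[OF graded_I]])
      fix c assume c: "c \<in> hdegrees f"
      then have nz: "hcomp c f \<noteq> 0" by (simp add: hcomp_eq_0_iff)
      have fc: "hcomp c f \<in> symbolic_power I m" by (rule graded_hcomp[OF sym(2) f])
      have "int (nat c) = c" using hdegrees_nonneg[OF c] by simp
      then have "alpha (symbolic_power I m) \<le> nat c"
        using alpha_le[OF fc nz, of "nat c"] homogeneous_hcomp[of c f] by simp
      then have "int r * d \<le> c" using mr(2) \<open>int (nat c) = c\<close> by linarith
      moreover obtain k where "linear_form a ^ k * hcomp c f \<in> ideal_power I m" using fc sym(1) by blast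
      then have "linear_form a ^ k * hcomp c f \<in> ideal_power I r" using ideal_power_antimono[OF mr(1)] by blast
      ultimately show "hcomp c f \<in> ideal_power I r" by (rule ell_power_cancel[OF homogeneous_hcomp])
    qed
  qed
qed

lemma resurgence_upper_bound:
  assumes dim: "defines_zero_dim_subscheme I" and inf: "infinite (UNIV :: 'k set)"
  shows "resurgence I \<le> ereal (real_of_int d / gamma I)"
  unfolding resurgence_def
proof (rule Sup_least)
  fix x assume "x \<in> {ereal (real m / real r) | m r. m \<ge> 1 \<and> r \<ge> 1 \<and> \<not> symbolic_power I m \<subseteq> ideal_power I r}"
  then obtain m r where mr: "x = ereal (real m / real r)" "m \<ge> 1" "r \<ge> 1"
    "\<not> symbolic_power I m \<subseteq> ideal_power I r" by blast
  have "gamma I \<le> real_of_int d" using gamma_le_alpha alpha_le_d by linarith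
  have "real m * gamma I \<le> real r * real_of_int d"
  proof (cases "\<forall>u. (\<forall>i. variable i * u \<in> I) \<longrightarrow> u \<in> I")
    case False
    \<comment> \<open>With equal powers, failure of the containment forces m < r, and gamma(I) <=
      alpha(I) <= d gives the estimate.\<close>
    then have "symbolic_power I m = ideal_power I m" using unsaturated_symbolic_power by blast
    then have "m < r" using mr(4) ideal_power_antimono[of r m I] by (metis not_le)
    then show ?thesis
      using \<open>gamma I \<le> real_of_int d\<close> gamma_ge_1 by (intro mult_mono) auto
  next
    case True
    show ?thesis
    proof (rule ccontr)
      assume "\<not> real m * gamma I \<le> real r * real_of_int d"
      then have lt: "real r * real_of_int d < real m * gamma I" by simp
      \<comment> \<open>Comparing m gamma(I) > rd >= r gamma(I) yields r <= m, needed for I^m to lie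
        in I^r.\<close>
      have "real r * gamma I \<le> real r * real_of_int d"
        using \<open>gamma I \<le> real_of_int d\<close> by (intro mult_left_mono) auto
      then have "real r * gamma I < real m * gamma I" using lt by linarith
      then have "r \<le> m" using gamma_ge_1 by simp
      have "real m * gamma I \<le> real (alpha (symbolic_power I m))"
        using gamma_le[OF mr(2)] mr(2) by (simp add: field_simps)
      then have "real_of_int (int r * d) \<le> real_of_int (int (alpha (symbolic_power I m)))" using lt by simp
      then have "int r * d \<le> int (alpha (symbolic_power I m))" by linarith
      then have "symbolic_power I m \<subseteq> ideal_power I r"
        using symbolic_power_subset_ideal_power[OF dim inf _ \<open>r \<le> m\<close>] True by blast
      then show False using mr(4) by blast
    qed
  qed
  then have "real m / real r \<le> real_of_int d / gamma I"
    using mr(3) gamma_ge_1 by (simp add: field_simps)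
  then show "x \<le> ereal (real_of_int d / gamma I)" by (simp add: mr(1))
qed

end

theorem theorem1p2p1:
  fixes I :: "('n::{finite,linorder}, 'k::alg_closed_field) mpol set"
  assumes "CARD('n) \<ge> 2"
    and "homogeneous_ideal I" and "I \<noteq> {0}" and "I \<noteq> UNIV"
  shows "ereal (real (alpha I) / gamma I) \<le> resurgence I \<and>
    (defines_zero_dim_subscheme I \<longrightarrow>
       resurgence I \<le> ereal (real_of_int (regularity I) / gamma I))"
proof -
  interpret proper_homogeneous_ideal I
    using assms(2-4) by unfold_locales (simp_all add: homogeneous_ideal_iff_graded)
  obtain rk sh g where res: "graded_complex rk sh g" "rk 0 = 1" "sh 0 0 = 0"
    "I = {Poly_Mapping.lookup (vlin (rk 1) (g 0) v) 0 | v. v \<in> free_mod (rk 1)}"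
    "\<And>i p. i < CARD('n) \<Longrightarrow> p < rk (Suc i) \<Longrightarrow> sh (Suc i) p \<le> regularity I + int i"
    by (rule regularity_complex[OF graded_I]) blast
  interpret C: graded_complex rk sh g by (rule res(1))
  interpret resolved_ideal rk sh g I "regularity I"
    using res(2,3,5) assms(1) res(4) by unfold_locales (simp_all add: C.phi_def)
  show ?thesis
    using resurgence_lower_bound resurgence_upper_bound[OF _ infinite_alg_closed_field] by blast
qed

end
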